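(* Let $N\in\mathbb N$ and $\tau,\epsilon\in(0,1]$. Let $\mu$ be a probability measure over $N$-dimensional pure states that forms an additive $\epsilon$-approximate projective $4$-design. Then for every Hermitian $O\in\mathbb C^{N^2\times N^2}$ with $\|O\|_{\mathrm{op}}\le1$, $$\mathrm{Var}_{\rho\sim\mu}\left[\mathrm{tr}[(\rho\otimes\rho)O]\right]=O(N^{-1})+\epsilon+\epsilon^2.$$ In particular, for the query complexity of non-trivial learning from $\mathtt{2QStat}$, $q_{\mathrm{nt}}[\mu^{\odot2},\tau]\ge\Omega(\tau^2N)$ if $\epsilon=O(N^{-1})$, and $q_{\mathrm{nt}}[\mu^{\odot2},\tau]\ge\Omega(\tau^2\epsilon^{-1})$ if $\epsilon=\omega(N^{-1})$.
   Context: Identify pure states with unit vectors $|\psi\rangle$ on the complex unit sphere $\mathbb S^{N-1}\subset\mathbb C^N$, $\rho=|\psi\rangle\langle\psi|$. For a measure $\nu$ on the sphere, $K^{(t)}_\nu=\mathbb E_{\psi\sim\nu}[(|\psi\rangle\langle\psi|)^{\otimes t}]$. $\mu$ is an additive $\epsilon$-approximate projective $t$-design if $\|K^{(s)}_\mu-K^{(s)}_{\mathrm{Haar}}\|_{\mathrm{tr}}\le\epsilon$ for all $s\le t$, with Haar the uniform measure on the sphere. $\mathtt{2QStat}_\tau(\rho)=\mathtt{QStat}_\tau(\rho\otimes\rho)$: queried with Hermitian $O$ on $\mathbb C^{N}\otimes\mathbb C^N$ with $\|O\|_{\mathrm{op}}\le1$, it returns $v$ with $|v-\mathrm{tr}[(\rho\otimes\rho)O]|\le\tau$.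 $\mu^{\odot2}$ denotes the image of $\mu$ under $\rho\mapsto\rho\otimes\rho$. The query complexity of non-trivial learning is $q_{\mathrm{nt}}[\mu^{\odot2},\tau]=\sup_g\big(\sup_O\Pr_{\rho\sim\mu}[|\mathrm{tr}[(\rho\otimes\rho)O]-g(O)|>\tau]\big)^{-1}$, with $O$ ranging over Hermitian operators with $\|O\|_{\mathrm{op}}\le1$ and $g$ over real-valued functions on that set. Asymptotic notation refers to $N\to\infty$.
   Formalization: The variance bound is proved as Var ≤ C(1/N + ε + ε²) with an absolute constant C; with coefficient 1 on ε it fails, e.g. for O = I − 2|00⟩⟨00| and μ = (1−ε/2)Haar + (ε/2)δ_{|0⟩}, where Var → 2ε − ε² > ε + ε² for ε < 1/2. *)

theory Defs
  imports "HOL-Probability.Probability" "HOL-Library.Landau_Symbols" "Jordan_Normal_Form.Matrix"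
begin

definition mtrace :: "complex mat \<Rightarrow> complex" where
  "mtrace A = (\<Sum>i<dim_row A. A $$ (i, i))"

definition madj :: "complex mat \<Rightarrow> complex mat" where
  "madj A = mat (dim_col A) (dim_row A) (\<lambda>(i, j). cnj (A $$ (j, i)))"

definition hermitian :: "nat \<Rightarrow> complex mat \<Rightarrow> bool" where
  "hermitian n A \<longleftrightarrow> A \<in> carrier_mat n n \<and> madj A = A"

definition unitary :: "nat \<Rightarrow> complex mat \<Rightarrow> bool" where
  "unitary n U \<longleftrightarrow> U \<in> carrier_mat n n \<and> U * madj U = 1\<^sub>m n"

definition cvec_norm :: "complex vec \<Rightarrow> real" where
  "cvec_norm v = sqrt (\<Sum>i<dim_vec v. (cmod (v $ i))\<^sup>2)"

definition op_norm :: "complex mat \<Rightarrow> real" where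
  "op_norm A = Sup {cvec_norm (A *\<^sub>v v) | v. v \<in> carrier_vec (dim_col A) \<and> cvec_norm v = 1}"

definition psd :: "nat \<Rightarrow> complex mat \<Rightarrow> bool" where
  "psd n P \<longleftrightarrow> hermitian n P \<and>
     (\<forall>v \<in> carrier_vec n. 0 \<le> Re (\<Sum>i<n. cnj (v $ i) * (P *\<^sub>v v) $ i))"

definition psd_sqrt :: "complex mat \<Rightarrow> complex mat" where
  "psd_sqrt B = (THE P. psd (dim_row B) P \<and> P * P = B)"

definition trace_norm :: "complex mat \<Rightarrow> real" where
  "trace_norm A = Re (mtrace (psd_sqrt (madj A * A)))"

definition kron :: "complex mat \<Rightarrow> complex mat \<Rightarrow> complex mat" where
  "kron A B = mat (dim_row A * dim_row B) (dim_col A * dim_col B)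
     (\<lambda>(i, j). A $$ (i div dim_row B, j div dim_col B) * B $$ (i mod dim_row B, j mod dim_col B))"

fun mat_tpow :: "nat \<Rightarrow> complex mat \<Rightarrow> complex mat" where
  "mat_tpow 0 A = 1\<^sub>m 1"
| "mat_tpow (Suc s) A = kron A (mat_tpow s A)"

text \<open>Vectors of \<open>\<complex>^N\<close> are represented as functions \<open>nat \<Rightarrow> complex\<close> vanishing
  outside \<open>{..<N}\<close>; the ambient space carries the product (Borel) topology.\<close>
definition pure_states :: "nat \<Rightarrow> (nat \<Rightarrow> complex) set" where
  "pure_states N = {\<psi>. (\<forall>i\<ge>N. \<psi> i = 0) \<and> (\<Sum>i<N. (cmod (\<psi> i))\<^sup>2) = 1}"

definition state_space :: "nat \<Rightarrow> (nat \<Rightarrow> complex) measure" where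
  "state_space N = restrict_space borel (pure_states N)"

definition rho :: "nat \<Rightarrow> (nat \<Rightarrow> complex) \<Rightarrow> complex mat" where
  "rho N \<psi> = mat N N (\<lambda>(i, j). \<psi> i * cnj (\<psi> j))"

definition act :: "nat \<Rightarrow> complex mat \<Rightarrow> (nat \<Rightarrow> complex) \<Rightarrow> (nat \<Rightarrow> complex)" where
  "act N U \<psi> = (\<lambda>i. if i < N then (U *\<^sub>v vec N \<psi>) $ i else 0)"

definition haar :: "nat \<Rightarrow> (nat \<Rightarrow> complex) measure" where
  "haar N = (THE M. prob_space M \<and> sets M = sets (state_space N) \<and>
      (\<forall>U. unitary N U \<longrightarrow> distr M M (act N U) = M))"

definition is_state_measure :: "nat \<Rightarrow> (nat \<Rightarrow> complex) measure \<Rightarrow> bool" where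
  "is_state_measure N M \<longleftrightarrow> prob_space M \<and> sets M = sets (state_space N)"

definition moment :: "nat \<Rightarrow> (nat \<Rightarrow> complex) measure \<Rightarrow> nat \<Rightarrow> complex mat" where
  "moment N M t = mat (N ^ t) (N ^ t)
     (\<lambda>(i, j). \<integral>\<psi>. (mat_tpow t (rho N \<psi>)) $$ (i, j) \<partial>M)"

definition approx_design :: "nat \<Rightarrow> (nat \<Rightarrow> complex) measure \<Rightarrow> nat \<Rightarrow> real \<Rightarrow> bool" where
  "approx_design N M t \<epsilon> \<longleftrightarrow>
     (\<forall>s\<le>t. trace_norm (moment N M s - moment N (haar N) s) \<le> \<epsilon>)"

definition observables :: "nat \<Rightarrow> complex mat set" where
  "observables N = {A. hermitian (N * N) A \<and> op_norm A \<le> 1}"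

definition two_copy_val :: "nat \<Rightarrow> complex mat \<Rightarrow> (nat \<Rightarrow> complex) \<Rightarrow> real" where
  "two_copy_val N A \<psi> = Re (mtrace (kron (rho N \<psi>) (rho N \<psi>) * A))"

text \<open>\<open>q_nt[\<mu>^{\<odot>2}, \<tau>] = sup_g (sup_O Pr[|tr((\<rho>\<otimes>\<rho>)O) - g(O)| > \<tau>])^{-1}\<close>,
  valued in the extended reals (inverse of 0 is \<open>\<infinity>\<close>).\<close>
definition q_nt2 :: "nat \<Rightarrow> (nat \<Rightarrow> complex) measure \<Rightarrow> real \<Rightarrow> ereal" where
  "q_nt2 N M \<tau> = (SUP g :: complex mat \<Rightarrow> real.
      inverse (SUP A \<in> observables N.
        ereal (measure M {\<psi> \<in> space M. \<bar>two_copy_val N A \<psi> - g A\<bar> > \<tau>})))"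

end

theory Submission
  imports Defs "Jordan_Normal_Form.Schur_Decomposition"
begin

text \<open>Against an operator of norm at most one, the trace norm bounds the difference between the second and
  fourth moments of the design and those of the uniform measure, so it suffices to bound the variance of
  \<open>f(\<psi>) = \<langle>\<psi>\<psi>|A|\<psi>\<psi>\<rangle>\<close> under the uniform measure. Unitary invariance yields, for a polynomial \<open>G\<close> of degree \<open>l\<close> in the
  conjugate variables, the integration by parts \<open>(N + l) E[cnj \<psi>\<^sub>p G] = E[\<partial>\<^sub>p G]\<close>. Applied four times, it
  expresses \<open>E[f]\<close> and \<open>E[f\<^sup>2]\<close> through the same trace up to gradient terms that are bounded because \<open>A\<close> is a
  contraction, whence \<open>Var f \<le> 6 / N\<close>. Chebyshev's inequality with \<open>g(A) = E[f]\<close> gives the query bounds. The uniform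
  measure itself is the normalised image of Lebesgue measure on a ball; it is the only invariant one.\<close>

section \<open>Hermitian matrices\<close>

text \<open>Three objects in the statement are given by a definite description or a supremum and say
  nothing until they are pinned down. \<open>haar\<close> needs an invariant measure to exist and to
  be unique; \<open>psd_sqrt\<close>, hence \<open>trace_norm\<close>, needs uniqueness of positive
  square roots, obtained here from a spectral theorem for Hermitian matrices; \<open>op_norm\<close>
  needs a boundedness argument. The textbook form of the fourth uniform moment is a sum over 24
  permutations, each giving a trace to estimate. Integration by parts avoids that list: peeling off
  one conjugate coordinate at a time leaves one main term and two error integrals. With
  \<open>m = E[f]\<close> and \<open>S = E[f^2]\<close> it gives
  \<open>(N+2)(N+3) S = N(N+1) m^2 + E[r'] + (N+2) E[r]\<close>, where \<open>|r| \<le> 2\<close>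
  and \<open>|r'| \<le> 4 N\<close>; this is the source of \<open>6 / N\<close>. Passing to the
  design costs \<open>\<epsilon>\<close> for the mean square of the observable value and
  \<open>2 \<epsilon>\<close> for the square of its mean, so the working bound is
  \<open>6 / N + 3 \<epsilon>\<close>.\<close>

lemma mat_mult_index:
  assumes "A \<in> carrier_mat n m" "B \<in> carrier_mat m k" "i < n" "j < k"
  shows "(A * B) $$ (i, j) = (\<Sum>l<m. A $$ (i, l) * B $$ (l, j))"
  using assms by (simp add: scalar_prod_def atLeast0LessThan)

lemma mat_vec_mult_index:
  assumes "A \<in> carrier_mat n m" "v \<in> carrier_vec m" "i < n"
  shows "(A *\<^sub>v v) $ i = (\<Sum>l<m. A $$ (i, l) * v $ l)"
  using assms by (simp add: mult_mat_vec_def scalar_prod_def atLeast0LessThan)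

lemma mtrace_mult_comm:
  assumes "A \<in> carrier_mat n n" "B \<in> carrier_mat n n"
  shows "mtrace (A * B) = mtrace (B * A)"
proof -
  have "mtrace (A * B) = (\<Sum>i<n. \<Sum>j<n. A $$ (i, j) * B $$ (j, i))"
    unfolding mtrace_def using assms
    by (auto simp: mat_mult_index[OF assms] simp del: index_mult_mat(1) intro!: sum.cong)
  also have "\<dots> = (\<Sum>j<n. \<Sum>i<n. A $$ (i, j) * B $$ (j, i))" by (rule sum.swap)
  also have "\<dots> = mtrace (B * A)"
    unfolding mtrace_def using assms
    by (auto simp: mat_mult_index[OF assms(2,1)] mult.commute simp del: index_mult_mat(1) intro!: sum.cong)
  finally show ?thesis .
qed

lemma hermitian_index:
  assumes "hermitian n M" "i < n" "j < n"
  shows "cnj (M $$ (i, j)) = M $$ (j, i)"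
proof -
  have "madj M = M" "M \<in> carrier_mat n n" using assms by (auto simp: hermitian_def)
  then have "M $$ (j, i) = madj M $$ (j, i)" by simp
  also have "\<dots> = cnj (M $$ (i, j))" using assms \<open>M \<in> carrier_mat n n\<close> by (simp add: madj_def)
  finally show ?thesis by simp
qed

lemma hermitianI:
  assumes "M \<in> carrier_mat n n" "\<And>i j. i < n \<Longrightarrow> j < n \<Longrightarrow> cnj (M $$ (i, j)) = M $$ (j, i)"
  shows "hermitian n M"
  unfolding hermitian_def madj_def using assms by (auto intro!: eq_matI)

text \<open>The square of a nonzero Hermitian matrix has positive trace, whereas the square of a strictly
  triangular matrix has trace zero; so not all eigenvalues in a Schur form vanish.\<close>

lemma hermitian_nonzero_eigenvalue:
  assumes M: "hermitian n M" and nz: "M \<noteq> 0\<^sub>m n n"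
  obtains e v where "e \<noteq> 0" "eigenvector M v e"
proof -
  have car: "M \<in> carrier_mat n n" using M by (simp add: hermitian_def)
  obtain es where es: "char_poly M = (\<Prod>a\<leftarrow>es. [:- a, 1:])" "length es = n"
    using char_poly_factorized[OF car] by blast
  obtain B P Q where dec: "schur_decomposition M es = (B, P, Q)" by (metis prod_cases3)
  have sim: "similar_mat_wit M B P Q" and up: "upper_triangular B" and dg: "diag_mat B = es"
    using schur_decomposition[OF car es(1) dec] by auto
  note w = similar_mat_witD2[OF car sim]
  obtain e where e: "e \<in> set es" "e \<noteq> 0"
  proof (rule ccontr)
    assume "\<not> thesis"
    with that have all0: "\<forall>e\<in>set es. e = 0" by blast
    have d0: "B $$ (i, i) = 0" if "i < n" for i
      using all0 that w(5) unfolding dg[symmetric] diag_mat_def by auto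
    have prod0: "B $$ (i, j) * B $$ (j, i) = 0" if "i < n" "j < n" for i j
    proof -
      consider "j < i" | "i < j" | "i = j" by linarith
      then show ?thesis using up w(5) that d0 by cases (auto simp: upper_triangular_def)
    qed
    \<comment> \<open>Cyclicity moves the leading \<open>P\<close> to the end, behind the last
      \<open>Q\<close>; both products \<open>Q * P\<close> then cancel and the trace becomes that of
      \<open>B * B\<close>.\<close>
    have "mtrace (M * M) = mtrace (P * (B * Q * P * B * Q))"
      unfolding w(3) using w(5-7) by (simp add: assoc_mult_mat[of _ n n _ n _ n])
    also have "\<dots> = mtrace (B * Q * P * B * Q * P)"
      using w by (intro mtrace_mult_comm[of _ n]) auto
    also have "B * Q * P * B * Q * P = B * (Q * P) * (B * (Q * P))"
      using w(5-7) by (simp add: assoc_mult_mat[of _ n n _ n _ n])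
    also have "\<dots> = B * B" using w(2,5) by simp
    also have "mtrace (B * B) = 0"
      unfolding mtrace_def using w(5) prod0
      by (auto simp: mat_mult_index[OF w(5,5)] simp del: index_mult_mat(1) intro!: sum.neutral)
    finally have tr0: "mtrace (M * M) = 0" .
    have "mtrace (M * M) = of_real (\<Sum>i<n. \<Sum>j<n. (cmod (M $$ (i, j)))\<^sup>2)"
      unfolding mtrace_def of_real_sum
    proof (rule sum.cong)
      show "{..<dim_row (M * M)} = {..<n}" using car by auto
    next
      fix i assume "i \<in> {..<n}"
      then have i: "i < n" by simp
      have "(M * M) $$ (i, i) = (\<Sum>j<n. M $$ (i, j) * M $$ (j, i))"
        by (rule mat_mult_index) (use car i in auto)
      also have "\<dots> = (\<Sum>j<n. complex_of_real ((cmod (M $$ (i, j)))\<^sup>2))"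
        using hermitian_index[OF M i, symmetric]
        by (intro sum.cong) (auto simp: complex_norm_square simp del: of_real_power)
      finally show "(M * M) $$ (i, i) = (\<Sum>j<n. complex_of_real ((cmod (M $$ (i, j)))\<^sup>2))" .
    qed
    with tr0 have "(\<Sum>i<n. \<Sum>j<n. (cmod (M $$ (i, j)))\<^sup>2) = 0" by (metis of_real_eq_0_iff)
    then have "\<forall>i<n. \<forall>j<n. M $$ (i, j) = 0"
      by (auto simp: sum_nonneg_eq_0_iff sum_nonneg)
    then have "M = 0\<^sub>m n n" using car by (intro eq_matI) auto
    with nz show False by simp
  qed
  have "poly (char_poly M) e = 0"
    unfolding es(1) poly_prod_list prod_list_zero_iff using e by force
  then have "eigenvalue M e" using eigenvalue_root_char_poly[OF car] by simp
  then show ?thesis using that e unfolding eigenvalue_def by blast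
qed

text \<open>Hermitian symmetry makes the number \<open>q = e * s\<close> below equal to its
  conjugate, so the eigenvalue is real. The vector is scaled to unit length and read as a function
  on \<open>nat\<close>, the representation also used for states.\<close>

lemma hermitian_nonzero_eigenpair:
  assumes M: "hermitian n M" and nz: "M \<noteq> 0\<^sub>m n n"
  obtains e :: real and v :: "nat \<Rightarrow> complex" where "e \<noteq> 0" "(\<Sum>i<n. cnj (v i) * v i) = 1"
    "\<And>i. i < n \<Longrightarrow> (\<Sum>j<n. M $$ (i, j) * v j) = of_real e * v i"
proof -
  have car: "M \<in> carrier_mat n n" using M by (simp add: hermitian_def)
  obtain e v where e: "e \<noteq> 0" "eigenvector M v e" by (rule hermitian_nonzero_eigenvalue[OF M nz])
  have v: "v \<in> carrier_vec n" "v \<noteq> 0\<^sub>v n" "M *\<^sub>v v = e \<cdot>\<^sub>v v"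
    using e(2) car by (auto simp: eigenvector_def)
  have ev: "(\<Sum>j<n. M $$ (i, j) * v $ j) = e * v $ i" if "i < n" for i
    using mat_vec_mult_index[OF car v(1) that] that v by simp
  define s where "s = (\<Sum>i<n. (cmod (v $ i))\<^sup>2)"
  have cs: "(\<Sum>i<n. cnj (v $ i) * v $ i) = of_real s"
    unfolding s_def of_real_sum
    by (intro sum.cong) (auto simp: complex_norm_square mult.commute simp del: of_real_power)
  have "s \<noteq> 0"
  proof
    assume "s = 0"
    then have "\<forall>i<n. v $ i = 0" unfolding s_def by (auto simp: sum_nonneg_eq_0_iff)
    then have "v = 0\<^sub>v n" using v(1) by (intro eq_vecI) auto
    with v(2) show False by simp
  qed
  moreover have "s \<ge> 0" unfolding s_def by (simp add: sum_nonneg)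
  ultimately have s: "s > 0" by simp
  define q where "q = (\<Sum>i<n. cnj (v $ i) * (\<Sum>j<n. M $$ (i, j) * v $ j))"
  have q1: "q = e * of_real s"
    unfolding q_def cs[symmetric] sum_distrib_left[of e] by (intro sum.cong) (auto simp: ev)
  have "cnj q = (\<Sum>i<n. \<Sum>j<n. v $ i * cnj (M $$ (i, j)) * cnj (v $ j))"
    unfolding q_def by (simp add: sum_distrib_left mult.assoc)
  also have "\<dots> = (\<Sum>i<n. \<Sum>j<n. v $ i * M $$ (j, i) * cnj (v $ j))"
    using hermitian_index[OF M] by (intro sum.cong) auto
  also have "\<dots> = (\<Sum>j<n. \<Sum>i<n. v $ i * M $$ (j, i) * cnj (v $ j))" by (rule sum.swap)
  also have "\<dots> = q"
    unfolding q_def sum_distrib_left by (intro sum.cong) (auto simp: mult_ac)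
  finally have "cnj e = e" using s unfolding q1 by simp
  then have re: "e = of_real (Re e)" by (simp add: complex_eq_iff)
  show ?thesis
  proof (rule that[of "Re e" "\<lambda>i. v $ i / of_real (sqrt s)"])
    show "Re e \<noteq> 0" using e re by auto
    have "(\<Sum>i<n. cnj (v $ i / of_real (sqrt s)) * (v $ i / of_real (sqrt s)))
        = (\<Sum>i<n. cnj (v $ i) * v $ i) / (of_real (sqrt s) * of_real (sqrt s))"
      by (simp add: sum_divide_distrib)
    also have "\<dots> = 1" unfolding cs of_real_mult[symmetric] using s by simp
    finally show "(\<Sum>i<n. cnj (v $ i / of_real (sqrt s)) * (v $ i / of_real (sqrt s))) = 1" .
    fix i assume "i < n"
    then show "(\<Sum>j<n. M $$ (i, j) * (v $ j / of_real (sqrt s)))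
        = of_real (Re e) * (v $ i / of_real (sqrt s))"
      using ev[of i] re by (simp add: sum_divide_distrib[symmetric])
  qed
qed

text \<open>The size \<open>m\<close> is independent of \<open>n\<close>: the spectral theorem
  collects eigenvectors until the remainder vanishes and does not complete them to a basis.\<close>

definition orthonormal_family :: "nat \<Rightarrow> nat \<Rightarrow> (nat \<Rightarrow> nat \<Rightarrow> complex) \<Rightarrow> bool" where
  "orthonormal_family n m v \<longleftrightarrow>
     (\<forall>k<m. \<forall>l<m. (\<Sum>i<n. cnj (v k i) * v l i) = (if k = l then 1 else 0))"

text \<open>Deflation: \<open>Q\<close> is an orthogonal projection onto a space containing the range of \<open>M\<close>, and
  splitting off an eigenvector lowers the rank \<open>r\<close> of \<open>Q\<close>.\<close>

lemma hermitian_spectral_aux: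
  assumes "hermitian n M" "hermitian n Q" "Q * Q = Q" "Q * M = M" "mtrace Q = of_nat r"
  shows "\<exists>m c v. orthonormal_family n m v \<and>
    (\<forall>k<m. \<forall>i<n. (\<Sum>j<n. Q $$ (i, j) * v k j) = v k i) \<and>
    (\<forall>i<n. \<forall>j<n. M $$ (i, j) = (\<Sum>k<m. complex_of_real (c k) * v k i * cnj (v k j)))"
  using assms
proof (induction r arbitrary: M Q)
  case 0
  have car: "M \<in> carrier_mat n n" "Q \<in> carrier_mat n n"
    using 0 by (auto simp: hermitian_def)
  \<comment> \<open>The trace of an orthogonal projection is the sum of the squared moduli of its
    entries, so trace zero forces \<open>Q = 0\<close>, and then \<open>M = Q * M\<close> vanishes
    too.\<close>
  have "mtrace Q = mtrace (Q * Q)" using 0 by simp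
  also have "\<dots> = of_real (\<Sum>i<n. \<Sum>j<n. (cmod (Q $$ (i, j)))\<^sup>2)"
    unfolding mtrace_def of_real_sum
  proof (rule sum.cong)
    show "{..<dim_row (Q * Q)} = {..<n}" using car by auto
    fix i assume "i \<in> {..<n}"
    then have i: "i < n" by simp
    have "(Q * Q) $$ (i, i) = (\<Sum>j<n. Q $$ (i, j) * Q $$ (j, i))"
      by (rule mat_mult_index) (use car i in auto)
    also have "\<dots> = (\<Sum>j<n. complex_of_real ((cmod (Q $$ (i, j)))\<^sup>2))"
      using hermitian_index[OF 0(2) i, symmetric]
      by (intro sum.cong) (auto simp: complex_norm_square simp del: of_real_power)
    finally show "(Q * Q) $$ (i, i) = (\<Sum>j<n. complex_of_real ((cmod (Q $$ (i, j)))\<^sup>2))" .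
  qed
  finally have "(\<Sum>i<n. \<Sum>j<n. (cmod (Q $$ (i, j)))\<^sup>2) = 0"
    using 0(5) by (metis of_nat_0 of_real_eq_0_iff)
  then have Q0: "\<forall>i<n. \<forall>j<n. Q $$ (i, j) = 0"
    by (auto simp: sum_nonneg_eq_0_iff sum_nonneg)
  have "\<forall>i<n. \<forall>j<n. (Q * M) $$ (i, j) = 0"
    using Q0 by (auto simp: mat_mult_index[OF car(2,1)] simp del: index_mult_mat(1))
  then have "\<forall>i<n. \<forall>j<n. M $$ (i, j) = 0" using 0 by simp
  then show ?case by (intro exI[of _ 0]) (auto simp: orthonormal_family_def)
next
  case (Suc r)
  show ?case
  proof (cases "M = 0\<^sub>m n n")
    case True
    then show ?thesis by (intro exI[of _ 0]) (auto simp: orthonormal_family_def)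
  next
    case False
    have car: "M \<in> carrier_mat n n" "Q \<in> carrier_mat n n"
      using Suc by (auto simp: hermitian_def)
    obtain e v where e: "e \<noteq> 0" and vn: "(\<Sum>i<n. cnj (v i) * v i) = 1"
      and ev: "\<And>i. i < n \<Longrightarrow> (\<Sum>j<n. M $$ (i, j) * v j) = of_real e * v i"
      using hermitian_nonzero_eigenpair[OF Suc(2) False] by metis
    have QM: "(\<Sum>l<n. Q $$ (i, l) * M $$ (l, j)) = M $$ (i, j)" if "i < n" "j < n" for i j
      using mat_mult_index[OF car(2,1) that] Suc(5) by simp
    have QQ: "(\<Sum>l<n. Q $$ (i, l) * Q $$ (l, j)) = Q $$ (i, j)" if "i < n" "j < n" for i j
      using mat_mult_index[OF car(2,2) that] Suc(4) by simp
    \<comment> \<open>Since \<open>e\<close> is nonzero, \<open>v\<close> lies in the range of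
      \<open>M\<close>, which \<open>Q\<close> fixes.\<close>
    have Qv: "(\<Sum>j<n. Q $$ (i, j) * v j) = v i" if i: "i < n" for i
    proof -
      have "of_real e * (\<Sum>j<n. Q $$ (i, j) * v j) = (\<Sum>j<n. Q $$ (i, j) * (\<Sum>k<n. M $$ (j, k) * v k))"
        unfolding sum_distrib_left by (intro sum.cong) (auto simp: ev sum_distrib_left[symmetric])
      also have "\<dots> = (\<Sum>k<n. (\<Sum>j<n. Q $$ (i, j) * M $$ (j, k)) * v k)"
        by (subst sum_distrib_left, subst sum.swap) (simp add: sum_distrib_right mult.assoc)
      also have "\<dots> = (\<Sum>k<n. M $$ (i, k) * v k)" using i by (intro sum.cong) (auto simp: QM)
      also have "\<dots> = of_real e * v i" using ev i by simp
      finally show ?thesis using e by simp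
    qed
    have vQ: "(\<Sum>j<n. cnj (v j) * Q $$ (j, i)) = cnj (v i)" if i: "i < n" for i
    proof -
      have "cnj (\<Sum>j<n. Q $$ (i, j) * v j) = cnj (v i)" using Qv[OF i] by simp
      then show ?thesis using hermitian_index[OF Suc(3) i] by (simp add: mult.commute)
    qed
    have vM: "(\<Sum>j<n. cnj (v j) * M $$ (j, i)) = of_real e * cnj (v i)" if i: "i < n" for i
    proof -
      have "cnj (\<Sum>j<n. M $$ (i, j) * v j) = cnj (of_real e * v i)" using ev[OF i] by simp
      then show ?thesis using hermitian_index[OF Suc(2) i] by (simp add: mult.commute)
    qed
    define M' where "M' = mat n n (\<lambda>(i, j). M $$ (i, j) - of_real e * v i * cnj (v j))"
    define Q' where "Q' = mat n n (\<lambda>(i, j). Q $$ (i, j) - v i * cnj (v j))"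
    have car': "M' \<in> carrier_mat n n" "Q' \<in> carrier_mat n n" by (auto simp: M'_def Q'_def)
    have M': "M' $$ (i, j) = M $$ (i, j) - of_real e * v i * cnj (v j)" if "i < n" "j < n" for i j
      using that by (simp add: M'_def)
    have Q': "Q' $$ (i, j) = Q $$ (i, j) - v i * cnj (v j)" if "i < n" "j < n" for i j
      using that by (simp add: Q'_def)
    have h1: "hermitian n M'"
      using car' hermitian_index[OF Suc(2)] by (intro hermitianI) (auto simp: M')
    have h2: "hermitian n Q'"
      using car' hermitian_index[OF Suc(3)] by (intro hermitianI) (auto simp: Q')
    have Q'v: "(\<Sum>j<n. Q' $$ (i, j) * v j) = 0" if i: "i < n" for i
    proof -
      have "(\<Sum>j<n. Q' $$ (i, j) * v j) = (\<Sum>j<n. Q $$ (i, j) * v j) - v i * (\<Sum>j<n. cnj (v j) * v j)"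
        using i by (simp add: Q' sum_subtractf sum_distrib_left algebra_simps)
      then show ?thesis using Qv[OF i] vn by simp
    qed
    have h3: "Q' * Q' = Q'"
    proof (rule eq_matI)
      fix i j assume "i < dim_row Q'" "j < dim_col Q'"
      then have ij: "i < n" "j < n" using car' by auto
      have "(Q' * Q') $$ (i, j) = (\<Sum>l<n. Q' $$ (i, l) * Q $$ (l, j)) - (\<Sum>l<n. Q' $$ (i, l) * v l) * cnj (v j)"
        using ij
        by (simp del: index_mult_mat(1) add: mat_mult_index[OF car'(2,2)] Q' right_diff_distrib
            sum_subtractf sum_distrib_right sum_distrib_left mult_ac)
      also have "(\<Sum>l<n. Q' $$ (i, l) * Q $$ (l, j)) =
          (\<Sum>l<n. Q $$ (i, l) * Q $$ (l, j)) - v i * (\<Sum>l<n. cnj (v l) * Q $$ (l, j))"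
        using ij by (simp add: Q' sum_subtractf sum_distrib_left algebra_simps)
      finally show "(Q' * Q') $$ (i, j) = Q' $$ (i, j)"
        using Q'v[OF ij(1)] Q'[OF ij] QQ[OF ij] vQ[OF ij(2)] by (metis diff_zero mult_zero_left)
    qed (use car' in auto)
    have h4: "Q' * M' = M'"
    proof (rule eq_matI)
      fix i j assume "i < dim_row M'" "j < dim_col M'"
      then have ij: "i < n" "j < n" using car' by auto
      have "(Q' * M') $$ (i, j) = (\<Sum>l<n. Q' $$ (i, l) * M $$ (l, j)) - (\<Sum>l<n. Q' $$ (i, l) * v l) * (of_real e * cnj (v j))"
        using ij
        by (simp del: index_mult_mat(1) add: mat_mult_index[OF car'(2,1)] M' right_diff_distrib
            sum_subtractf sum_distrib_right sum_distrib_left mult_ac)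
      also have "(\<Sum>l<n. Q' $$ (i, l) * M $$ (l, j)) =
          (\<Sum>l<n. Q $$ (i, l) * M $$ (l, j)) - v i * (\<Sum>l<n. cnj (v l) * M $$ (l, j))"
        using ij by (simp add: Q' sum_subtractf sum_distrib_left algebra_simps)
      finally show "(Q' * M') $$ (i, j) = M' $$ (i, j)"
        unfolding Q'v[OF ij(1)] M'[OF ij] QM[OF ij] vM[OF ij(2)] by (simp add: mult_ac)
    qed (use car' in auto)
    have h5: "mtrace Q' = of_nat r"
    proof -
      have "mtrace Q' = mtrace Q - (\<Sum>i<n. cnj (v i) * v i)"
        unfolding mtrace_def using car by (simp add: Q'_def sum_subtractf mult.commute)
      then show ?thesis using Suc(6) vn by simp
    qed
    obtain m c w where on: "orthonormal_family n m w"
      and Qw: "\<forall>k<m. \<forall>i<n. (\<Sum>j<n. Q' $$ (i, j) * w k j) = w k i"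
      and rep: "\<forall>i<n. \<forall>j<n. M' $$ (i, j) = (\<Sum>k<m. complex_of_real (c k) * w k i * cnj (w k j))"
      using Suc.IH[OF h1 h2 h3 h4 h5] by blast
    \<comment> \<open>The inductive family is fixed by \<open>Q'\<close>, and \<open>Q'\<close>
      annihilates \<open>v\<close>; the clause on fixed vectors in the induction statement provides
      this orthogonality.\<close>
    have vw: "(\<Sum>i<n. cnj (v i) * w k i) = 0" if k: "k < m" for k
    proof -
      have "(\<Sum>i<n. cnj (v i) * w k i) = (\<Sum>i<n. cnj (v i) * (\<Sum>j<n. Q' $$ (i, j) * w k j))"
        using Qw k by simp
      also have "\<dots> = (\<Sum>j<n. (\<Sum>i<n. cnj (v i) * Q' $$ (i, j)) * w k j)"
        by (subst sum_distrib_left, subst sum.swap) (simp add: sum_distrib_right mult.assoc)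
      also have "\<dots> = 0"
      proof (intro sum.neutral ballI)
        fix j assume "j \<in> {..<n}"
        then have j: "j < n" by simp
        have "cnj (\<Sum>i<n. Q' $$ (j, i) * v i) = 0" using Q'v[OF j] by simp
        then have "(\<Sum>i<n. cnj (v i) * Q' $$ (i, j)) = 0"
          using hermitian_index[OF h2 j] by (simp add: mult.commute)
        then show "(\<Sum>i<n. cnj (v i) * Q' $$ (i, j)) * w k j = 0" by simp
      qed
      finally show ?thesis .
    qed
    have wv: "(\<Sum>i<n. cnj (w k i) * v i) = 0" if k: "k < m" for k
    proof -
      have "cnj (\<Sum>i<n. cnj (v i) * w k i) = 0" using vw[OF k] by simp
      then show ?thesis by (simp add: mult.commute)
    qed
    define u where "u = w(m := v)"
    have "orthonormal_family n (Suc m) u"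
      using on vn vw wv unfolding orthonormal_family_def u_def by (auto simp: less_Suc_eq)
    moreover have "\<forall>k<Suc m. \<forall>i<n. (\<Sum>j<n. Q $$ (i, j) * u k j) = u k i"
    proof (intro allI impI)
      fix k i assume k: "k < Suc m" and i: "i < n"
      show "(\<Sum>j<n. Q $$ (i, j) * u k j) = u k i"
      proof (cases "k = m")
        case True then show ?thesis using Qv[OF i] by (simp add: u_def)
      next
        case False
        then have km: "k < m" using k by simp
        have "w k i = (\<Sum>j<n. Q' $$ (i, j) * w k j)" using Qw km i by simp
        also have "\<dots> = (\<Sum>j<n. Q $$ (i, j) * w k j) - v i * (\<Sum>j<n. cnj (v j) * w k j)"
          using i by (simp add: Q' sum_subtractf sum_distrib_left algebra_simps)
        finally show ?thesis using vw[OF km] False by (simp add: u_def)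
      qed
    qed
    moreover have "\<forall>i<n. \<forall>j<n. M $$ (i, j) =
        (\<Sum>k<Suc m. complex_of_real ((c(m := e)) k) * u k i * cnj (u k j))"
    proof (intro allI impI)
      fix i j assume ij: "i < n" "j < n"
      have "M $$ (i, j) = M' $$ (i, j) + of_real e * v i * cnj (v j)" using M'[OF ij] by simp
      then show "M $$ (i, j) = (\<Sum>k<Suc m. complex_of_real ((c(m := e)) k) * u k i * cnj (u k j))"
        using rep ij by (simp add: u_def)
    qed
    ultimately show ?thesis by blast
  qed
qed

theorem hermitian_spectral:
  assumes M: "hermitian n M"
  obtains m c v where "orthonormal_family n m v"
    "\<And>i j. i < n \<Longrightarrow> j < n \<Longrightarrow> M $$ (i, j) = (\<Sum>k<m. complex_of_real (c k) * v k i * cnj (v k j))"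
proof -
  have "\<exists>m c v. orthonormal_family n m v \<and>
    (\<forall>k<m. \<forall>i<n. (\<Sum>j<n. (1\<^sub>m n :: complex mat) $$ (i, j) * v k j) = v k i) \<and>
    (\<forall>i<n. \<forall>j<n. M $$ (i, j) = (\<Sum>k<m. complex_of_real (c k) * v k i * cnj (v k j)))"
  proof (rule hermitian_spectral_aux[OF M, where r = n])
    show "hermitian n (1\<^sub>m n)" by (rule hermitianI) auto
    show "1\<^sub>m n * M = M" using M by (auto simp: hermitian_def)
    show "mtrace (1\<^sub>m n) = of_nat n" by (simp add: mtrace_def)
  qed auto
  then show ?thesis using that by blast
qed

section \<open>Trace norm and operator norm\<close>

definition qform :: "nat \<Rightarrow> complex mat \<Rightarrow> (nat \<Rightarrow> complex) \<Rightarrow> complex" where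
  "qform n M v = (\<Sum>i<n. \<Sum>j<n. cnj (v i) * M $$ (i, j) * v j)"

text \<open>A functional calculus for a fixed orthonormal family: functions of a Hermitian matrix,
  in particular its absolute value, arise by changing the coefficients \<open>c\<close>
  alone.\<close>

definition spectral_mat :: "nat \<Rightarrow> nat \<Rightarrow> (nat \<Rightarrow> real) \<Rightarrow> (nat \<Rightarrow> nat \<Rightarrow> complex) \<Rightarrow> complex mat" where
  "spectral_mat n m c v = mat n n (\<lambda>(i, j). \<Sum>k<m. complex_of_real (c k) * v k i * cnj (v k j))"

lemma spectral_mat_carrier [simp]: "spectral_mat n m c v \<in> carrier_mat n n"
  by (simp add: spectral_mat_def)

lemma spectral_mat_index:
  "i < n \<Longrightarrow> j < n \<Longrightarrow>
    spectral_mat n m c v $$ (i, j) = (\<Sum>k<m. complex_of_real (c k) * v k i * cnj (v k j))"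
  by (simp add: spectral_mat_def)

lemma hermitian_spectral_mat: "hermitian n (spectral_mat n m c v)"
  by (rule hermitianI) (auto simp: spectral_mat_index mult_ac)

lemma psd_iff_qform: "psd n P \<longleftrightarrow> hermitian n P \<and> (\<forall>v. 0 \<le> Re (qform n P v))"
proof -
  have eq: "(\<Sum>i<n. cnj (v $ i) * (P *\<^sub>v v) $ i) = qform n P (\<lambda>i. v $ i)"
    if "P \<in> carrier_mat n n" "v \<in> carrier_vec n" for v
    unfolding qform_def using that
    by (intro sum.cong) (auto simp: mat_vec_mult_index[OF that] sum_distrib_left mult.assoc
        simp del: index_mult_mat_vec)
  have fn: "qform n P v = qform n P (\<lambda>i. vec n v $ i)" for v by (simp add: qform_def)
  show ?thesis
  proof
    assume P: "psd n P"
    then have car: "P \<in> carrier_mat n n" by (simp add: psd_def hermitian_def)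
    show "hermitian n P \<and> (\<forall>v. 0 \<le> Re (qform n P v))"
    proof (intro conjI allI)
      show "hermitian n P" using P by (simp add: psd_def)
      fix v
      show "0 \<le> Re (qform n P v)"
        unfolding fn[of v] using P eq[OF car vec_carrier, of v] unfolding psd_def by (metis vec_carrier)
    qed
  next
    assume P: "hermitian n P \<and> (\<forall>v. 0 \<le> Re (qform n P v))"
    then have car: "P \<in> carrier_mat n n" by (simp add: hermitian_def)
    show "psd n P" using P unfolding psd_def by (auto simp: eq[OF car])
  qed
qed

lemma qform_spectral_mat:
  "qform n (spectral_mat n m c v) w = (\<Sum>k<m. of_real (c k * (cmod (\<Sum>i<n. cnj (v k i) * w i))\<^sup>2))"
proof -
  have "qform n (spectral_mat n m c v) w =
      (\<Sum>i<n. \<Sum>j<n. \<Sum>k<m. of_real (c k) * (cnj (w i) * v k i) * (cnj (v k j) * w j))"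
    unfolding qform_def
    by (intro sum.cong) (auto simp: spectral_mat_index sum_distrib_left sum_distrib_right mult_ac)
  also have "\<dots> = (\<Sum>i<n. \<Sum>k<m. \<Sum>j<n. of_real (c k) * (cnj (w i) * v k i) * (cnj (v k j) * w j))"
    by (intro sum.cong sum.swap refl)
  also have "\<dots> = (\<Sum>k<m. \<Sum>i<n. \<Sum>j<n. of_real (c k) * (cnj (w i) * v k i) * (cnj (v k j) * w j))"
    by (rule sum.swap)
  also have "\<dots> = (\<Sum>k<m. of_real (c k * (cmod (\<Sum>i<n. cnj (v k i) * w i))\<^sup>2))"
  proof (rule sum.cong)
    fix k
    have "(\<Sum>i<n. \<Sum>j<n. of_real (c k) * (cnj (w i) * v k i) * (cnj (v k j) * w j))
       = of_real (c k) * ((\<Sum>j<n. cnj (v k j) * w j) * cnj (\<Sum>i<n. cnj (v k i) * w i))"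
      by (simp add: sum_product sum_distrib_left mult_ac)
    then show "(\<Sum>i<n. \<Sum>j<n. of_real (c k) * (cnj (w i) * v k i) * (cnj (v k j) * w j)) =
        complex_of_real (c k * (cmod (\<Sum>i<n. cnj (v k i) * w i))\<^sup>2)"
      unfolding of_real_mult complex_norm_square by simp
  qed simp
  finally show ?thesis .
qed

lemma psd_spectral_mat:
  assumes "\<And>k. k < m \<Longrightarrow> 0 \<le> c k"
  shows "psd n (spectral_mat n m c v)"
  unfolding psd_iff_qform qform_spectral_mat using assms
  by (auto simp: hermitian_spectral_mat intro!: sum_nonneg)

lemma spectral_mat_eigen:
  assumes "orthonormal_family n m v" "k < m" "i < n"
  shows "(\<Sum>j<n. spectral_mat n m c v $$ (i, j) * v k j) = of_real (c k) * v k i"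
proof -
  have "(\<Sum>j<n. spectral_mat n m c v $$ (i, j) * v k j)
      = (\<Sum>j<n. \<Sum>l<m. of_real (c l) * v l i * (cnj (v l j) * v k j))"
    using assms by (intro sum.cong) (auto simp: spectral_mat_index sum_distrib_left sum_distrib_right mult_ac)
  also have "\<dots> = (\<Sum>l<m. of_real (c l) * v l i * (\<Sum>j<n. cnj (v l j) * v k j))"
    by (subst sum.swap) (simp add: sum_distrib_left)
  also have "\<dots> = (\<Sum>l<m. if l = k then of_real (c l) * v l i else 0)"
    using assms by (intro sum.cong) (auto simp: orthonormal_family_def)
  also have "\<dots> = of_real (c k) * v k i" using assms by simp
  finally show ?thesis .
qed

lemma spectral_mat_eigen_left:
  assumes "orthonormal_family n m v" "k < m" "j < n"
  shows "(\<Sum>i<n. cnj (v k i) * spectral_mat n m c v $$ (i, j)) = of_real (c k) * cnj (v k j)"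
proof -
  have "cnj (\<Sum>i<n. spectral_mat n m c v $$ (j, i) * v k i) = cnj (of_real (c k) * v k j)"
    using spectral_mat_eigen[OF assms] by simp
  then show ?thesis
    using hermitian_index[OF hermitian_spectral_mat assms(3)] by (simp add: mult.commute)
qed

lemma spectral_mat_mult:
  assumes "orthonormal_family n m v"
  shows "spectral_mat n m a v * spectral_mat n m b v = spectral_mat n m (\<lambda>k. a k * b k) v"
proof (rule eq_matI)
  fix i j assume "i < dim_row (spectral_mat n m (\<lambda>k. a k * b k) v)"
    "j < dim_col (spectral_mat n m (\<lambda>k. a k * b k) v)"
  then have ij: "i < n" "j < n" by (auto simp: spectral_mat_def)
  have "(spectral_mat n m a v * spectral_mat n m b v) $$ (i, j)
     = (\<Sum>l<n. \<Sum>k<m. spectral_mat n m a v $$ (i, l) * v k l * (of_real (b k) * cnj (v k j)))"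
    unfolding mat_mult_index[OF spectral_mat_carrier spectral_mat_carrier ij] using ij
    by (intro sum.cong) (auto simp: spectral_mat_index[of _ n j] sum_distrib_left mult_ac)
  also have "\<dots> = (\<Sum>k<m. (\<Sum>l<n. spectral_mat n m a v $$ (i, l) * v k l) * (of_real (b k) * cnj (v k j)))"
    by (subst sum.swap) (simp add: sum_distrib_right)
  also have "\<dots> = spectral_mat n m (\<lambda>k. a k * b k) v $$ (i, j)"
    unfolding spectral_mat_index[OF ij]
    using ij by (intro sum.cong) (auto simp: spectral_mat_eigen[OF assms])
  finally show "(spectral_mat n m a v * spectral_mat n m b v) $$ (i, j)
      = spectral_mat n m (\<lambda>k. a k * b k) v $$ (i, j)" .
qed (auto simp: spectral_mat_def)

lemma hermitian_eq_spectral_mat: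
  assumes "hermitian n M"
  obtains m c v where "orthonormal_family n m v" "M = spectral_mat n m c v"
proof -
  obtain m c v where *: "orthonormal_family n m v"
    "\<And>i j. i < n \<Longrightarrow> j < n \<Longrightarrow> M $$ (i, j) = (\<Sum>k<m. complex_of_real (c k) * v k i * cnj (v k j))"
    by (rule hermitian_spectral[OF assms]) blast
  have "M = spectral_mat n m c v"
    using assms * by (intro eq_matI) (auto simp: spectral_mat_index hermitian_def spectral_mat_def)
  then show ?thesis using * that by blast
qed

text \<open>If \<open>P\<^sup>2 = R\<^sup>2\<close> then \<open>X = P - R\<close> satisfies \<open>X P + R X = 0\<close>; evaluated at a unit
  eigenvector of \<open>X\<close> this forces the eigenvalue to vanish.\<close>

lemma psd_square_inj:
  assumes P: "psd n P" and R: "psd n R" and eq: "P * P = R * R"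
  shows "P = R"
proof -
  have hP: "hermitian n P" and hR: "hermitian n R" using P R by (auto simp: psd_def)
  have cP: "P \<in> carrier_mat n n" and cR: "R \<in> carrier_mat n n"
    using hP hR by (auto simp: hermitian_def)
  define X where "X = P - R"
  have cX: "X \<in> carrier_mat n n" using cP cR by (auto simp: X_def)
  have X: "X $$ (i, j) = P $$ (i, j) - R $$ (i, j)" if "i < n" "j < n" for i j
    using that cP cR by (simp add: X_def)
  have "hermitian n X"
    using cX hermitian_index[OF hP] hermitian_index[OF hR] by (intro hermitianI) (auto simp: X)
  then obtain m c v where on: "orthonormal_family n m v" and Xs: "X = spectral_mat n m c v"
    by (rule hermitian_eq_spectral_mat)
  have "c k = 0" if k: "k < m" for k
  proof (rule ccontr)
    assume ck: "c k \<noteq> 0"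
    let ?v = "v k"
    have XPRX: "(\<Sum>l<n. X $$ (i, l) * P $$ (l, j)) + (\<Sum>l<n. R $$ (i, l) * X $$ (l, j)) = 0"
      if ij: "i < n" "j < n" for i j
    proof -
      have "(\<Sum>l<n. P $$ (i, l) * P $$ (l, j)) = (\<Sum>l<n. R $$ (i, l) * R $$ (l, j))"
        using mat_mult_index[OF cP cP ij] mat_mult_index[OF cR cR ij] eq by simp
      then show ?thesis using ij by (simp add: X algebra_simps sum_subtractf)
    qed
    \<comment> \<open>Sandwiched between \<open>v k\<close> and itself, \<open>X\<close> acts to the
      left in the first product and to the right in the second. Both times it gives
      \<open>c k\<close>, so \<open>c k\<close> times a sum of two nonnegative forms is
      zero.\<close>
    have "0 = (\<Sum>i<n. \<Sum>j<n. cnj (?v i) * ((\<Sum>l<n. X $$ (i, l) * P $$ (l, j)) + (\<Sum>l<n. R $$ (i, l) * X $$ (l, j))) * ?v j)"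
      by (simp add: XPRX)
    also have "\<dots> = (\<Sum>i<n. \<Sum>j<n. \<Sum>l<n. cnj (?v i) * X $$ (i, l) * (P $$ (l, j) * ?v j))
        + (\<Sum>i<n. \<Sum>j<n. \<Sum>l<n. cnj (?v i) * R $$ (i, l) * (X $$ (l, j) * ?v j))"
      by (simp only: distrib_left distrib_right sum.distrib sum_distrib_left sum_distrib_right mult.assoc)
    also have "(\<Sum>i<n. \<Sum>j<n. \<Sum>l<n. cnj (?v i) * X $$ (i, l) * (P $$ (l, j) * ?v j))
        = (\<Sum>j<n. \<Sum>i<n. \<Sum>l<n. cnj (?v i) * X $$ (i, l) * (P $$ (l, j) * ?v j))"
      by (rule sum.swap)
    also have "\<dots> = (\<Sum>j<n. \<Sum>l<n. \<Sum>i<n. cnj (?v i) * X $$ (i, l) * (P $$ (l, j) * ?v j))"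
      by (intro sum.cong sum.swap refl)
    also have "\<dots> = (\<Sum>j<n. \<Sum>l<n. (\<Sum>i<n. cnj (?v i) * X $$ (i, l)) * (P $$ (l, j) * ?v j))"
      by (simp only: sum_distrib_right)
    also have "\<dots> = of_real (c k) * qform n P ?v"
      unfolding qform_def sum_distrib_left Xs
      by (subst sum.swap) (auto simp: spectral_mat_eigen_left[OF on k] mult_ac intro!: sum.cong)
    also have "(\<Sum>i<n. \<Sum>j<n. \<Sum>l<n. cnj (?v i) * R $$ (i, l) * (X $$ (l, j) * ?v j))
        = (\<Sum>i<n. \<Sum>l<n. cnj (?v i) * R $$ (i, l) * (\<Sum>j<n. X $$ (l, j) * ?v j))"
      unfolding sum_distrib_left by (intro sum.cong sum.swap refl)
    also have "\<dots> = of_real (c k) * qform n R ?v"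
      unfolding qform_def sum_distrib_left[of "of_real (c k)"] Xs
      by (intro sum.cong refl) (simp add: spectral_mat_eigen[OF on k])
    finally have "of_real (c k) * (qform n P ?v + qform n R ?v) = 0" by (simp add: algebra_simps)
    then have "qform n P ?v + qform n R ?v = 0" using ck by simp
    then have s0: "Re (qform n P ?v) + Re (qform n R ?v) = 0" by (metis plus_complex.sel(1) zero_complex.sel(1))
    have "0 \<le> Re (qform n P ?v)" "0 \<le> Re (qform n R ?v)" using P R by (auto simp: psd_iff_qform)
    then have "Re (qform n P ?v) = 0" "Re (qform n R ?v) = 0" using s0 by auto
    \<comment> \<open>Both forms vanish at \<open>v k\<close>, hence so does their difference; but
      that difference is the eigenvalue \<open>c k\<close> itself.\<close>
    moreover have "qform n X ?v = qform n P ?v - qform n R ?v"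
      unfolding qform_def by (simp add: X algebra_simps sum_subtractf)
    ultimately have "Re (qform n X ?v) = 0" by simp
    moreover have "qform n X ?v = (\<Sum>i<n. cnj (?v i) * (\<Sum>j<n. X $$ (i, j) * ?v j))"
      by (simp add: qform_def sum_distrib_left mult.assoc)
    moreover have "\<dots> = of_real (c k) * (\<Sum>i<n. cnj (?v i) * ?v i)"
      unfolding Xs sum_distrib_left[of "of_real (c k)"]
      by (intro sum.cong refl) (simp add: spectral_mat_eigen[OF on k])
    moreover have "\<dots> = of_real (c k)" using on k by (simp add: orthonormal_family_def)
    ultimately show False using ck by simp
  qed
  then have X0: "X $$ (i, j) = 0" if "i < n" "j < n" for i j
    unfolding Xs using that by (simp add: spectral_mat_index)
  show ?thesis
  proof (rule eq_matI)
    fix i j assume "i < dim_row R" "j < dim_col R"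
    then have "i < n" "j < n" using cR by auto
    then show "P $$ (i, j) = R $$ (i, j)" using X[of i j] X0[of i j] by simp
  qed (use cP cR in auto)
qed

lemma mtrace_spectral_mat:
  assumes "orthonormal_family n m v"
  shows "mtrace (spectral_mat n m c v) = (\<Sum>k<m. of_real (c k))"
proof -
  have "mtrace (spectral_mat n m c v) = (\<Sum>i<n. \<Sum>k<m. of_real (c k) * (cnj (v k i) * v k i))"
    unfolding mtrace_def by (auto simp: spectral_mat_def mult_ac intro!: sum.cong)
  also have "\<dots> = (\<Sum>k<m. of_real (c k) * (\<Sum>i<n. cnj (v k i) * v k i))"
    by (subst sum.swap) (simp add: sum_distrib_left)
  also have "\<dots> = (\<Sum>k<m. of_real (c k))"
    using assms by (intro sum.cong) (auto simp: orthonormal_family_def)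
  finally show ?thesis .
qed

text \<open>The matrix with coefficients \<open>\<bar>c k\<bar>\<close> is positive and has the same
  square as the given one; uniqueness of the positive root is what allows the definite description
  in \<open>psd_sqrt\<close> to be evaluated.\<close>

lemma trace_norm_spectral_mat:
  assumes on: "orthonormal_family n m v"
  shows "trace_norm (spectral_mat n m c v) = (\<Sum>k<m. \<bar>c k\<bar>)"
proof -
  let ?D = "spectral_mat n m c v" and ?P = "spectral_mat n m (\<lambda>k. \<bar>c k\<bar>) v"
  have "madj ?D = ?D" using hermitian_spectral_mat by (simp add: hermitian_def)
  then have DD: "madj ?D * ?D = ?P * ?P" by (simp add: spectral_mat_mult[OF on])
  have dim: "dim_row (?P * ?P) = n" by (simp add: spectral_mat_def)
  have psd: "psd n ?P" by (rule psd_spectral_mat) simp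
  have "psd_sqrt (?P * ?P) = ?P"
    unfolding psd_sqrt_def dim using psd psd_square_inj[OF _ psd] by (intro the_equality) auto
  then show ?thesis unfolding trace_norm_def DD by (simp add: mtrace_spectral_mat[OF on])
qed

text \<open>One half of the Hoelder inequality for trace and operator norm. Expanding
  \<open>D\<close> in eigenvectors turns the trace into a combination of values of the quadratic
  form of \<open>B\<close> at unit vectors, weighted by the eigenvalues.\<close>

theorem trace_norm_duality:
  assumes D: "hermitian n D" and B: "B \<in> carrier_mat n n"
    and bd: "\<And>v. (\<Sum>i<n. (cmod (v i))\<^sup>2) = 1 \<Longrightarrow> cmod (qform n B v) \<le> 1"
  shows "cmod (mtrace (D * B)) \<le> trace_norm D"
proof -
  obtain m c v where on: "orthonormal_family n m v" and Ds: "D = spectral_mat n m c v"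
    using D by (rule hermitian_eq_spectral_mat)
  have car: "D \<in> carrier_mat n n" using D by (simp add: hermitian_def)
  have unit: "(\<Sum>i<n. (cmod (v k i))\<^sup>2) = 1" if k: "k < m" for k
  proof -
    have "complex_of_real (\<Sum>i<n. (cmod (v k i))\<^sup>2) = (\<Sum>i<n. cnj (v k i) * v k i)"
      unfolding of_real_sum
      by (intro sum.cong) (auto simp: complex_norm_square mult.commute simp del: of_real_power)
    also have "\<dots> = 1" using on k by (simp add: orthonormal_family_def)
    finally show ?thesis by (metis of_real_eq_1_iff)
  qed
  have "mtrace (D * B) = (\<Sum>i<n. \<Sum>j<n. D $$ (i, j) * B $$ (j, i))"
    unfolding mtrace_def using car B
    by (auto simp: mat_mult_index[OF car B] simp del: index_mult_mat(1) intro!: sum.cong)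
  also have "\<dots> = (\<Sum>i<n. \<Sum>j<n. \<Sum>k<m. of_real (c k) * (cnj (v k j) * B $$ (j, i) * v k i))"
    unfolding Ds by (intro sum.cong) (auto simp: spectral_mat_index sum_distrib_left sum_distrib_right mult_ac)
  also have "\<dots> = (\<Sum>i<n. \<Sum>k<m. \<Sum>j<n. of_real (c k) * (cnj (v k j) * B $$ (j, i) * v k i))"
    by (intro sum.cong sum.swap refl)
  also have "\<dots> = (\<Sum>k<m. \<Sum>i<n. \<Sum>j<n. of_real (c k) * (cnj (v k j) * B $$ (j, i) * v k i))"
    by (rule sum.swap)
  also have "\<dots> = (\<Sum>k<m. of_real (c k) * qform n B (v k))"
    unfolding qform_def sum_distrib_left by (intro sum.cong sum.swap refl)
  finally have "cmod (mtrace (D * B)) \<le> (\<Sum>k<m. cmod (of_real (c k) * qform n B (v k)))"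
    by (simp add: norm_sum)
  also have "\<dots> \<le> (\<Sum>k<m. \<bar>c k\<bar>)"
    using bd[OF unit] by (intro sum_mono) (auto simp: norm_mult mult_left_le)
  finally show ?thesis unfolding Ds trace_norm_spectral_mat[OF on] .
qed

text \<open>An inequality for all vectors, without normalisation, can be applied slice by slice to a
  Kronecker product; a supremum over unit vectors cannot be used so directly.\<close>

definition contraction :: "nat \<Rightarrow> complex mat \<Rightarrow> bool" where
  "contraction n A \<longleftrightarrow>
     (\<forall>w. (\<Sum>i<n. (cmod (\<Sum>j<n. A $$ (i, j) * w j))\<^sup>2) \<le> (\<Sum>j<n. (cmod (w j))\<^sup>2))"

lemma cmod_sum_mult_le:
  assumes "(\<Sum>i\<in>I. (cmod (x i))\<^sup>2) \<le> a\<^sup>2" "(\<Sum>i\<in>I. (cmod (y i))\<^sup>2) \<le> b\<^sup>2" "0 \<le> a" "0 \<le> b"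
  shows "cmod (\<Sum>i\<in>I. x i * y i) \<le> a * b"
proof -
  have "cmod (\<Sum>i\<in>I. x i * y i) \<le> (\<Sum>i\<in>I. cmod (x i) * cmod (y i))"
    by (rule order_trans[OF norm_sum]) (simp add: norm_mult)
  also have "\<dots> \<le> a * b"
  proof (rule power2_le_imp_le)
    have "(\<Sum>i\<in>I. cmod (x i) * cmod (y i))\<^sup>2 \<le> (\<Sum>i\<in>I. (cmod (x i))\<^sup>2) * (\<Sum>i\<in>I. (cmod (y i))\<^sup>2)"
      by (rule Cauchy_Schwarz_ineq_sum)
    also have "\<dots> \<le> a\<^sup>2 * b\<^sup>2" using assms by (intro mult_mono) (auto intro: sum_nonneg)
    finally show "(\<Sum>i\<in>I. cmod (x i) * cmod (y i))\<^sup>2 \<le> (a * b)\<^sup>2" by (simp add: power_mult_distrib)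
  qed (use assms in auto)
  finally show ?thesis .
qed

lemma contraction_qform_le:
  assumes A: "contraction n A" and v: "(\<Sum>i<n. (cmod (v i))\<^sup>2) = 1"
  shows "cmod (qform n A v) \<le> 1"
proof -
  have "qform n A v = (\<Sum>i<n. cnj (v i) * (\<Sum>j<n. A $$ (i, j) * v j))"
    by (simp add: qform_def sum_distrib_left mult.assoc)
  also have "cmod \<dots> \<le> 1 * 1"
  proof (rule cmod_sum_mult_le)
    show "(\<Sum>i<n. (cmod (cnj (v i)))\<^sup>2) \<le> 1\<^sup>2" using v by simp
    have "(\<Sum>i<n. (cmod (\<Sum>j<n. A $$ (i, j) * v j))\<^sup>2) \<le> (\<Sum>i<n. (cmod (v i))\<^sup>2)"
      using A unfolding contraction_def by blast
    then show "(\<Sum>i<n. (cmod (\<Sum>j<n. A $$ (i, j) * v j))\<^sup>2) \<le> 1\<^sup>2" using v by simp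
  qed auto
  finally show ?thesis by simp
qed

text \<open>A real supremum dominates its set only if the set is bounded above; the Frobenius norm
  supplies that bound. Scaling extends the inequality from unit vectors to all others, with the zero
  vector treated apart.\<close>

lemma contraction_of_op_norm:
  assumes A: "A \<in> carrier_mat n n" and le: "op_norm A \<le> 1"
  shows "contraction n A"
  unfolding contraction_def
proof
  fix w
  let ?S = "{cvec_norm (A *\<^sub>v v) | v. v \<in> carrier_vec (dim_col A) \<and> cvec_norm v = 1}"
  have nrm: "cvec_norm (A *\<^sub>v v) = sqrt (\<Sum>i<n. (cmod (\<Sum>j<n. A $$ (i, j) * v $ j))\<^sup>2)"
    if "v \<in> carrier_vec n" for v
    unfolding cvec_norm_def using that A
    by (auto simp: mat_vec_mult_index[OF A that] simp del: index_mult_mat_vec)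
  have "bdd_above ?S"
  proof (rule bdd_aboveI)
    fix x assume "x \<in> ?S"
    then obtain v where v: "v \<in> carrier_vec n" "cvec_norm v = 1" and x: "x = cvec_norm (A *\<^sub>v v)"
      using A by auto
    have v1: "(\<Sum>i<n. (cmod (v $ i))\<^sup>2) = 1" using v by (simp add: cvec_norm_def)
    have "cmod (\<Sum>j<n. A $$ (i, j) * v $ j) \<le> sqrt (\<Sum>j<n. (cmod (A $$ (i, j)))\<^sup>2) * 1" for i
      using v1 by (intro cmod_sum_mult_le) (auto simp: sum_nonneg)
    then have "(cmod (\<Sum>j<n. A $$ (i, j) * v $ j))\<^sup>2 \<le> (\<Sum>j<n. (cmod (A $$ (i, j)))\<^sup>2)" for i
      by (intro sqrt_ge_absD) simp
    then show "x \<le> sqrt (\<Sum>i<n. \<Sum>j<n. (cmod (A $$ (i, j)))\<^sup>2)"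
      unfolding x nrm[OF v(1)] by (intro real_sqrt_le_mono sum_mono)
  qed
  then have unit: "(\<Sum>i<n. (cmod (\<Sum>j<n. A $$ (i, j) * u j))\<^sup>2) \<le> 1"
    if u: "(\<Sum>i<n. (cmod (u i))\<^sup>2) = 1" for u
  proof -
    have "cvec_norm (A *\<^sub>v vec n u) \<le> op_norm A"
      unfolding op_norm_def using \<open>bdd_above ?S\<close> u A
      by (intro cSup_upper) (auto simp: cvec_norm_def intro!: exI[of _ "vec n u"])
    then have "sqrt (\<Sum>i<n. (cmod (\<Sum>j<n. A $$ (i, j) * u j))\<^sup>2) \<le> 1"
      using le nrm[of "vec n u"] by (simp del: real_sqrt_le_1_iff)
    then show ?thesis by simp
  qed
  define s where "s = (\<Sum>j<n. (cmod (w j))\<^sup>2)"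
  have "s \<ge> 0" by (simp add: s_def sum_nonneg)
  show "(\<Sum>i<n. (cmod (\<Sum>j<n. A $$ (i, j) * w j))\<^sup>2) \<le> (\<Sum>j<n. (cmod (w j))\<^sup>2)"
  proof (cases "s = 0")
    case True
    then have "\<forall>j<n. w j = 0" unfolding s_def by (auto simp: sum_nonneg_eq_0_iff)
    then show ?thesis by (simp add: sum_nonneg)
  next
    case False
    with \<open>s \<ge> 0\<close> have s: "s > 0" by simp
    define u where "u j = w j / of_real (sqrt s)" for j
    have "(\<Sum>j<n. (cmod (u j))\<^sup>2) = s / s"
      using s unfolding u_def norm_divide power_divide
      by (simp add: sum_divide_distrib[symmetric] s_def)
    then have u1: "(\<Sum>j<n. (cmod (u j))\<^sup>2) = 1" using s by simp
    have wu: "w j = of_real (sqrt s) * u j" for j using s by (simp add: u_def)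
    have "(\<Sum>i<n. (cmod (\<Sum>j<n. A $$ (i, j) * w j))\<^sup>2) = s * (\<Sum>i<n. (cmod (\<Sum>j<n. A $$ (i, j) * u j))\<^sup>2)"
    proof -
      have "(\<Sum>j<n. A $$ (i, j) * w j) = of_real (sqrt s) * (\<Sum>j<n. A $$ (i, j) * u j)" for i
        unfolding wu by (simp add: sum_distrib_left mult_ac)
      then have "(cmod (\<Sum>j<n. A $$ (i, j) * w j))\<^sup>2 = s * (cmod (\<Sum>j<n. A $$ (i, j) * u j))\<^sup>2" for i
        using s by (simp add: norm_mult power_mult_distrib)
      then show ?thesis by (simp add: sum_distrib_left)
    qed
    also have "\<dots> \<le> s * 1" using s unit[OF u1] by (intro mult_left_mono) auto
    finally show ?thesis by (simp add: s_def)
  qed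
qed

section \<open>Index splitting and Kronecker products\<close>

lemma sum_lessThan_mult:
  fixes f :: "nat \<Rightarrow> 'a::comm_monoid_add"
  shows "(\<Sum>i<n * m. f i) = (\<Sum>a<n. \<Sum>b<m. f (a * m + b))"
proof -
  have "(\<Sum>i<n * m. f i) = (\<Sum>a<n. sum f {a * m..<a * m + m})" by (simp add: sum.nat_group)
  also have "\<dots> = (\<Sum>a<n. \<Sum>b<m. f (a * m + b))"
  proof (rule sum.cong)
    fix a
    show "sum f {a * m..<a * m + m} = (\<Sum>b<m. f (a * m + b))"
      using sum.shift_bounds_nat_ivl[of f 0 "a * m" m] by (simp add: atLeast0LessThan add.commute)
  qed simp
  finally show ?thesis .
qed

lemma mult_add_less: "a < n \<Longrightarrow> b < m \<Longrightarrow> a * m + b < n * (m::nat)"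
proof -
  assume "a < n" "b < m"
  then have "a * m + b < Suc a * m" by simp
  also have "\<dots> \<le> n * m" using \<open>a < n\<close> by (intro mult_le_mono1) simp
  finally show ?thesis .
qed

lemma kron_index:
  assumes "A \<in> carrier_mat n n'" "B \<in> carrier_mat m m'" "a < n" "b < m" "c < n'" "d < m'"
  shows "kron A B $$ (a * m + b, c * m' + d) = A $$ (a, c) * B $$ (b, d)"
  using assms by (simp add: kron_def mult_add_less)

text \<open>The product acts in two stages: \<open>y\<close> is the result of applying
  \<open>A\<close> to the first index, and \<open>B\<close> then acts on the second. Each stage is a
  contraction for every fixed value of the other index.\<close>

lemma contraction_kron:
  assumes cA: "A \<in> carrier_mat n n" and cB: "B \<in> carrier_mat m m"
    and A: "contraction n A" and B: "contraction m B"
  shows "contraction (n * m) (kron A B)"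
  unfolding contraction_def
proof
  fix w
  define y where "y a d = (\<Sum>c<n. A $$ (a, c) * w (c * m + d))" for a d
  have "(\<Sum>i<n * m. (cmod (\<Sum>j<n * m. kron A B $$ (i, j) * w j))\<^sup>2)
      = (\<Sum>a<n. \<Sum>b<m. (cmod (\<Sum>d<m. B $$ (b, d) * y a d))\<^sup>2)"
    unfolding sum_lessThan_mult
  proof (intro sum.cong refl)
    fix a b assume "a \<in> {..<n}" "b \<in> {..<m}"
    then have ab: "a < n" "b < m" by auto
    have "(\<Sum>c<n. \<Sum>d<m. kron A B $$ (a * m + b, c * m + d) * w (c * m + d)) =
        (\<Sum>c<n. \<Sum>d<m. B $$ (b, d) * (A $$ (a, c) * w (c * m + d)))"
      using ab by (intro sum.cong refl) (auto simp: kron_index[OF cA cB])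
    also have "\<dots> = (\<Sum>d<m. B $$ (b, d) * y a d)"
      unfolding y_def by (subst sum.swap) (simp add: sum_distrib_left)
    finally show "(cmod (\<Sum>c<n. \<Sum>d<m. kron A B $$ (a * m + b, c * m + d) * w (c * m + d)))\<^sup>2
        = (cmod (\<Sum>d<m. B $$ (b, d) * y a d))\<^sup>2" by simp
  qed
  also have "\<dots> \<le> (\<Sum>a<n. \<Sum>d<m. (cmod (y a d))\<^sup>2)"
    using B[unfolded contraction_def, rule_format] by (rule sum_mono)
  also have "\<dots> = (\<Sum>d<m. \<Sum>a<n. (cmod (y a d))\<^sup>2)" by (rule sum.swap)
  also have "\<dots> \<le> (\<Sum>d<m. \<Sum>c<n. (cmod (w (c * m + d)))\<^sup>2)"
    unfolding y_def using A[unfolded contraction_def, rule_format] by (rule sum_mono)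
  also have "\<dots> = (\<Sum>i<n * m. (cmod (w i))\<^sup>2)"
    unfolding sum_lessThan_mult by (rule sum.swap)
  finally show "(\<Sum>i<n * m. (cmod (\<Sum>j<n * m. kron A B $$ (i, j) * w j))\<^sup>2) \<le> (\<Sum>i<n * m. (cmod (w i))\<^sup>2)" .
qed

section \<open>Unitary invariance of Lebesgue measure\<close>

definition csq :: "nat \<Rightarrow> (nat \<Rightarrow> complex) \<Rightarrow> real" where
  "csq N x = (\<Sum>i<N. (cmod (x i))\<^sup>2)"

text \<open>Points of this product space are extensional, that is \<open>undefined\<close> outside
  \<open>{..<N}\<close>, whereas pure states vanish there. This is why unitaries act through
  \<open>lin\<close> here and through \<open>act\<close> on states.\<close>

definition cleb :: "nat \<Rightarrow> (nat \<Rightarrow> complex) measure" where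
  "cleb N = Pi\<^sub>M {..<N} (\<lambda>_. lborel)"

definition vshift :: "nat \<Rightarrow> (nat \<Rightarrow> complex) \<Rightarrow> (nat \<Rightarrow> complex) \<Rightarrow> nat \<Rightarrow> complex" where
  "vshift N t x = (\<lambda>i\<in>{..<N}. x i + t i)"

definition lin :: "nat \<Rightarrow> complex mat \<Rightarrow> (nat \<Rightarrow> complex) \<Rightarrow> nat \<Rightarrow> complex" where
  "lin N U x = (\<lambda>i\<in>{..<N}. \<Sum>j<N. U $$ (i, j) * x j)"

lemma csq_nonneg [simp]: "0 \<le> csq N x"
  by (simp add: csq_def sum_nonneg)

lemma product_sigma_finite_lborel: "product_sigma_finite (\<lambda>_::nat. lborel :: complex measure)"
  by unfold_locales

lemma sigma_finite_cleb: "sigma_finite_measure (cleb N)"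
  unfolding cleb_def by (rule product_sigma_finite.sigma_finite[OF product_sigma_finite_lborel]) simp

lemma space_cleb: "space (cleb N) = {..<N} \<rightarrow>\<^sub>E UNIV"
  by (simp add: cleb_def space_PiM)

lemma emeasure_cleb:
  assumes "\<And>i. i < N \<Longrightarrow> A i \<in> sets borel"
  shows "emeasure (cleb N) (Pi\<^sub>E {..<N} A) = (\<Prod>i<N. emeasure lborel (A i))"
  unfolding cleb_def using assms
  by (intro product_sigma_finite.emeasure_PiM[OF product_sigma_finite_lborel]) auto

lemma measurable_cleb_component [measurable]: "i < N \<Longrightarrow> (\<lambda>x. x i) \<in> borel_measurable (cleb N)"
  unfolding cleb_def using measurable_component_singleton[of i "{..<N}" "\<lambda>_. lborel"] by simp

lemma measurable_into_cleb:
  assumes "\<And>i. i < N \<Longrightarrow> (\<lambda>x. f x i) \<in> borel_measurable M"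
  shows "(\<lambda>x. \<lambda>i\<in>{..<N}. f x i) \<in> M \<rightarrow>\<^sub>M cleb N"
  unfolding cleb_def using assms by (intro measurable_restrict) auto

lemma sets_cleb_PiE: "(\<And>i. i < N \<Longrightarrow> A i \<in> sets borel) \<Longrightarrow> Pi\<^sub>E {..<N} A \<in> sets (cleb N)"
  unfolding cleb_def by (intro sets_PiM_I_finite) auto

lemma csq_measurable [measurable]: "csq N \<in> borel_measurable (cleb N)"
  unfolding csq_def by measurable

lemma lin_measurable [measurable]: "lin N U \<in> cleb N \<rightarrow>\<^sub>M cleb N"
  unfolding lin_def by (intro measurable_into_cleb) measurable

lemma vshift_measurable [measurable]: "vshift N t \<in> cleb N \<rightarrow>\<^sub>M cleb N"
  unfolding vshift_def by (intro measurable_into_cleb) measurable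

text \<open>A product measure is determined by boxes, and on a box the claim factors into
  translation invariance in the complex plane.\<close>

lemma distr_cleb_shift: "distr (cleb N) (cleb N) (vshift N t) = cleb N"
  unfolding cleb_def
proof (rule product_sigma_finite.PiM_eqI[OF product_sigma_finite_lborel])
  fix A :: "nat \<Rightarrow> complex set" assume A: "\<And>i. i \<in> {..<N} \<Longrightarrow> A i \<in> sets lborel"
  have "emeasure (distr (cleb N) (cleb N) (vshift N t)) (Pi\<^sub>E {..<N} A)
      = emeasure (cleb N) (vshift N t -` Pi\<^sub>E {..<N} A \<inter> space (cleb N))"
    using A by (intro emeasure_distr vshift_measurable sets_cleb_PiE) auto
  also have "vshift N t -` Pi\<^sub>E {..<N} A \<inter> space (cleb N) = Pi\<^sub>E {..<N} (\<lambda>i. (+) (t i) -` A i)"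
    by (auto simp: vshift_def space_cleb PiE_iff add.commute)
  also have "emeasure (cleb N) \<dots> = (\<Prod>i<N. emeasure lborel ((+) (t i) -` A i))"
    using A by (intro emeasure_cleb) (auto intro!: measurable_sets_borel[of _ borel])
  also have "\<dots> = (\<Prod>i<N. emeasure lborel (A i))"
  proof (rule prod.cong)
    fix i assume i: "i \<in> {..<N}"
    have "emeasure lborel (A i) = emeasure (distr lborel borel ((+) (t i))) (A i)"
      by (simp add: lborel_distr_plus)
    also have "\<dots> = emeasure lborel ((+) (t i) -` A i)"
      using A[OF i] by (subst emeasure_distr) auto
    finally show "emeasure lborel ((+) (t i) -` A i) = emeasure lborel (A i)" by simp
  qed simp
  finally show "emeasure (distr (Pi\<^sub>M {..<N} (\<lambda>_. lborel)) (Pi\<^sub>M {..<N} (\<lambda>_. lborel)) (vshift N t)) (Pi\<^sub>E {..<N} A)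
      = (\<Prod>i<N. emeasure lborel (A i))" by (simp add: cleb_def)
qed auto

lemma nn_integral_cleb_shift:
  assumes [measurable]: "f \<in> borel_measurable (cleb N)"
  shows "(\<integral>\<^sup>+x. f (vshift N t x) \<partial>cleb N) = (\<integral>\<^sup>+x. f x \<partial>cleb N)"
proof -
  have "(\<integral>\<^sup>+x. f x \<partial>cleb N) = (\<integral>\<^sup>+x. f x \<partial>distr (cleb N) (cleb N) (vshift N t))"
    by (simp add: distr_cleb_shift)
  also have "\<dots> = (\<integral>\<^sup>+x. f (vshift N t x) \<partial>cleb N)" by (rule nn_integral_distr) auto
  finally show ?thesis by simp
qed

lemma unitary_rows:
  assumes "unitary N U" "i < N" "k < N"
  shows "(\<Sum>j<N. U $$ (i, j) * cnj (U $$ (k, j))) = (if i = k then 1 else 0)"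
proof -
  have U: "U \<in> carrier_mat N N" "U * madj U = 1\<^sub>m N" using assms by (auto simp: unitary_def)
  have cM: "madj U \<in> carrier_mat N N" using U by (simp add: madj_def)
  have "(\<Sum>j<N. U $$ (i, j) * madj U $$ (j, k)) = (1\<^sub>m N :: complex mat) $$ (i, k)"
    using mat_mult_index[OF U(1) cM assms(2,3)] U by simp
  then show ?thesis using assms U by (simp add: madj_def)
qed

lemma unitary_cols:
  assumes "unitary N U" "i < N" "k < N"
  shows "(\<Sum>j<N. cnj (U $$ (j, i)) * U $$ (j, k)) = (if i = k then 1 else 0)"
proof -
  have U: "U \<in> carrier_mat N N" "U * madj U = 1\<^sub>m N" using assms by (auto simp: unitary_def)
  have cM: "madj U \<in> carrier_mat N N" using U by (simp add: madj_def)
  have "madj U * U = 1\<^sub>m N" by (rule mat_mult_left_right_inverse[OF U(1) cM U(2)])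
  then have "(\<Sum>j<N. madj U $$ (i, j) * U $$ (j, k)) = (1\<^sub>m N :: complex mat) $$ (i, k)"
    using mat_mult_index[OF cM U(1) assms(2,3)] by simp
  then show ?thesis using assms U by (simp add: madj_def)
qed

lemma csq_unitary:
  assumes U: "unitary N U"
  shows "csq N (\<lambda>i. \<Sum>j<N. U $$ (i, j) * x j) = csq N x"
proof -
  have "complex_of_real (csq N (\<lambda>i. \<Sum>j<N. U $$ (i, j) * x j)) =
      (\<Sum>i<N. (\<Sum>k<N. U $$ (i, k) * x k) * cnj (\<Sum>j<N. U $$ (i, j) * x j))"
    unfolding csq_def of_real_sum complex_norm_square by simp
  also have "\<dots> = (\<Sum>i<N. \<Sum>k<N. \<Sum>j<N. (cnj (U $$ (i, j)) * U $$ (i, k)) * (x k * cnj (x j)))"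
    by (simp add: sum_product mult_ac)
  also have "\<dots> = (\<Sum>k<N. \<Sum>i<N. \<Sum>j<N. (cnj (U $$ (i, j)) * U $$ (i, k)) * (x k * cnj (x j)))"
    by (rule sum.swap)
  also have "\<dots> = (\<Sum>k<N. \<Sum>j<N. \<Sum>i<N. (cnj (U $$ (i, j)) * U $$ (i, k)) * (x k * cnj (x j)))"
    by (intro sum.cong sum.swap refl)
  also have "\<dots> = (\<Sum>k<N. \<Sum>j<N. (if j = k then 1 else 0) * (x k * cnj (x j)))"
    by (simp add: sum_distrib_right[symmetric] unitary_cols[OF U])
  also have "\<dots> = (\<Sum>k<N. x k * cnj (x k))"
    by (intro sum.cong refl) (simp add: if_distrib[of "\<lambda>c. c * _"] cong: if_cong)
  also have "\<dots> = complex_of_real (csq N x)"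
    unfolding csq_def of_real_sum complex_norm_square by simp
  finally show ?thesis by (metis of_real_eq_iff)
qed

lemma csq_cong: "(\<And>i. i < N \<Longrightarrow> x i = y i) \<Longrightarrow> csq N x = csq N y"
  by (simp add: csq_def)

lemma csq_lin: "unitary N U \<Longrightarrow> csq N (lin N U x) = csq N x"
  using csq_unitary[of N U x] csq_cong[of N "lin N U x" "\<lambda>i. \<Sum>j<N. U $$ (i, j) * x j"]
  by (simp add: lin_def)

text \<open>The adjoint of a unitary is its inverse, so a translation after \<open>U\<close> can be
  replaced by a translation before it.\<close>

lemma lin_shift_adjoint:
  assumes U: "unitary N U" and i: "i < N"
  shows "lin N U (vshift N (lin N (madj U) y) x) i = lin N U x i + y i"
proof -
  have car: "U \<in> carrier_mat N N" using U by (simp add: unitary_def)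
  have "lin N U (vshift N (lin N (madj U) y) x) i
      = (\<Sum>j<N. U $$ (i, j) * (x j + (\<Sum>k<N. cnj (U $$ (k, j)) * y k)))"
    using i car by (auto simp: lin_def vshift_def madj_def intro!: sum.cong)
  also have "\<dots> = (\<Sum>j<N. U $$ (i, j) * x j) + (\<Sum>j<N. \<Sum>k<N. U $$ (i, j) * cnj (U $$ (k, j)) * y k)"
    by (simp add: distrib_left sum.distrib sum_distrib_left mult.assoc)
  also have "(\<Sum>j<N. \<Sum>k<N. U $$ (i, j) * cnj (U $$ (k, j)) * y k)
      = (\<Sum>k<N. (\<Sum>j<N. U $$ (i, j) * cnj (U $$ (k, j))) * y k)"
    by (subst sum.swap) (simp add: sum_distrib_right)
  also have "\<dots> = y i"
    using i by (simp add: unitary_rows[OF U] if_distrib[of "\<lambda>c. c * _"] cong: if_cong)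
  also have "(\<Sum>j<N. U $$ (i, j) * x j) = lin N U x i" using i by (simp add: lin_def)
  finally show ?thesis .
qed

text \<open>This set serves twice. It is unitarily invariant with positive finite measure, so its
  measure can be cancelled from an equation; and it omits the origin, so its points can be divided
  by their length.\<close>

definition punctured_ball :: "nat \<Rightarrow> (nat \<Rightarrow> complex) set" where
  "punctured_ball N = {x \<in> space (cleb N). 0 < csq N x \<and> csq N x < 1}"

lemma punctured_ball_sets [measurable]: "punctured_ball N \<in> sets (cleb N)"
  unfolding punctured_ball_def by measurable

lemma emeasure_punctured_ball_finite: "emeasure (cleb N) (punctured_ball N) < \<infinity>"
proof -
  have "x i \<in> cball 0 1" if "csq N x < 1" "i < N" for x i
  proof -
    have "(cmod (x i))\<^sup>2 \<le> csq N x"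
      unfolding csq_def using that by (intro member_le_sum) auto
    then have "(cmod (x i))\<^sup>2 \<le> 1\<^sup>2" using that by simp
    then have "cmod (x i) \<le> 1" by (rule power2_le_imp_le) simp
    then show ?thesis by simp
  qed
  then have "emeasure (cleb N) (punctured_ball N) \<le> emeasure (cleb N) (Pi\<^sub>E {..<N} (\<lambda>_. cball 0 1))"
    by (intro emeasure_mono)
      (auto simp: punctured_ball_def space_cleb PiE_iff extensional_def intro!: sets_cleb_PiE)
  also have "\<dots> = (\<Prod>i<N. emeasure lborel (cball 0 1 :: complex set))"
    by (rule emeasure_cleb) auto
  also have "\<dots> < \<infinity>" using emeasure_lborel_cball_finite[of "0::complex" 1] by (simp add: power_less_top_ennreal)
  finally show ?thesis .
qed

lemma emeasure_punctured_ball_pos: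
  assumes "1 \<le> N"
  shows "0 < emeasure (cleb N) (punctured_ball N)"
proof -
  \<comment> \<open>The disc with centre and radius \<open>a\<close> avoids zero, and its points
    have modulus below \<open>2 * a = 1 / N\<close>. Their squared moduli are then below
    \<open>1 / N\<close> as well, so \<open>N\<close> such coordinates stay inside the unit
    ball.\<close>
  define a :: real where "a = 1 / (2 * real N)"
  have a: "a > 0" using assms by (simp add: a_def)
  let ?S = "ball (complex_of_real a) a"
  have S: "z \<noteq> 0" "(cmod z)\<^sup>2 < 1 / real N" if "z \<in> ?S" for z
  proof -
    show "z \<noteq> 0" using that a by (auto simp: dist_norm)
    have "cmod z \<le> cmod (complex_of_real a - z) + cmod (complex_of_real a)"
      by (metis norm_triangle_sub add.commute norm_minus_commute)
    also have "\<dots> < a + a" using that a by (simp add: dist_norm)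
    also have "a + a = 1 / real N" by (simp add: a_def)
    finally have z: "cmod z < 1 / real N" .
    then have "(cmod z)\<^sup>2 < (1 / real N)\<^sup>2" by (intro power_strict_mono) auto
    also have "\<dots> \<le> 1 / real N" using assms by (simp add: power2_eq_square field_simps)
    finally show "(cmod z)\<^sup>2 < 1 / real N" .
  qed
  have "0 < (\<Prod>i<N. emeasure lborel ?S)"
  proof -
    have "0 < unit_ball_vol 2 * a\<^sup>2" using a unit_ball_vol_pos[of 2] by simp
    moreover have "emeasure lborel ?S = ennreal (unit_ball_vol 2 * a\<^sup>2)"
      using a by (simp add: emeasure_ball)
    ultimately have "0 < emeasure lborel ?S" by (metis ennreal_less_zero_iff)
    then have "0 < (\<Prod>i<n. emeasure lborel ?S)" for n :: nat
      by (induction n) (simp_all add: ennreal_zero_less_mult_iff)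
    then show ?thesis .
  qed
  also have "\<dots> = emeasure (cleb N) (Pi\<^sub>E {..<N} (\<lambda>_. ?S))"
    by (rule emeasure_cleb[symmetric]) auto
  also have "\<dots> \<le> emeasure (cleb N) (punctured_ball N)"
  proof (rule emeasure_mono)
    show "Pi\<^sub>E {..<N} (\<lambda>_. ?S) \<subseteq> punctured_ball N"
    proof
      fix x assume x: "x \<in> Pi\<^sub>E {..<N} (\<lambda>_. ?S)"
      have xs: "x i \<in> ?S" if "i < N" for i using x that by (auto simp: PiE_iff)
      have "csq N x < (\<Sum>i<N. 1 / real N)"
        unfolding csq_def
      proof (rule sum_strict_mono)
        show "{..<N} \<noteq> {}" using assms by (auto simp: lessThan_empty_iff)
        show "(cmod (x i))\<^sup>2 < 1 / real N" if "i \<in> {..<N}" for i using S(2)[OF xs] that by blast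
      qed simp
      then have "csq N x < 1" using assms by simp
      moreover have "0 < csq N x"
        unfolding csq_def
      proof (rule sum_pos)
        show "{..<N} \<noteq> {}" using assms by (auto simp: lessThan_empty_iff)
        show "0 < (cmod (x i))\<^sup>2" if "i \<in> {..<N}" for i using S(1)[OF xs] that by simp
      qed simp
      ultimately show "x \<in> punctured_ball N"
        using x unfolding punctured_ball_def space_cleb by (simp add: PiE_iff)
    qed
  qed simp
  finally show ?thesis .
qed

text \<open>Writing the product \<open>\<lambda>(U\<^sup>-\<^sup>1 A) \<lambda>(B)\<close> as a double integral and using translation invariance in
  each variable turns it into \<open>\<lambda>(A) \<lambda>(- U\<^sup>-\<^sup>1 B)\<close>; for the ball \<open>B\<close> the second factor is again
  \<open>\<lambda>(B)\<close>.\<close>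

lemma distr_cleb_unitary:
  assumes N: "1 \<le> N" and U: "unitary N U"
  shows "distr (cleb N) (cleb N) (lin N U) = cleb N"
proof (rule measure_eqI)
  show "sets (distr (cleb N) (cleb N) (lin N U)) = sets (cleb N)" by simp
  fix A assume "A \<in> sets (distr (cleb N) (cleb N) (lin N U))"
  then have [measurable]: "A \<in> sets (cleb N)" by simp
  let ?L = "cleb N" and ?B = "punctured_ball N"
  interpret L: sigma_finite_measure ?L by (rule sigma_finite_cleb)
  interpret P: pair_sigma_finite ?L ?L by unfold_locales
  define neg where "neg x = (\<lambda>i\<in>{..<N}. - lin N U x i)" for x
  have lin_sp: "lin N U x \<in> space ?L" for x by (auto simp: lin_def space_cleb)
  have neg_meas [measurable]: "neg \<in> ?L \<rightarrow>\<^sub>M ?L"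
    unfolding neg_def lin_def by (intro measurable_into_cleb) (auto intro!: borel_measurable_uminus)
  have shl: "(\<lambda>p. vshift N (lin N U (fst p)) (snd p)) \<in> ?L \<Otimes>\<^sub>M ?L \<rightarrow>\<^sub>M ?L"
    unfolding vshift_def lin_def by (intro measurable_into_cleb) (auto cong: if_cong)
  have shn: "(\<lambda>p. vshift N (neg (fst p)) (snd p)) \<in> ?L \<Otimes>\<^sub>M ?L \<rightarrow>\<^sub>M ?L"
    unfolding vshift_def neg_def lin_def by (intro measurable_into_cleb) (auto cong: if_cong)
  note [measurable] = shl[unfolded split_beta'[symmetric]] shn
  have "emeasure ?L (lin N U -` A \<inter> space ?L) * emeasure ?L ?B
      = (\<integral>\<^sup>+y. indicator ?B y * (\<integral>\<^sup>+x. indicator A (lin N U x) \<partial>?L) \<partial>?L)"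
  proof -
    have "(\<integral>\<^sup>+x. indicator A (lin N U x) \<partial>?L) = (\<integral>\<^sup>+x. indicator (lin N U -` A \<inter> space ?L) x \<partial>?L)"
      by (intro nn_integral_cong) (auto split: split_indicator)
    also have "\<dots> = emeasure ?L (lin N U -` A \<inter> space ?L)" by (rule nn_integral_indicator) measurable
    finally show ?thesis by (simp add: nn_integral_multc mult.commute)
  qed
  \<comment> \<open>For fixed \<open>y\<close>, translating \<open>x\<close> by the adjoint image of
    \<open>y\<close> replaces \<open>U x\<close> by \<open>U x + y\<close>.\<close>
  also have "\<dots> = (\<integral>\<^sup>+y. (\<integral>\<^sup>+x. indicator ?B y * indicator A (vshift N (lin N U x) y) \<partial>?L) \<partial>?L)"
  proof (rule nn_integral_cong)
    fix y assume y: "y \<in> space ?L"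
    have "(\<integral>\<^sup>+x. indicator A (lin N U x) \<partial>?L) =
        (\<integral>\<^sup>+x. indicator A (lin N U (vshift N (lin N (madj U) y) x)) \<partial>?L :: ennreal)"
      by (rule nn_integral_cleb_shift[symmetric]) measurable
    also have "\<dots> = (\<integral>\<^sup>+x. indicator A (vshift N (lin N U x) y) \<partial>?L)"
    proof (rule nn_integral_cong)
      fix x
      have "lin N U (vshift N (lin N (madj U) y) x) i = vshift N (lin N U x) y i" for i
      proof (cases "i < N")
        case True
        then show ?thesis using lin_shift_adjoint[OF U True, of y x] by (simp add: vshift_def[of N "lin N U x"] add.commute)
      next
        case False
        then show ?thesis by (simp add: vshift_def lin_def)
      qed
      then have "lin N U (vshift N (lin N (madj U) y) x) = vshift N (lin N U x) y" by blast
      then show "indicator A (lin N U (vshift N (lin N (madj U) y) x))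
          = (indicator A (vshift N (lin N U x) y) :: ennreal)" by simp
    qed
    finally show "indicator ?B y * (\<integral>\<^sup>+x. indicator A (lin N U x) \<partial>?L)
        = (\<integral>\<^sup>+x. indicator ?B y * indicator A (vshift N (lin N U x) y) \<partial>?L)"
      using y by (subst nn_integral_cmult) (auto intro!: measurable_compose[OF _ borel_measurable_indicator] measurable_compose[OF _ shl, of "\<lambda>x. (x, y)", simplified])
  qed
  also have "\<dots> = (\<integral>\<^sup>+x. (\<integral>\<^sup>+y. indicator ?B y * indicator A (vshift N (lin N U x) y) \<partial>?L) \<partial>?L)"
    by (rule P.Fubini') (simp add: split_beta')
  \<comment> \<open>Translating \<open>y\<close> by \<open>- U x\<close> moves the shift from
    \<open>A\<close> onto the ball.\<close>
  also have "\<dots> = (\<integral>\<^sup>+x. (\<integral>\<^sup>+y. indicator ?B (vshift N (neg x) y) * indicator A y \<partial>?L) \<partial>?L)"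
  proof (rule nn_integral_cong)
    fix x assume x: "x \<in> space ?L"
    have "(\<integral>\<^sup>+y. indicator ?B (vshift N (neg x) y) * indicator A y \<partial>?L) =
      (\<integral>\<^sup>+y. indicator ?B (vshift N (neg x) (vshift N (lin N U x) y)) * indicator A (vshift N (lin N U x) y) \<partial>?L :: ennreal)"
      by (rule nn_integral_cleb_shift[symmetric]) measurable
    also have "\<dots> = (\<integral>\<^sup>+y. indicator ?B y * indicator A (vshift N (lin N U x) y) \<partial>?L)"
    proof (rule nn_integral_cong)
      fix y assume "y \<in> space ?L"
      then have "vshift N (neg x) (vshift N (lin N U x) y) = y"
        by (auto simp: vshift_def neg_def space_cleb PiE_iff extensional_def fun_eq_iff)
      then show "indicator ?B (vshift N (neg x) (vshift N (lin N U x) y)) * indicator A (vshift N (lin N U x) y)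
          = (indicator ?B y * indicator A (vshift N (lin N U x) y) :: ennreal)" by simp
    qed
    finally show "(\<integral>\<^sup>+y. indicator ?B y * indicator A (vshift N (lin N U x) y) \<partial>?L)
        = (\<integral>\<^sup>+y. indicator ?B (vshift N (neg x) y) * indicator A y \<partial>?L)" by simp
  qed
  also have "\<dots> = (\<integral>\<^sup>+y. (\<integral>\<^sup>+x. indicator ?B (vshift N (neg x) y) * indicator A y \<partial>?L) \<partial>?L)"
    by (rule P.Fubini'[symmetric]) (simp add: split_beta')
  \<comment> \<open>One more translation in \<open>x\<close> turns \<open>y - U x\<close> into
    \<open>- U x\<close>. Membership in the ball depends only on the length, which \<open>U\<close>
    and the sign preserve, so the dependence on \<open>y\<close> disappears.\<close>
  also have "\<dots> = (\<integral>\<^sup>+y. emeasure ?L ?B * indicator A y \<partial>?L)"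
  proof (rule nn_integral_cong)
    fix y assume y: "y \<in> space ?L"
    have shny: "(\<lambda>x. vshift N (neg x) y) \<in> ?L \<rightarrow>\<^sub>M ?L"
      using measurable_compose[OF _ shn, of "\<lambda>x. (x, y)" ?L] y by simp
    have "(\<integral>\<^sup>+x. indicator ?B (vshift N (neg x) y) * indicator A y \<partial>?L) =
        (\<integral>\<^sup>+x. indicator ?B (vshift N (neg x) y) \<partial>?L) * indicator A y"
      using shny by (intro nn_integral_multc) measurable
    also have "(\<integral>\<^sup>+x. indicator ?B (vshift N (neg x) y) \<partial>?L) =
        (\<integral>\<^sup>+x. indicator ?B (vshift N (neg (vshift N (lin N (madj U) y) x)) y) \<partial>?L)"
      using shny by (intro nn_integral_cleb_shift[symmetric]) measurable
    also have "\<dots> = (\<integral>\<^sup>+x. indicator ?B x \<partial>?L)"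
    proof (rule nn_integral_cong)
      fix x assume x: "x \<in> space ?L"
      have "vshift N (neg (vshift N (lin N (madj U) y) x)) y i = neg x i" for i
        using lin_shift_adjoint[OF U, of i y x] by (cases "i < N") (auto simp: vshift_def neg_def)
      then have eq: "vshift N (neg (vshift N (lin N (madj U) y) x)) y = neg x" by blast
      have "csq N (neg x) = csq N (lin N U x)" by (simp add: csq_def neg_def)
      then have "csq N (neg x) = csq N x" using csq_lin[OF U] by simp
      moreover have "neg x \<in> space ?L" by (auto simp: neg_def space_cleb)
      ultimately show "indicator ?B (vshift N (neg (vshift N (lin N (madj U) y) x)) y)
          = (indicator ?B x :: ennreal)"
        unfolding eq using x by (auto simp: punctured_ball_def split: split_indicator)
    qed
    also have "\<dots> = emeasure ?L ?B" by (rule nn_integral_indicator) measurable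
    finally show "(\<integral>\<^sup>+x. indicator ?B (vshift N (neg x) y) * indicator A y \<partial>?L) = emeasure ?L ?B * indicator A y" .
  qed
  also have "\<dots> = emeasure ?L ?B * emeasure ?L A" by (simp add: nn_integral_cmult)
  finally have "emeasure ?L ?B * emeasure ?L (lin N U -` A \<inter> space ?L) = emeasure ?L ?B * emeasure ?L A"
    by (simp add: mult.commute)
  then have "emeasure ?L (lin N U -` A \<inter> space ?L) = emeasure ?L A"
    using emeasure_punctured_ball_pos[OF N] emeasure_punctured_ball_finite[of N]
    by (auto simp: ennreal_mult_cancel_left)
  then show "emeasure (distr ?L ?L (lin N U)) A = emeasure ?L A"
    by (simp add: emeasure_distr)
qed

section \<open>The uniform measure on pure states\<close>

text \<open>The predicate under the definite description in \<open>haar\<close>. Working with it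
  keeps the arguments valid for any invariant measure, and existence with uniqueness transfers them
  to \<open>haar N\<close>.\<close>

definition haar_like :: "nat \<Rightarrow> (nat \<Rightarrow> complex) measure \<Rightarrow> bool" where
  "haar_like N M \<longleftrightarrow> prob_space M \<and> sets M = sets (state_space N) \<and>
      (\<forall>U. unitary N U \<longrightarrow> distr M M (act N U) = M)"

lemma pure_states_iff: "\<psi> \<in> pure_states N \<longleftrightarrow> (\<forall>i\<ge>N. \<psi> i = 0) \<and> csq N \<psi> = 1"
  by (simp add: pure_states_def csq_def)

lemma csq_borel_measurable [measurable]: "csq N \<in> borel_measurable borel"
  unfolding csq_def by (intro borel_measurable_sum borel_measurable_power
      measurable_compose[OF measurable_product_coordinates borel_measurable_norm])

lemma pure_states_borel [measurable]: "pure_states N \<in> sets borel"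
proof -
  have "{\<psi> \<in> space (borel :: (nat \<Rightarrow> complex) measure). (\<forall>i. i \<ge> N \<longrightarrow> \<psi> i = 0) \<and> csq N \<psi> = 1} \<in> sets borel"
    by measurable
  moreover have "pure_states N = {\<psi> \<in> space (borel :: (nat \<Rightarrow> complex) measure). (\<forall>i. i \<ge> N \<longrightarrow> \<psi> i = 0) \<and> csq N \<psi> = 1}"
    by (auto simp: pure_states_iff)
  ultimately show ?thesis by simp
qed

lemma space_state_space [simp]: "space (state_space N) = pure_states N"
  by (simp add: state_space_def space_restrict_space)

lemma measurable_from_state_space:
  "f \<in> borel_measurable borel \<Longrightarrow> f \<in> borel_measurable (state_space N)"
  unfolding state_space_def by (rule measurable_restrict_space1)

lemma state_space_component [measurable]: "(\<lambda>\<psi>. \<psi> i) \<in> borel_measurable (state_space N)"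
  by (intro measurable_from_state_space measurable_product_coordinates)

lemma measurable_into_state_space:
  assumes "\<And>i. (\<lambda>x. f x i) \<in> borel_measurable M" "\<And>x. x \<in> space M \<Longrightarrow> f x \<in> pure_states N"
  shows "f \<in> M \<rightarrow>\<^sub>M state_space N"
  unfolding state_space_def using assms
  by (intro measurable_restrict_space2 measurable_coordinatewise_then_product) auto

lemma act_eq:
  assumes "U \<in> carrier_mat N N"
  shows "act N U \<psi> = (\<lambda>i. if i < N then \<Sum>j<N. U $$ (i, j) * \<psi> j else 0)"
proof
  fix i
  show "act N U \<psi> i = (if i < N then \<Sum>j<N. U $$ (i, j) * \<psi> j else 0)"
    using mat_vec_mult_index[OF assms, of "vec N \<psi>" i] by (simp add: act_def)
qed

lemma csq_act: "unitary N U \<Longrightarrow> csq N (act N U \<psi>) = csq N \<psi>"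
  using csq_unitary[of N U \<psi>] csq_cong[of N "act N U \<psi>" "\<lambda>i. \<Sum>j<N. U $$ (i, j) * \<psi> j"]
  by (simp add: act_eq unitary_def)

lemma act_pure_states: "unitary N U \<Longrightarrow> \<psi> \<in> pure_states N \<Longrightarrow> act N U \<psi> \<in> pure_states N"
  by (simp add: pure_states_iff csq_act) (simp add: act_def)

lemma act_measurable: "unitary N U \<Longrightarrow> act N U \<in> state_space N \<rightarrow>\<^sub>M state_space N"
proof (rule measurable_into_state_space)
  assume U: "unitary N U"
  then have car: "U \<in> carrier_mat N N" by (simp add: unitary_def)
  show "(\<lambda>x. act N U x i) \<in> borel_measurable (state_space N)" for i
    unfolding act_eq[OF car] by measurable
  show "x \<in> space (state_space N) \<Longrightarrow> act N U x \<in> pure_states N" for x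
    using act_pure_states[OF U] by simp
qed

text \<open>The value where \<open>csq N x\<close> vanishes is an arbitrary choice of unit vector;
  it makes the map total into the sphere for \<open>1 \<le> N\<close>.\<close>

definition normalise :: "nat \<Rightarrow> (nat \<Rightarrow> complex) \<Rightarrow> nat \<Rightarrow> complex" where
  "normalise N x = (if csq N x > 0 then (\<lambda>i. if i < N then x i / of_real (sqrt (csq N x)) else 0)
     else (\<lambda>i. if i = 0 then 1 else 0))"

lemma normalise_pure_states:
  assumes "1 \<le> N"
  shows "normalise N x \<in> pure_states N"
proof (cases "csq N x > 0")
  case True
  define s where "s = sqrt (csq N x)"
  have s: "s > 0" "s\<^sup>2 = csq N x" using True by (auto simp: s_def)
  have eq: "normalise N x = (\<lambda>i. if i < N then x i / of_real s else 0)"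
    unfolding normalise_def s_def using True by simp
  have "csq N (normalise N x) = (\<Sum>i<N. (cmod (x i))\<^sup>2 / s\<^sup>2)"
    unfolding eq csq_def by (simp add: norm_divide power_divide)
  also have "\<dots> = csq N x / s\<^sup>2" unfolding csq_def by (simp add: sum_divide_distrib)
  also have "\<dots> = 1" using True s by simp
  finally show ?thesis unfolding pure_states_iff by (simp add: eq)
next
  case False
  have "(\<Sum>i<N. (cmod (if i = 0 then 1 else 0))\<^sup>2) = (\<Sum>i<N. if i = 0 then 1 else (0::real))"
    by (intro sum.cong) auto
  then show ?thesis using False assms by (auto simp: pure_states_iff normalise_def csq_def)
qed

lemma normalise_measurable: "1 \<le> N \<Longrightarrow> normalise N \<in> cleb N \<rightarrow>\<^sub>M state_space N"
proof (rule measurable_into_state_space)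
  fix i
  have [measurable]: "(\<lambda>x. if i < N then x i / of_real (sqrt (csq N x)) else 0) \<in> borel_measurable (cleb N)"
    by (cases "i < N") (simp_all, measurable)
  have "(\<lambda>x. normalise N x i) =
     (\<lambda>x. if csq N x > 0 then (if i < N then x i / of_real (sqrt (csq N x)) else 0) else (if i = 0 then 1 else 0))"
    by (auto simp: normalise_def)
  then show "(\<lambda>x. normalise N x i) \<in> borel_measurable (cleb N)" by simp
qed (simp add: normalise_pure_states)

lemma act_normalise:
  assumes U: "unitary N U" and "csq N x > 0"
  shows "act N U (normalise N x) = normalise N (lin N U x)"
proof
  fix i
  have car: "U \<in> carrier_mat N N" using U by (simp add: unitary_def)
  show "act N U (normalise N x) i = normalise N (lin N U x) i"
    unfolding act_eq[OF car] normalise_def csq_lin[OF U] using assms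
    by (auto simp: lin_def sum_divide_distrib)
qed

lemma haar_like_exists:
  assumes N: "1 \<le> N"
  shows "\<exists>M. haar_like N M"
proof -
  let ?L = "cleb N" and ?B = "punctured_ball N"
  define W where "W = uniform_measure ?L ?B"
  have [measurable_cong]: "sets W = sets ?L" by (simp add: W_def)
  define M where "M = distr W (state_space N) (normalise N)"
  have nm: "normalise N \<in> W \<rightarrow>\<^sub>M state_space N"
    using normalise_measurable[OF N] by (simp add: measurable_cong_sets[OF \<open>sets W = sets ?L\<close> refl])
  have "prob_space W"
    unfolding W_def using emeasure_punctured_ball_pos[OF N] emeasure_punctured_ball_finite[of N]
    by (intro prob_space_uniform_measure) auto
  then have "prob_space M" unfolding M_def using nm by (rule prob_space.prob_space_distr)
  moreover have sM: "sets M = sets (state_space N)" by (simp add: M_def)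
  moreover have "distr M M (act N U) = M" if U: "unitary N U" for U
  proof -
    have W_inv: "distr W W (lin N U) = W"
    proof (rule measure_eqI)
      fix A assume "A \<in> sets (distr W W (lin N U))"
      then have [measurable]: "A \<in> sets ?L" by (simp add: W_def)
      have [measurable]: "lin N U -` A \<inter> space ?L \<in> sets ?L" by measurable
      have "emeasure (distr W W (lin N U)) A = emeasure W (lin N U -` A \<inter> space ?L)"
        by (subst emeasure_distr) (simp_all add: W_def)
      also have "\<dots> = emeasure ?L (?B \<inter> (lin N U -` A \<inter> space ?L)) / emeasure ?L ?B"
        unfolding W_def by (rule emeasure_uniform_measure) measurable
      also have "?B \<inter> (lin N U -` A \<inter> space ?L) = lin N U -` (?B \<inter> A) \<inter> space ?L"
        using csq_lin[OF U] by (auto simp: punctured_ball_def lin_def space_cleb)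
      also have "emeasure ?L \<dots> = emeasure (distr ?L ?L (lin N U)) (?B \<inter> A)"
        by (subst emeasure_distr) auto
      also have "\<dots> = emeasure ?L (?B \<inter> A)" by (simp add: distr_cleb_unitary[OF N U])
      also have "\<dots> / emeasure ?L ?B = emeasure W A"
        unfolding W_def by (rule emeasure_uniform_measure[symmetric]) measurable
      finally show "emeasure (distr W W (lin N U)) A = emeasure W A" .
    qed simp
    have [measurable]: "act N U \<in> state_space N \<rightarrow>\<^sub>M state_space N" by (rule act_measurable[OF U])
    note [measurable] = nm
    have "distr M M (act N U) = distr M (state_space N) (act N U)"
      by (rule distr_cong) (auto simp: sM)
    also have "\<dots> = distr W (state_space N) (act N U \<circ> normalise N)"
      unfolding M_def by (rule distr_distr) auto
    \<comment> \<open>Normalisation commutes with \<open>U\<close> away from the origin, where its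
      default value does not intervene; almost everywhere agreement suffices because
      \<open>W\<close> is concentrated on the punctured ball.\<close>
    also have "\<dots> = distr W (state_space N) (normalise N \<circ> lin N U)"
    proof (rule distr_cong_AE)
      have "AE x in ?L. x \<in> ?B \<longrightarrow> (act N U \<circ> normalise N) x = (normalise N \<circ> lin N U) x"
        using act_normalise[OF U] by (auto simp: punctured_ball_def)
      then show "AE x in W. (act N U \<circ> normalise N) x = (normalise N \<circ> lin N U) x"
        unfolding W_def by (intro AE_uniform_measureI) auto
    qed auto
    also have "\<dots> = distr (distr W W (lin N U)) (state_space N) (normalise N)"
      by (rule distr_distr[symmetric]) auto
    also have "\<dots> = M" by (simp add: W_inv M_def)
    finally show ?thesis .
  qed
  ultimately show ?thesis unfolding haar_like_def by blast
qed

text \<open>The matrix \<open>1 + c v v^*\<close>, a complex Householder map. When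
  \<open>c |v|^2 = z - 1\<close> with \<open>|z| = 1\<close>, it multiplies \<open>v\<close> by
  \<open>z\<close> and fixes the orthogonal complement; the condition in
  \<open>unitary_reflect\<close> expresses \<open>|z| = 1\<close>.\<close>

definition reflect :: "nat \<Rightarrow> complex \<Rightarrow> (nat \<Rightarrow> complex) \<Rightarrow> complex mat" where
  "reflect N c v = mat N N (\<lambda>(i, j). (if i = j then 1 else 0) + c * v i * cnj (v j))"

lemma unitary_reflect:
  assumes "c + cnj c + c * cnj c * of_real (csq N v) = 0"
  shows "unitary N (reflect N c v)"
proof -
  let ?R = "reflect N c v"
  have car: "?R \<in> carrier_mat N N" by (simp add: reflect_def)
  have cadj: "madj ?R \<in> carrier_mat N N" by (simp add: reflect_def madj_def)
  have s: "(\<Sum>l<N. cnj (v l) * v l) = of_real (csq N v)"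
    unfolding csq_def of_real_sum complex_norm_square by (simp add: mult.commute)
  have "?R * madj ?R = 1\<^sub>m N"
  proof (rule eq_matI)
    fix i j assume "i < dim_row (1\<^sub>m N :: complex mat)" "j < dim_col (1\<^sub>m N :: complex mat)"
    then have ij: "i < N" "j < N" by auto
    have "(?R * madj ?R) $$ (i, j) = (\<Sum>l<N. ((if i = l then 1 else 0) + c * v i * cnj (v l)) *
        ((if l = j then 1 else 0) + cnj c * cnj (v j) * v l))"
      unfolding mat_mult_index[OF car cadj ij] using ij
      by (intro sum.cong) (auto simp: reflect_def madj_def)
    also have "\<dots> = (\<Sum>l<N. (if i = l then (if l = j then 1 else 0) + cnj c * cnj (v j) * v l else 0)
        + (if l = j then c * v i * cnj (v l) else 0)
        + c * v i * cnj c * cnj (v j) * (cnj (v l) * v l))"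
      by (intro sum.cong) (auto simp: algebra_simps)
    also have "\<dots> = (if i = j then 1 else 0) + cnj c * cnj (v j) * v i + c * v i * cnj (v j)
        + c * v i * cnj c * cnj (v j) * of_real (csq N v)"
      unfolding s[symmetric] using ij by (simp add: sum.distrib sum_distrib_left)
    also have "\<dots> = (if i = j then 1 else 0) + (c + cnj c + c * cnj c * of_real (csq N v)) * (v i * cnj (v j))"
      by (simp add: algebra_simps)
    finally show "(?R * madj ?R) $$ (i, j) = (1\<^sub>m N :: complex mat) $$ (i, j)" using ij assms by simp
  qed (use car cadj in auto)
  then show ?thesis using car by (simp add: unitary_def)
qed

lemma act_reflect:
  "act N (reflect N c v) \<psi> = (\<lambda>i. if i < N then \<psi> i + c * (\<Sum>j<N. cnj (v j) * \<psi> j) * v i else 0)"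
proof -
  have car: "reflect N c v \<in> carrier_mat N N" by (simp add: reflect_def)
  have "(\<Sum>j<N. reflect N c v $$ (i, j) * \<psi> j) = \<psi> i + c * (\<Sum>j<N. cnj (v j) * \<psi> j) * v i"
    if i: "i < N" for i
  proof -
    have "(\<Sum>j<N. reflect N c v $$ (i, j) * \<psi> j) =
        (\<Sum>j<N. (if i = j then \<psi> j else 0) + c * v i * (cnj (v j) * \<psi> j))"
      using i by (intro sum.cong) (auto simp: reflect_def algebra_simps)
    also have "\<dots> = \<psi> i + c * v i * (\<Sum>j<N. cnj (v j) * \<psi> j)"
      using i by (simp add: sum.distrib sum_distrib_left)
    finally show ?thesis by (simp add: mult_ac)
  qed
  then show ?thesis unfolding act_eq[OF car] by auto
qed

text \<open>The unitary reflection along \<open>y - x\<close>.\<close>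

lemma unitary_transitive:
  assumes x: "x \<in> pure_states N" and y: "y \<in> pure_states N"
  obtains U where "unitary N U" "act N U x = y"
proof (cases "x = y")
  case True
  have "unitary N (reflect N 0 x)" by (rule unitary_reflect) simp
  moreover have "act N (reflect N 0 x) x = x"
    using x by (auto simp: act_reflect pure_states_iff)
  ultimately show ?thesis using that True by blast
next
  case False
  define v where "v i = y i - x i" for i
  define w where "w = (\<Sum>j<N. cnj (v j) * x j)"
  have sq: "complex_of_real (csq N z) = (\<Sum>j<N. cnj (z j) * z j)" for z
    unfolding csq_def of_real_sum complex_norm_square by (simp add: mult.commute)
  have x1: "(\<Sum>j<N. cnj (x j) * x j) = 1" and y1: "(\<Sum>j<N. cnj (y j) * y j) = 1"
    using x y sq[of x] sq[of y] by (auto simp: pure_states_iff)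
  have w_eq: "w = (\<Sum>j<N. cnj (y j) * x j) - 1"
    unfolding w_def v_def x1[symmetric] by (simp add: sum_subtractf algebra_simps)
  have "complex_of_real (csq N v) = (\<Sum>j<N. cnj (y j) * y j) + (\<Sum>j<N. cnj (x j) * x j)
      - (\<Sum>j<N. cnj (y j) * x j) - (\<Sum>j<N. cnj (x j) * y j)"
    unfolding sq v_def sum.distrib[symmetric] sum_subtractf[symmetric]
    by (intro sum.cong refl) (simp add: algebra_simps)
  also have "(\<Sum>j<N. cnj (x j) * y j) = cnj (\<Sum>j<N. cnj (y j) * x j)" by (simp add: mult.commute)
  also have "(\<Sum>j<N. cnj (y j) * x j) = w + 1" by (simp add: w_eq)
  finally have sv: "complex_of_real (csq N v) = - (w + cnj w)" by (simp add: x1 y1)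
  \<comment> \<open>The identity \<open>|v|^2 = - (w + cnj w)\<close> would otherwise give
    \<open>v = 0\<close>, hence \<open>x = y\<close>.\<close>
  have "w \<noteq> 0"
  proof
    assume "w = 0"
    then have "csq N v = 0" using sv by simp
    then have "\<forall>i<N. v i = 0" unfolding csq_def by (auto simp: sum_nonneg_eq_0_iff)
    then have "x = y" using x y unfolding v_def pure_states_iff by (metis eq_iff_diff_eq_0 ext not_less)
    with False show False by simp
  qed
  \<comment> \<open>As \<open>w\<close> is the inner product of \<open>v\<close> with
    \<open>x\<close>, the coefficient \<open>1 / w\<close> sends \<open>x\<close> to
    \<open>x + v = y\<close>; the unitarity condition is the same identity for \<open>|v|^2\<close>,
    divided by \<open>|w|^2\<close>.\<close>
  have "unitary N (reflect N (1 / w) v)"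
    by (rule unitary_reflect) (use \<open>w \<noteq> 0\<close> in \<open>simp add: sv field_simps\<close>)
  moreover have "act N (reflect N (1 / w) v) x = y"
    using x y \<open>w \<noteq> 0\<close> unfolding act_reflect w_def[symmetric] by (auto simp: v_def pure_states_iff)
  ultimately show ?thesis by (rule that)
qed

text \<open>A unitarily invariant distance, left squared to avoid roots. Its balls are open in the
  ambient product topology, and on pure states every open neighbourhood contains one.\<close>

definition sqdist :: "nat \<Rightarrow> (nat \<Rightarrow> complex) \<Rightarrow> (nat \<Rightarrow> complex) \<Rightarrow> real" where
  "sqdist N x y = csq N (\<lambda>i. x i - y i)"

lemma sqdist_commute: "sqdist N x y = sqdist N y x"
  by (simp add: sqdist_def csq_def norm_minus_commute)

lemma sqdist_act:
  assumes U: "unitary N U"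
  shows "sqdist N (act N U x) (act N U y) = sqdist N x y"
proof -
  have car: "U \<in> carrier_mat N N" using U by (simp add: unitary_def)
  have "sqdist N (act N U x) (act N U y) = csq N (\<lambda>i. \<Sum>j<N. U $$ (i, j) * (x j - y j))"
    unfolding sqdist_def
    by (rule csq_cong) (simp add: act_eq[OF car] right_diff_distrib sum_subtractf)
  also have "\<dots> = csq N (\<lambda>j. x j - y j)" by (rule csq_unitary[OF U])
  finally show ?thesis by (simp add: sqdist_def)
qed

lemma continuous_on_sqdist: "continuous_on UNIV (\<lambda>x. sqdist N x y)"
  unfolding sqdist_def csq_def by (intro continuous_intros continuous_on_product_coordinates)

lemma open_sqdist_ball: "open {x. sqdist N x y < r}"
  using open_Collect_less[OF continuous_on_sqdist continuous_on_const] .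

lemma sqdist_measurable: "(\<lambda>p. sqdist N (fst p) (snd p)) \<in> borel_measurable (state_space N \<Otimes>\<^sub>M state_space N)"
  unfolding sqdist_def csq_def by measurable

text \<open>Coordinates from \<open>N\<close> onwards are zero for every pure state, so a basic open
  set restricts only finitely many of them and a minimum of finitely many radii works. The inserted
  \<open>1\<close> keeps that minimum defined for \<open>N = 0\<close>.\<close>

lemma open_contains_sqdist_ball:
  assumes "open G" "x \<in> G" "x \<in> pure_states N"
  obtains r where "r > 0" "\<And>y. y \<in> pure_states N \<Longrightarrow> sqdist N y x < r \<Longrightarrow> y \<in> G"
proof -
  obtain X where X: "x \<in> Pi\<^sub>E UNIV X" "\<And>i. open (X i)" "Pi\<^sub>E UNIV X \<subseteq> G"
    using product_topology_open_contains_basis[of "\<lambda>_. euclidean" UNIV G x] assms(1,2)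
    by (auto simp: open_fun_def)
  have "\<forall>i. \<exists>e>0. ball (x i) e \<subseteq> X i"
    using X by (auto simp: open_contains_ball PiE_iff)
  then obtain e where e: "\<And>i. e i > 0" "\<And>i. ball (x i) (e i) \<subseteq> X i" by metis
  define r where "r = Min (insert 1 ((\<lambda>i. (e i)\<^sup>2) ` {..<N}))"
  have "e i \<noteq> 0" for i using e(1)[of i] by simp
  then have "r > 0" unfolding r_def by (subst Min_gr_iff) auto
  moreover have "y \<in> G" if y: "y \<in> pure_states N" "sqdist N y x < r" for y
  proof -
    have "y i \<in> X i" for i
    proof (cases "i < N")
      case True
      have "(cmod (y i - x i))\<^sup>2 \<le> sqdist N y x"
        unfolding sqdist_def csq_def using True by (intro member_le_sum[of i _ "\<lambda>i. (cmod (y i - x i))\<^sup>2"]) auto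
      also have "\<dots> < r" by (rule y)
      also have "r \<le> (e i)\<^sup>2" unfolding r_def using True by (intro Min_le) auto
      finally have "cmod (y i - x i) < e i" using e(1)[of i] by (simp add: power2_less_imp_less less_imp_le)
      then show ?thesis using e(2)[of i] by (auto simp: dist_norm norm_minus_commute subset_eq)
    next
      case False
      then have "y i = x i" using y assms by (simp add: pure_states_iff)
      then show ?thesis using X(1) by (simp add: PiE_iff)
    qed
    then show ?thesis using X(3) by (auto simp: PiE_iff)
  qed
  ultimately show ?thesis by (rule that)
qed

section \<open>Balls under an invariant measure, and uniqueness\<close>

lemma haar_like_space:
  assumes "haar_like N M"
  shows "space M = pure_states N"
  using sets_eq_imp_space_eq[of M "state_space N"] assms by (simp add: haar_like_def)

lemma open_Int_pure_states_sets:
  assumes "haar_like N M" "open G"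
  shows "G \<inter> pure_states N \<in> sets M"
proof -
  have "G \<inter> pure_states N \<in> sets (state_space N)"
    using assms(2) by (auto simp: state_space_def sets_restrict_space intro: image_eqI[of _ _ G])
  then show ?thesis using assms(1) by (simp add: haar_like_def)
qed

text \<open>A unitary that takes one centre to the other pulls the second ball back to the
  first.\<close>

lemma haar_like_ball:
  assumes M: "haar_like N M" and x: "x \<in> pure_states N" and y: "y \<in> pure_states N"
  shows "emeasure M ({z. sqdist N z x < r} \<inter> pure_states N) = emeasure M ({z. sqdist N z y < r} \<inter> pure_states N)"
proof -
  obtain U where U: "unitary N U" "act N U x = y" by (rule unitary_transitive[OF x y])
  have sM: "sets M = sets (state_space N)" using M by (simp add: haar_like_def)
  have meas: "act N U \<in> M \<rightarrow>\<^sub>M M"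
    using act_measurable[OF U(1)] by (simp add: measurable_cong_sets[OF sM sM])
  have "emeasure M ({z. sqdist N z y < r} \<inter> pure_states N)
      = emeasure (distr M M (act N U)) ({z. sqdist N z y < r} \<inter> pure_states N)"
    using M U by (simp add: haar_like_def)
  also have "\<dots> = emeasure M (act N U -` ({z. sqdist N z y < r} \<inter> pure_states N) \<inter> space M)"
    by (intro emeasure_distr meas open_Int_pure_states_sets[OF M] open_sqdist_ball)
  also have "act N U -` ({z. sqdist N z y < r} \<inter> pure_states N) \<inter> space M = {z. sqdist N z x < r} \<inter> pure_states N"
    using act_pure_states[OF U(1)] sqdist_act[OF U(1)] U(2) by (auto simp: haar_like_space[OF M])
  finally show ?thesis by simp
qed

text \<open>Balls of equal radius have equal measure. If it were zero, the Lindelof property would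
  cover the sphere by countably many null sets, against total mass one.\<close>

lemma haar_like_ball_pos:
  assumes M: "haar_like N M" and x: "x \<in> pure_states N" and r: "r > 0"
  shows "emeasure M ({z. sqdist N z x < r} \<inter> pure_states N) > 0"
proof (rule ccontr)
  assume "\<not> ?thesis"
  then have zero: "emeasure M ({z. sqdist N z y < r} \<inter> pure_states N) = 0" if "y \<in> pure_states N" for y
    using haar_like_ball[OF M x that] by (simp add: zero_less_iff_neq_zero)
  define F where "F = (\<lambda>y. {z. sqdist N z y < r}) ` pure_states N"
  have "open S" if "S \<in> F" for S using that open_sqdist_ball by (auto simp: F_def)
  then obtain F' where F': "F' \<subseteq> F" "countable F'" "\<Union>F' = \<Union>F"
    using Lindelof by metis
  have "pure_states N \<subseteq> \<Union>F" using r by (auto simp: F_def sqdist_def csq_def)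
  then have cov: "space M = (\<Union>A\<in>F'. A \<inter> pure_states N)" using F' by (auto simp: haar_like_space[OF M])
  have "A \<inter> pure_states N \<in> null_sets M" if "A \<in> F'" for A
    using that F' zero open_Int_pure_states_sets[OF M open_sqdist_ball]
    by (auto simp: F_def null_sets_def)
  then have "space M \<in> null_sets M" unfolding cov using F'(2) by (intro null_sets_UN') auto
  then have "emeasure M (space M) = 0" by blast
  moreover have "emeasure M (space M) = 1"
    using M by (simp add: haar_like_def prob_space.emeasure_space_1)
  ultimately show False by simp
qed

text \<open>Double counting (Christensen): integrating the indicator of
  \<open>{(x, y). x \<in> A, |x - y|\<^sup>2 < r}\<close> in both orders compares two invariant measures,
  because the measure of a ball does not depend on its centre.\<close>

lemma haar_like_compare:
  assumes M: "haar_like N M" and M': "haar_like N M'" and x0: "x0 \<in> pure_states N"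
    and A: "A \<in> sets M" and G: "G \<in> sets M"
    and imp: "\<And>x y. x \<in> A \<Longrightarrow> y \<in> pure_states N \<Longrightarrow> sqdist N x y < r \<Longrightarrow> y \<in> G"
  shows "emeasure M A * emeasure M' ({z. sqdist N z x0 < r} \<inter> pure_states N)
      \<le> emeasure M' G * emeasure M ({z. sqdist N z x0 < r} \<inter> pure_states N)"
proof -
  have sM: "sets M = sets (state_space N)" and sM': "sets M' = sets (state_space N)"
    using M M' by (auto simp: haar_like_def)
  note [measurable_cong] = sM sM'
  note [measurable] = sqdist_measurable
  have [measurable]: "A \<in> sets (state_space N)" "G \<in> sets (state_space N)" using A G sM by auto
  have sp: "space M = pure_states N" "space M' = pure_states N" using haar_like_space M M' by auto
  interpret M: prob_space M using M by (simp add: haar_like_def)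
  interpret M': prob_space M' using M' by (simp add: haar_like_def)
  interpret P: pair_sigma_finite M M' by unfold_locales
  let ?b = "\<lambda>x. {z. sqdist N z x < r} \<inter> pure_states N"
  let ?k = "\<lambda>x y. indicator A x * indicator {p. sqdist N (fst p) (snd p) < r} (x, y) :: ennreal"
  have AM: "A \<subseteq> pure_states N" using sets.sets_into_space[OF A] sp by simp
  have km: "case_prod ?k \<in> borel_measurable (M \<Otimes>\<^sub>M M')"
  proof -
    have "Measurable.pred (state_space N \<Otimes>\<^sub>M state_space N) (\<lambda>p. sqdist N (fst p) (snd p) < r)"
      by measurable
    then have "(\<lambda>p. indicator A (fst p) * indicator {p. sqdist N (fst p) (snd p) < r} p :: ennreal)
        \<in> borel_measurable (state_space N \<Otimes>\<^sub>M state_space N)" by measurable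
    then show ?thesis
      by (simp add: split_beta' measurable_cong_sets[OF sets_pair_measure_cong[OF sM sM'] refl])
  qed
  have "emeasure M A * emeasure M' (?b x0) = (\<integral>\<^sup>+x. indicator A x * emeasure M' (?b x0) \<partial>M)"
    using A by (simp add: nn_integral_multc)
  also have "\<dots> = (\<integral>\<^sup>+x. (\<integral>\<^sup>+y. ?k x y \<partial>M') \<partial>M)"
  proof (rule nn_integral_cong)
    fix x assume "x \<in> space M"
    then have x: "x \<in> pure_states N" using sp by simp
    have "(\<integral>\<^sup>+y. ?k x y \<partial>M') = (\<integral>\<^sup>+y. indicator A x * indicator (?b x) y \<partial>M')"
      by (rule nn_integral_cong) (auto simp: sp sqdist_commute split: split_indicator)
    also have "\<dots> = indicator A x * emeasure M' (?b x)"
      using open_Int_pure_states_sets[OF M' open_sqdist_ball] by (simp add: nn_integral_cmult)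
    also have "emeasure M' (?b x) = emeasure M' (?b x0)" by (rule haar_like_ball[OF M' x x0])
    finally show "indicator A x * emeasure M' (?b x0) = (\<integral>\<^sup>+y. ?k x y \<partial>M')" by simp
  qed
  also have "\<dots> = (\<integral>\<^sup>+y. (\<integral>\<^sup>+x. ?k x y \<partial>M) \<partial>M')"
    using km by (intro P.Fubini'[symmetric])
  also have "\<dots> \<le> (\<integral>\<^sup>+y. indicator G y * emeasure M (?b x0) \<partial>M')"
  proof (rule nn_integral_mono)
    fix y assume "y \<in> space M'"
    then have y: "y \<in> pure_states N" using sp by simp
    have "(\<integral>\<^sup>+x. ?k x y \<partial>M) \<le> (\<integral>\<^sup>+x. indicator G y * indicator (?b y) x \<partial>M)"
      using imp[OF _ y] by (intro nn_integral_mono) (auto simp: sp split: split_indicator)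
    also have "\<dots> = indicator G y * emeasure M (?b y)"
      using open_Int_pure_states_sets[OF M open_sqdist_ball] by (simp add: nn_integral_cmult)
    also have "emeasure M (?b y) = emeasure M (?b x0)" by (rule haar_like_ball[OF M y x0])
    finally show "(\<integral>\<^sup>+x. ?k x y \<partial>M) \<le> indicator G y * emeasure M (?b x0)" .
  qed
  also have "\<dots> = emeasure M' G * emeasure M (?b x0)"
    using G sM sM' by (simp add: nn_integral_multc)
  finally show ?thesis .
qed

text \<open>The open set is exhausted from inside by the sets \<open>A n\<close> of states at
  squared distance at least \<open>1 / (n + 1)\<close> from the states outside \<open>V\<close>. A
  ball of that size around a point of \<open>A n\<close> stays in \<open>V\<close>, so double
  counting bounds each \<open>A n\<close>, and continuity from below concludes.\<close>

lemma haar_like_open_le: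
  assumes M: "haar_like N M" and M': "haar_like N M'" and V: "open V"
  shows "emeasure M (V \<inter> pure_states N) \<le> emeasure M' (V \<inter> pure_states N)"
proof -
  have sp: "space M = pure_states N" "space M' = pure_states N" using haar_like_space M M' by auto
  interpret M: prob_space M using M by (simp add: haar_like_def)
  interpret M': prob_space M' using M' by (simp add: haar_like_def)
  obtain x0 where x0: "x0 \<in> pure_states N" using M.not_empty sp by auto
  let ?h = "\<lambda>M r. emeasure M ({z. sqdist N z x0 < r} \<inter> pure_states N)"
  \<comment> \<open>Comparing the whole sphere with itself leaves only the ball factors. Used both
    ways, this shows that the two measures agree on balls, so the factors cancel later.\<close>
  have le: "?h M2 r \<le> ?h M1 r" if "haar_like N M1" "haar_like N M2" for M1 M2 and r :: real
  proof -
    have s: "space M1 \<in> sets M1" "space M1 = pure_states N" "space M2 = pure_states N"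
      using haar_like_space[OF that(1)] haar_like_space[OF that(2)] sets.top[of M1] by auto
    have "emeasure M1 (space M1) = 1" "emeasure M2 (space M1) = 1"
      using that s prob_space.emeasure_space_1[of M1] prob_space.emeasure_space_1[of M2]
      by (auto simp: haar_like_def)
    then show ?thesis
      using haar_like_compare[OF that x0 s(1) s(1), of r] s by auto
  qed
  have h_eq: "?h M' r = ?h M r" for r using le[OF M M'] le[OF M' M] by (intro antisym)
  define G where "G = V \<inter> pure_states N"
  have Gs: "G \<in> sets M" unfolding G_def by (rule open_Int_pure_states_sets[OF M V])
  define A where "A n = pure_states N - (\<Union>y\<in>pure_states N - V. {x. sqdist N x y < inverse (real (Suc n))})" for n
  have A_iff: "x \<in> A n \<longleftrightarrow> x \<in> pure_states N \<and>
      (\<forall>y\<in>pure_states N - V. \<not> sqdist N x y < inverse (real (Suc n)))" for x n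
    unfolding A_def by blast
  have As: "A n \<in> sets M" for n
  proof -
    have "A n = pure_states N - (\<Union>y\<in>pure_states N - V. {x. sqdist N x y < inverse (real (Suc n))}) \<inter> pure_states N"
      by (auto simp: A_def)
    moreover have "(\<Union>y\<in>pure_states N - V. {x. sqdist N x y < inverse (real (Suc n))}) \<inter> pure_states N \<in> sets M"
      by (intro open_Int_pure_states_sets[OF M] open_UN ballI open_sqdist_ball)
    moreover have "pure_states N \<in> sets M" using sets.top[of M] sp by simp
    ultimately show ?thesis by auto
  qed
  have A_le: "emeasure M (A n) \<le> emeasure M' G" for n
  proof -
    let ?r = "inverse (real (Suc n))"
    have "emeasure M (A n) * ?h M' ?r \<le> emeasure M' G * ?h M ?r"
      by (rule haar_like_compare[OF M M' x0 As Gs]) (unfold A_iff G_def, blast)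
    then have "?h M ?r * emeasure M (A n) \<le> ?h M ?r * emeasure M' G"
      unfolding h_eq by (simp only: mult.commute)
    moreover have "?h M ?r \<noteq> 0" using haar_like_ball_pos[OF M x0, of ?r] by simp
    moreover have "?h M ?r \<noteq> \<infinity>" by simp
    ultimately show ?thesis using ennreal_mult_le_mult_iff[of "?h M ?r"] by simp
  qed
  have "G = (\<Union>n. A n)"
  proof (intro equalityI subsetI)
    fix x assume x: "x \<in> G"
    obtain r where r: "r > 0" "\<And>y. y \<in> pure_states N \<Longrightarrow> sqdist N y x < r \<Longrightarrow> y \<in> V"
      using open_contains_sqdist_ball[OF V, of x N] x by (auto simp: G_def)
    obtain n where n: "inverse (real (Suc n)) < r" using reals_Archimedean[OF r(1)] by auto
    have "\<not> sqdist N x y < inverse (real (Suc n))" if "y \<in> pure_states N - V" for y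
      using r(2)[of y] that n sqdist_commute[of N x y] by auto
    then have "x \<in> A n" using x unfolding A_iff G_def by blast
    then show "x \<in> (\<Union>n. A n)" by blast
  next
    fix x assume "x \<in> (\<Union>n. A n)"
    then obtain n where "x \<in> A n" by blast
    moreover have "sqdist N x x < inverse (real (Suc n))" by (simp add: sqdist_def csq_def)
    ultimately show "x \<in> G" unfolding A_iff G_def by blast
  qed
  moreover have "incseq A"
  proof (rule incseq_SucI)
    fix n
    have "inverse (real (Suc (Suc n))) \<le> inverse (real (Suc n))" by (intro le_imp_inverse_le) auto
    then have "\<not> d < inverse (real (Suc (Suc n)))" if "\<not> d < inverse (real (Suc n))" for d :: real
      using that by linarith
    then show "A n \<subseteq> A (Suc n)" unfolding subset_iff A_iff by blast
  qed
  moreover have "range A \<subseteq> sets M" using As by blast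
  ultimately have "emeasure M G = (SUP n. emeasure M (A n))"
    using SUP_emeasure_incseq[of A M] by simp
  also have "\<dots> \<le> emeasure M' G" by (rule SUP_least) (rule A_le)
  finally show ?thesis by (simp add: G_def)
qed

lemma sets_state_space: "sets (state_space N) = sigma_sets (pure_states N) ((\<inter>) (pure_states N) ` {V. open V})"
proof -
  have "sets (state_space N) = (\<inter>) (pure_states N) ` sigma_sets UNIV {V. open V}"
    unfolding state_space_def sets_restrict_space by (simp add: borel_def)
  also have "\<dots> = sigma_sets (pure_states N) ((\<inter>) (pure_states N) ` {V. open V})"
    using pure_states_borel[of N] by (intro sigma_sets_Int) (auto simp: borel_def)
  finally show ?thesis .
qed

text \<open>The inequality on open sets, read in both directions, gives equality on an
  intersection-stable generator.\<close>

lemma haar_like_unique: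
  assumes M: "haar_like N M" and M': "haar_like N M'"
  shows "M = M'"
proof (rule measure_eqI_generator_eq[where \<Omega> = "pure_states N" and E = "(\<inter>) (pure_states N) ` {V. open V}" and A = "\<lambda>_. pure_states N"])
  show "Int_stable ((\<inter>) (pure_states N) ` {V. open V})"
  proof (rule Int_stableI, safe)
    fix X Y :: "(nat \<Rightarrow> complex) set" assume "open X" "open Y"
    then show "pure_states N \<inter> X \<inter> (pure_states N \<inter> Y) \<in> (\<inter>) (pure_states N) ` {V. open V}"
      by (intro image_eqI[of _ _ "X \<inter> Y"]) auto
  qed
  show "emeasure M X = emeasure M' X" if "X \<in> (\<inter>) (pure_states N) ` {V. open V}" for X
    using that haar_like_open_le[OF M M'] haar_like_open_le[OF M' M]
    by (auto simp: Int_commute intro: antisym)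
  show "sets M = sigma_sets (pure_states N) ((\<inter>) (pure_states N) ` {V. open V})"
    "sets M' = sigma_sets (pure_states N) ((\<inter>) (pure_states N) ` {V. open V})"
    using M M' by (auto simp: haar_like_def sets_state_space)
  show "emeasure M (pure_states N) \<noteq> \<infinity>"
    using M by (simp add: haar_like_def prob_space.finite_measure finite_measure.emeasure_finite)
  show "range (\<lambda>_. pure_states N) \<subseteq> (\<inter>) (pure_states N) ` {V. open V}" by auto
qed auto

theorem haar_like_haar:
  assumes "1 \<le> N"
  shows "haar_like N (haar N)"
proof -
  obtain M where M: "haar_like N M" using haar_like_exists[OF assms] by blast
  have "haar N = M"
    unfolding haar_def haar_like_def[symmetric] using M haar_like_unique[OF _ M] by (rule the_equality)
  then show ?thesis using M by simp
qed

section \<open>Integration by parts on the sphere\<close>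

text \<open>\<open>bipoly N l G D E\<close>: to second order around the sphere, \<open>G\<close> has holomorphic derivatives \<open>D p\<close>
  and antiholomorphic derivatives \<open>E p\<close>; the Euler identity expresses that \<open>G\<close> is homogeneous of
  degree \<open>l\<close> in the conjugate variables.\<close>

definition taylor_bound :: "nat \<Rightarrow> real \<Rightarrow> ((nat \<Rightarrow> complex) \<Rightarrow> complex) \<Rightarrow>
    (nat \<Rightarrow> (nat \<Rightarrow> complex) \<Rightarrow> complex) \<Rightarrow> (nat \<Rightarrow> (nat \<Rightarrow> complex) \<Rightarrow> complex) \<Rightarrow> bool" where
  "taylor_bound N C G D E \<longleftrightarrow> (\<forall>\<psi>\<in>pure_states N. cmod (G \<psi>) \<le> C \<and>
     (\<forall>p. cmod (D p \<psi>) \<le> C \<and> cmod (E p \<psi>) \<le> C) \<and>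
     (\<forall>\<delta>. csq N \<delta> \<le> 1 \<longrightarrow> cmod (G (\<lambda>i. \<psi> i + \<delta> i) - G \<psi>
        - ((\<Sum>p<N. \<delta> p * D p \<psi>) + (\<Sum>p<N. cnj (\<delta> p) * E p \<psi>))) \<le> C * csq N \<delta>))"

definition bipoly :: "nat \<Rightarrow> nat \<Rightarrow> ((nat \<Rightarrow> complex) \<Rightarrow> complex) \<Rightarrow>
    (nat \<Rightarrow> (nat \<Rightarrow> complex) \<Rightarrow> complex) \<Rightarrow> (nat \<Rightarrow> (nat \<Rightarrow> complex) \<Rightarrow> complex) \<Rightarrow> bool" where
  "bipoly N l G D E \<longleftrightarrow> G \<in> borel_measurable (state_space N) \<and>
     (\<forall>p. D p \<in> borel_measurable (state_space N)) \<and> (\<forall>p. E p \<in> borel_measurable (state_space N)) \<and>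
     (\<forall>\<psi>\<in>pure_states N. (\<Sum>q<N. cnj (\<psi> q) * E q \<psi>) = of_nat l * G \<psi>) \<and>
     (\<exists>C\<ge>0. taylor_bound N C G D E)"

lemma bipolyD:
  assumes "bipoly N l G D E"
  shows "G \<in> borel_measurable (state_space N)" "D p \<in> borel_measurable (state_space N)"
    "E p \<in> borel_measurable (state_space N)"
    "\<psi> \<in> pure_states N \<Longrightarrow> (\<Sum>q<N. cnj (\<psi> q) * E q \<psi>) = of_nat l * G \<psi>"
    "\<exists>C\<ge>0. taylor_bound N C G D E"
  using assms by (auto simp: bipoly_def)

lemma cmod_le_sqrt_csq: "p < N \<Longrightarrow> cmod (\<delta> p) \<le> sqrt (csq N \<delta>)"
proof (rule real_le_rsqrt)
  assume "p < N"
  then show "(cmod (\<delta> p))\<^sup>2 \<le> csq N \<delta>"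
    unfolding csq_def by (intro member_le_sum[of p _ "\<lambda>i. (cmod (\<delta> i))\<^sup>2"]) auto
qed

lemma pure_state_component_le: "\<psi> \<in> pure_states N \<Longrightarrow> cmod (\<psi> i) \<le> 1"
  using cmod_le_sqrt_csq[of i N \<psi>] by (cases "i < N") (auto simp: pure_states_iff)

section \<open>Closure of the admissible functions under sums and products\<close>

lemma bipoly_const: "bipoly N 0 (\<lambda>_. c) (\<lambda>_ _. 0) (\<lambda>_ _. 0)"
  unfolding bipoly_def taylor_bound_def by (auto intro!: exI[of _ "cmod c"])

lemma bipoly_coord:
  assumes "i < N"
  shows "bipoly N 0 (\<lambda>\<psi>. \<psi> i) (\<lambda>p _. if p = i then 1 else 0) (\<lambda>_ _. 0)"
proof -
  have "(\<Sum>p<N. \<delta> p * (if p = i then 1 else 0)) = \<delta> i" for \<delta> :: "nat \<Rightarrow> complex"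
    using assms by (simp add: if_distrib[of "\<lambda>c. _ * c"] cong: if_cong)
  then show ?thesis unfolding bipoly_def taylor_bound_def
    by (auto intro!: exI[of _ 1] pure_state_component_le)
qed

lemma bipoly_cnj_coord:
  assumes "i < N"
  shows "bipoly N 1 (\<lambda>\<psi>. cnj (\<psi> i)) (\<lambda>_ _. 0) (\<lambda>q _. if q = i then 1 else 0)"
proof -
  have "(\<Sum>p<N. \<delta> p * (if p = i then 1 else 0)) = \<delta> i" for \<delta> :: "nat \<Rightarrow> complex"
    using assms by (simp add: if_distrib[of "\<lambda>c. _ * c"] cong: if_cong)
  moreover have "(\<lambda>\<psi>. cnj (\<psi> i)) \<in> borel_measurable (state_space N)"
    by (rule measurable_compose[OF state_space_component])
      (intro borel_measurable_continuous_onI continuous_intros)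
  ultimately show ?thesis unfolding bipoly_def taylor_bound_def
    by (auto intro!: exI[of _ 1] pure_state_component_le)
qed

lemma bipoly_add:
  assumes "bipoly N l G D E" "bipoly N l G' D' E'"
  shows "bipoly N l (\<lambda>\<psi>. G \<psi> + G' \<psi>) (\<lambda>p \<psi>. D p \<psi> + D' p \<psi>) (\<lambda>p \<psi>. E p \<psi> + E' p \<psi>)"
proof -
  obtain C C' where C: "C \<ge> 0" "taylor_bound N C G D E" "C' \<ge> 0" "taylor_bound N C' G' D' E'"
    using bipolyD(5)[OF assms(1)] bipolyD(5)[OF assms(2)] by blast
  have "taylor_bound N (C + C') (\<lambda>\<psi>. G \<psi> + G' \<psi>) (\<lambda>p \<psi>. D p \<psi> + D' p \<psi>) (\<lambda>p \<psi>. E p \<psi> + E' p \<psi>)"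
    unfolding taylor_bound_def
  proof (intro ballI conjI allI impI)
    fix \<psi> assume \<psi>: "\<psi> \<in> pure_states N"
    note T = C(2)[unfolded taylor_bound_def, rule_format, OF \<psi>] C(4)[unfolded taylor_bound_def, rule_format, OF \<psi>]
    show "cmod (G \<psi> + G' \<psi>) \<le> C + C'" using T by (intro norm_triangle_mono) auto
    show "cmod (D p \<psi> + D' p \<psi>) \<le> C + C'" "cmod (E p \<psi> + E' p \<psi>) \<le> C + C'" for p
      using T by (auto intro!: norm_triangle_mono)
    fix \<delta> :: "nat \<Rightarrow> complex" assume \<delta>: "csq N \<delta> \<le> 1"
    let ?R = "\<lambda>G D E. G (\<lambda>i. \<psi> i + \<delta> i) - G \<psi> - ((\<Sum>p<N. \<delta> p * D p \<psi>) + (\<Sum>p<N. cnj (\<delta> p) * E p \<psi>))"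
    have eq: "?R (\<lambda>\<psi>. G \<psi> + G' \<psi>) (\<lambda>p \<psi>. D p \<psi> + D' p \<psi>) (\<lambda>p \<psi>. E p \<psi> + E' p \<psi>) = ?R G D E + ?R G' D' E'"
      by (simp add: distrib_left sum.distrib)
    have b: "cmod (?R G D E) \<le> C * csq N \<delta>" "cmod (?R G' D' E') \<le> C' * csq N \<delta>"
      using T \<delta> by auto
    show "cmod (?R (\<lambda>\<psi>. G \<psi> + G' \<psi>) (\<lambda>p \<psi>. D p \<psi> + D' p \<psi>) (\<lambda>p \<psi>. E p \<psi> + E' p \<psi>)) \<le> (C + C') * csq N \<delta>"
      unfolding eq distrib_right by (rule norm_triangle_mono[OF b])
  qed
  then have "\<exists>C\<ge>0. taylor_bound N C (\<lambda>\<psi>. G \<psi> + G' \<psi>) (\<lambda>p \<psi>. D p \<psi> + D' p \<psi>) (\<lambda>p \<psi>. E p \<psi> + E' p \<psi>)"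
    using C by (intro exI[of _ "C + C'"]) auto
  moreover have "(\<Sum>q<N. cnj (\<psi> q) * (E q \<psi> + E' q \<psi>)) = of_nat l * (G \<psi> + G' \<psi>)" if "\<psi> \<in> pure_states N" for \<psi>
    using bipolyD(4)[OF assms(1) that] bipolyD(4)[OF assms(2) that] by (simp add: distrib_left sum.distrib)
  ultimately show ?thesis
    unfolding bipoly_def using bipolyD(1-3)[OF assms(1)] bipolyD(1-3)[OF assms(2)]
    by (auto intro!: borel_measurable_add)
qed

text \<open>Zero counts as homogeneous of every degree, which provides the empty sum at any
  \<open>l\<close>.\<close>

lemma bipoly_zero: "bipoly N l (\<lambda>_. 0) (\<lambda>_ _. 0) (\<lambda>_ _. 0)"
  unfolding bipoly_def taylor_bound_def by (auto intro!: exI[of _ 0])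

lemma bipoly_sum:
  assumes "finite I" "\<And>a. a \<in> I \<Longrightarrow> bipoly N l (G a) (D a) (E a)"
  shows "bipoly N l (\<lambda>\<psi>. \<Sum>a\<in>I. G a \<psi>) (\<lambda>p \<psi>. \<Sum>a\<in>I. D a p \<psi>) (\<lambda>p \<psi>. \<Sum>a\<in>I. E a p \<psi>)"
  using assms
proof (induction I rule: finite_induct)
  case empty
  show ?case by (simp add: bipoly_zero)
next
  case (insert a I)
  then have "bipoly N l (\<lambda>\<psi>. G a \<psi> + (\<Sum>a\<in>I. G a \<psi>)) (\<lambda>p \<psi>. D a p \<psi> + (\<Sum>a\<in>I. D a p \<psi>)) (\<lambda>p \<psi>. E a p \<psi> + (\<Sum>a\<in>I. E a p \<psi>))"
    by (intro bipoly_add) auto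
  then show ?case using insert by simp
qed

text \<open>With remainders \<open>R\<close> and \<open>R'\<close>, the error is
  \<open>g R' + R g' + (L + R) (L' + R')\<close>. The first two terms are of order
  \<open>t^2\<close> at once; in the last, \<open>t \<le> 1\<close> makes each factor of order
  \<open>t\<close>.\<close>

lemma product_remainder:
  fixes a a' g g' L L' :: complex
  assumes "cmod (a - g - L) \<le> C * t\<^sup>2" "cmod (a' - g' - L') \<le> C' * t\<^sup>2"
    "cmod L \<le> K * t" "cmod L' \<le> K' * t" "cmod g \<le> C" "cmod g' \<le> C'" "0 \<le> t" "t \<le> 1"
  shows "cmod (a * a' - g * g' - (L * g' + g * L')) \<le> (2 * C * C' + (K + C) * (K' + C')) * t\<^sup>2"
proof -
  define R where "R = a - g - L"
  define R' where "R' = a' - g' - L'"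
  have C: "0 \<le> C" "0 \<le> C'" using assms(5,6) norm_ge_zero order_trans by blast+
  have R: "cmod R \<le> C * t\<^sup>2" "cmod R' \<le> C' * t\<^sup>2" using assms by (auto simp: R_def R'_def)
  have t2: "t\<^sup>2 \<le> t" using assms(7,8) by (simp add: power2_eq_square mult_left_le)
  have "cmod (L + R) \<le> K * t + C * t"
    using assms(3) R(1) mult_left_mono[OF t2 C(1)] by (intro norm_triangle_mono) auto
  then have LR: "cmod (L + R) \<le> (K + C) * t" by (simp add: distrib_right)
  have "cmod (L' + R') \<le> K' * t + C' * t"
    using assms(4) R(2) mult_left_mono[OF t2 C(2)] by (intro norm_triangle_mono) auto
  then have LR': "cmod (L' + R') \<le> (K' + C') * t" by (simp add: distrib_right)
  have "a * a' - g * g' - (L * g' + g * L') = g * R' + R * g' + (L + R) * (L' + R')"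
    by (simp add: R_def R'_def algebra_simps)
  also have "cmod \<dots> \<le> C * (C' * t\<^sup>2) + C * t\<^sup>2 * C' + ((K + C) * t) * ((K' + C') * t)"
  proof (intro norm_triangle_mono)
    have "0 \<le> C * t\<^sup>2" "0 \<le> C' * t\<^sup>2" using C by auto
    then show "cmod (g * R') \<le> C * (C' * t\<^sup>2)" "cmod (R * g') \<le> C * t\<^sup>2 * C'"
      unfolding norm_mult using assms R C by (auto intro!: mult_mono)
    have "0 \<le> (K + C) * t" by (rule order_trans[OF norm_ge_zero LR])
    then show "cmod ((L + R) * (L' + R')) \<le> ((K + C) * t) * ((K' + C') * t)"
      unfolding norm_mult using LR LR' by (intro mult_mono) auto
  qed
  also have "\<dots> = (2 * C * C' + (K + C) * (K' + C')) * t\<^sup>2"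
    by (simp add: algebra_simps power2_eq_square)
  finally show ?thesis .
qed

lemma bipoly_mult:
  assumes "bipoly N l G D E" "bipoly N l' G' D' E'"
  shows "bipoly N (l + l') (\<lambda>\<psi>. G \<psi> * G' \<psi>) (\<lambda>p \<psi>. D p \<psi> * G' \<psi> + G \<psi> * D' p \<psi>)
    (\<lambda>p \<psi>. E p \<psi> * G' \<psi> + G \<psi> * E' p \<psi>)"
proof -
  obtain C C' where C: "C \<ge> 0" "taylor_bound N C G D E" "C' \<ge> 0" "taylor_bound N C' G' D' E'"
    using bipolyD(5)[OF assms(1)] bipolyD(5)[OF assms(2)] by blast
  \<comment> \<open>The linear part has \<open>2 * N\<close> terms, each a derivative of modulus at
    most \<open>C\<close> times a coordinate of modulus at most \<open>t\<close>.\<close>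
  define K where "K = 2 * real N * C"
  define K' where "K' = 2 * real N * C'"
  define B where "B = 2 * C * C' + (K + C) * (K' + C')"
  have KK: "0 \<le> K" "0 \<le> K'" using C by (auto simp: K_def K'_def)
  then have B: "2 * C * C' \<le> B" "C * C' \<le> B" "0 \<le> B"
    using C by (auto simp: B_def intro!: add_increasing2 add_increasing)
  have "taylor_bound N B (\<lambda>\<psi>. G \<psi> * G' \<psi>) (\<lambda>p \<psi>. D p \<psi> * G' \<psi> + G \<psi> * D' p \<psi>)
    (\<lambda>p \<psi>. E p \<psi> * G' \<psi> + G \<psi> * E' p \<psi>)"
    unfolding taylor_bound_def
  proof (intro ballI conjI allI impI)
    fix \<psi> assume \<psi>: "\<psi> \<in> pure_states N"
    note T = C(2)[unfolded taylor_bound_def, rule_format, OF \<psi>] C(4)[unfolded taylor_bound_def, rule_format, OF \<psi>]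
    have m: "cmod (x * y) \<le> C * C'" if "cmod x \<le> C" "cmod y \<le> C'" for x y
      using that C by (auto simp: norm_mult intro: mult_mono)
    have m2: "cmod (x * y + z * w) \<le> B" if "cmod x \<le> C" "cmod y \<le> C'" "cmod z \<le> C" "cmod w \<le> C'" for x y z w
      using norm_triangle_mono[OF m[OF that(1,2)] m[OF that(3,4)]] B by linarith
    show "cmod (G \<psi> * G' \<psi>) \<le> B" using m[of "G \<psi>" "G' \<psi>"] T B by auto
    show "cmod (D p \<psi> * G' \<psi> + G \<psi> * D' p \<psi>) \<le> B" "cmod (E p \<psi> * G' \<psi> + G \<psi> * E' p \<psi>) \<le> B" for p
      using T by (auto intro!: m2)
    fix \<delta> :: "nat \<Rightarrow> complex" assume \<delta>: "csq N \<delta> \<le> 1"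
    define t where "t = sqrt (csq N \<delta>)"
    have t: "0 \<le> t" "t \<le> 1" "t\<^sup>2 = csq N \<delta>" using \<delta> by (auto simp: t_def)
    let ?L = "\<lambda>D E. (\<Sum>p<N. \<delta> p * D p \<psi>) + (\<Sum>p<N. cnj (\<delta> p) * E p \<psi>)"
    have Lb: "cmod (?L D E) \<le> 2 * real N * C * t"
      if "\<And>p. cmod (D p \<psi>) \<le> C" "\<And>p. cmod (E p \<psi>) \<le> C" for C and D E :: "nat \<Rightarrow> (nat \<Rightarrow> complex) \<Rightarrow> complex"
    proof -
      have "cmod (\<Sum>p<N. \<delta> p * D p \<psi>) \<le> (\<Sum>p<N. t * C)"
        using that(1) cmod_le_sqrt_csq[of _ N \<delta>] t
        by (intro sum_norm_le) (auto simp: norm_mult t_def[symmetric] intro!: mult_mono)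
      moreover have "cmod (\<Sum>p<N. cnj (\<delta> p) * E p \<psi>) \<le> (\<Sum>p<N. t * C)"
        using that(2) cmod_le_sqrt_csq[of _ N \<delta>] t
        by (intro sum_norm_le) (auto simp: norm_mult t_def[symmetric] intro!: mult_mono)
      ultimately have "cmod (?L D E) \<le> (\<Sum>p<N. t * C) + (\<Sum>p<N. t * C)" by (rule norm_triangle_mono)
      then show ?thesis by (simp add: mult_ac)
    qed
    have "?L (\<lambda>p \<psi>. D p \<psi> * G' \<psi> + G \<psi> * D' p \<psi>) (\<lambda>p \<psi>. E p \<psi> * G' \<psi> + G \<psi> * E' p \<psi>)
        = ?L D E * G' \<psi> + G \<psi> * ?L D' E'"
      by (simp add: distrib_left distrib_right sum.distrib sum_distrib_left sum_distrib_right mult_ac)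
    moreover have "cmod (G (\<lambda>i. \<psi> i + \<delta> i) * G' (\<lambda>i. \<psi> i + \<delta> i) - G \<psi> * G' \<psi> - (?L D E * G' \<psi> + G \<psi> * ?L D' E')) \<le> B * t\<^sup>2"
      unfolding B_def K_def K'_def
      by (rule product_remainder) (use T \<delta> t Lb in auto)
    ultimately show "cmod (G (\<lambda>i. \<psi> i + \<delta> i) * G' (\<lambda>i. \<psi> i + \<delta> i) - G \<psi> * G' \<psi> -
       ?L (\<lambda>p \<psi>. D p \<psi> * G' \<psi> + G \<psi> * D' p \<psi>) (\<lambda>p \<psi>. E p \<psi> * G' \<psi> + G \<psi> * E' p \<psi>)) \<le> B * csq N \<delta>"
      using t by simp
  qed
  then have "\<exists>C\<ge>0. taylor_bound N C (\<lambda>\<psi>. G \<psi> * G' \<psi>) (\<lambda>p \<psi>. D p \<psi> * G' \<psi> + G \<psi> * D' p \<psi>)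
    (\<lambda>p \<psi>. E p \<psi> * G' \<psi> + G \<psi> * E' p \<psi>)" using B by blast
  moreover have "(\<Sum>q<N. cnj (\<psi> q) * (E q \<psi> * G' \<psi> + G \<psi> * E' q \<psi>)) = of_nat (l + l') * (G \<psi> * G' \<psi>)"
    if \<psi>: "\<psi> \<in> pure_states N" for \<psi>
  proof -
    have "(\<Sum>q<N. cnj (\<psi> q) * (E q \<psi> * G' \<psi> + G \<psi> * E' q \<psi>)) =
       (\<Sum>q<N. cnj (\<psi> q) * E q \<psi>) * G' \<psi> + G \<psi> * (\<Sum>q<N. cnj (\<psi> q) * E' q \<psi>)"
      by (simp add: distrib_left sum.distrib sum_distrib_left sum_distrib_right mult_ac)
    also have "\<dots> = of_nat l * G \<psi> * G' \<psi> + G \<psi> * (of_nat l' * G' \<psi>)"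
      using bipolyD(4)[OF assms(1) \<psi>] bipolyD(4)[OF assms(2) \<psi>] by simp
    finally show ?thesis by (simp add: algebra_simps)
  qed
  ultimately show ?thesis
    unfolding bipoly_def using bipolyD(1-3)[OF assms(1)] bipolyD(1-3)[OF assms(2)]
    by (auto intro!: borel_measurable_add borel_measurable_times)
qed

text \<open>Rational parametrisation of the circle: for \<open>d = 1 - i t\<close> the quotient
  \<open>cnj d / d\<close> has modulus one and differs from \<open>1\<close> by
  \<open>2 i t / d\<close>, of modulus at most \<open>2 t\<close>. No estimate of the exponential
  enters.\<close>

lemma unit_near_one:
  assumes "e > 0"
  obtains z :: complex where "z * cnj z = 1" "z \<noteq> 1" "cmod (z - 1) \<le> e" "cmod (z - 1) \<le> 1"
proof -
  define t where "t = min (e / 2) (1 / 2)"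
  have t: "t > 0" "2 * t \<le> e" "2 * t \<le> 1" using assms by (auto simp: t_def)
  define d where "d = Complex 1 (- t)"
  have d: "d \<noteq> 0" "cmod d \<ge> 1"
    using abs_Re_le_cmod[of d] by (auto simp: d_def complex_eq_iff)
  have z1: "cnj d / d - 1 = Complex 0 (2 * t) / d"
    using d by (simp add: field_simps) (simp add: d_def complex_eq_iff)
  have "Complex 0 (2 * t) = \<i> * of_real (2 * t)" by (simp add: complex_eq_iff)
  then have "cmod (Complex 0 (2 * t)) = 2 * t" using t by (simp add: norm_mult)
  then have "cmod (cnj d / d - 1) \<le> 2 * t"
    unfolding z1 norm_divide using d t by (simp add: divide_le_eq mult_le_cancel_left1)
  moreover have "cnj d / d * cnj (cnj d / d) = 1" using d by simp
  moreover have "Complex 0 (2 * t) \<noteq> 0" using t by (simp add: complex_eq_iff)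
  then have "cnj d / d \<noteq> 1" using z1 d by auto
  ultimately show ?thesis using that[of "cnj d / d"] t by linarith
qed

section \<open>From rotation invariance to the integration by parts formula\<close>

lemma haar_like_integrable:
  assumes "haar_like N M" "f \<in> borel_measurable (state_space N)"
    "\<And>\<psi>. \<psi> \<in> pure_states N \<Longrightarrow> cmod (f \<psi>) \<le> B"
  shows "integrable M (f :: _ \<Rightarrow> complex)"
proof -
  interpret prob_space M using assms by (simp add: haar_like_def)
  have sM: "sets M = sets (state_space N)" using assms(1) by (simp add: haar_like_def)
  have "f \<in> borel_measurable M" using assms(2) unfolding measurable_cong_sets[OF sM refl] .
  moreover have "AE x in M. norm (f x) \<le> B" using assms(3) haar_like_space[OF assms(1)] by (intro AE_I2) simp
  ultimately show ?thesis by (intro integrable_const_bound) auto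
qed

lemma bipoly_bounded:
  assumes "bipoly N l G D E"
  obtains B where "B \<ge> 0" "\<And>\<psi>. \<psi> \<in> pure_states N \<Longrightarrow> cmod (G \<psi>) \<le> B"
    "\<And>\<psi> p. \<psi> \<in> pure_states N \<Longrightarrow> cmod (D p \<psi>) \<le> B" "\<And>\<psi> p. \<psi> \<in> pure_states N \<Longrightarrow> cmod (E p \<psi>) \<le> B"
  using bipolyD(5)[OF assms] unfolding taylor_bound_def by blast

lemma haar_like_integrable_coord_mult:
  assumes M: "haar_like N M" and f: "f \<in> borel_measurable (state_space N)"
    and B: "\<And>\<psi>. \<psi> \<in> pure_states N \<Longrightarrow> cmod (f \<psi>) \<le> B"
  shows "integrable M (\<lambda>\<psi>. \<psi> q * f \<psi>)" "integrable M (\<lambda>\<psi>. cnj (\<psi> q) * f \<psi>)"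
proof -
  have cm: "(\<lambda>\<psi>. cnj (\<psi> q)) \<in> borel_measurable (state_space N)"
    by (rule measurable_compose[OF state_space_component])
      (intro borel_measurable_continuous_onI continuous_intros)
  have bd: "cmod (z * f \<psi>) \<le> 1 * B" if "cmod z \<le> 1" "\<psi> \<in> pure_states N" for z \<psi>
    unfolding norm_mult using that B by (intro mult_mono) auto
  show "integrable M (\<lambda>\<psi>. \<psi> q * f \<psi>)" "integrable M (\<lambda>\<psi>. cnj (\<psi> q) * f \<psi>)"
    using bd pure_state_component_le f cm
    by (auto intro!: haar_like_integrable[OF M, where B = "1 * B"] borel_measurable_times)
qed

text \<open>Invariance under the rotations \<open>1 + (z - 1) v v\<^sup>* / |v|\<^sup>2\<close> with \<open>|z| = 1\<close>, \<open>z \<rightarrow> 1\<close>.\<close>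

lemma haar_like_rotation_derivative:
  assumes M: "haar_like N M" and G: "bipoly N l G D E" and v: "csq N v > 0"
  shows "(\<integral>\<psi>. (\<Sum>q<N. cnj (v q) * \<psi> q) * (\<Sum>p<N. v p * D p \<psi>) \<partial>M)
       = (\<integral>\<psi>. cnj (\<Sum>q<N. cnj (v q) * \<psi> q) * (\<Sum>p<N. cnj (v p) * E p \<psi>) \<partial>M)"
proof -
  interpret prob_space M using M by (simp add: haar_like_def)
  have sM: "sets M = sets (state_space N)" using M by (simp add: haar_like_def)
  have sp: "space M = pure_states N" by (rule haar_like_space[OF M])
  obtain C where C: "C \<ge> 0" "taylor_bound N C G D E" using bipolyD(5)[OF G] by blast
  note T = C(2)[unfolded taylor_bound_def, rule_format]
  let ?ip = "\<lambda>\<psi>. \<Sum>q<N. cnj (v q) * \<psi> q"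
  let ?f = "\<lambda>\<psi>. ?ip \<psi> * (\<Sum>p<N. v p * D p \<psi>)"
  let ?g = "\<lambda>\<psi>. cnj (?ip \<psi>) * (\<Sum>p<N. cnj (v p) * E p \<psi>)"
  define s where "s = csq N v"
  have s: "s > 0" using v by (simp add: s_def)
  have Gi: "integrable M G" using haar_like_integrable[OF M bipolyD(1)[OF G], of C] T by auto
  have fi: "integrable M ?f"
  proof -
    have "integrable M (\<lambda>\<psi>. \<psi> q * D p \<psi>)" for p q
      using haar_like_integrable_coord_mult(1)[OF M bipolyD(2)[OF G, of p], of C] T by blast
    then have "integrable M (\<lambda>\<psi>. \<Sum>q<N. \<Sum>p<N. (cnj (v q) * v p) * (\<psi> q * D p \<psi>))"
      by (intro Bochner_Integration.integrable_sum integrable_mult_right)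
    then show ?thesis by (simp add: sum_product mult_ac)
  qed
  have gi: "integrable M ?g"
  proof -
    have "integrable M (\<lambda>\<psi>. cnj (\<psi> q) * E p \<psi>)" for p q
      using haar_like_integrable_coord_mult(2)[OF M bipolyD(3)[OF G, of p], of C] T by blast
    then have "integrable M (\<lambda>\<psi>. \<Sum>q<N. \<Sum>p<N. (v q * cnj (v p)) * (cnj (\<psi> q) * E p \<psi>))"
      by (intro Bochner_Integration.integrable_sum integrable_mult_right)
    then show ?thesis by (simp add: sum_product mult_ac)
  qed
  define X where "X = (\<integral>\<psi>. ?f \<psi> \<partial>M)"
  define Y where "Y = (\<integral>\<psi>. ?g \<psi> \<partial>M)"
  have key: "cmod (X - cnj z * Y) \<le> s * C * cmod (z - 1)"
    if z: "z * cnj z = 1" "z \<noteq> 1" "cmod (z - 1) \<le> 1" for z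
  proof -
    define c where "c = (z - 1) / of_real s"
    have cc: "c + cnj c + c * cnj c * of_real (csq N v) = ((z - 1) + (cnj z - 1) + (z - 1) * (cnj z - 1)) / of_real s"
    proof -
      have "a / b + a' / b + a / b * (a' / b) * b = (a + a' + a * a') / b" if "b \<noteq> 0" for a a' b :: complex
        using that by (simp add: field_simps)
      from this[of "of_real s" "z - 1" "cnj z - 1"] show ?thesis
        using s unfolding c_def s_def[symmetric] by simp
    qed
    have "(z - 1) + (cnj z - 1) + (z - 1) * (cnj z - 1) = 0" using z(1) by (simp add: algebra_simps)
    then have U: "unitary N (reflect N c v)" using cc by (intro unitary_reflect) simp
    define \<delta> where "\<delta> \<psi> = (\<lambda>i. if i < N then c * ?ip \<psi> * v i else 0)" for \<psi>
    have act: "act N (reflect N c v) \<psi> = (\<lambda>i. \<psi> i + \<delta> \<psi> i)" if "\<psi> \<in> pure_states N" for \<psi>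
      using that by (auto simp: act_reflect \<delta>_def pure_states_iff)
    have csq\<delta>: "csq N (\<delta> \<psi>) \<le> (cmod (z - 1))\<^sup>2" if \<psi>: "\<psi> \<in> pure_states N" for \<psi>
    proof -
      have ip: "cmod (?ip \<psi>) \<le> sqrt s * 1"
        using \<psi> s by (intro cmod_sum_mult_le) (auto simp: s_def csq_def pure_states_iff)
      have "csq N (\<delta> \<psi>) = (\<Sum>i<N. (cmod (c * ?ip \<psi>))\<^sup>2 * (cmod (v i))\<^sup>2)"
        unfolding csq_def by (intro sum.cong refl) (simp add: \<delta>_def norm_mult power_mult_distrib)
      also have "\<dots> = (cmod c)\<^sup>2 * (cmod (?ip \<psi>))\<^sup>2 * s"
        unfolding s_def csq_def sum_distrib_left[symmetric] by (simp only: norm_mult power_mult_distrib)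
      also have "\<dots> \<le> (cmod c)\<^sup>2 * s * s"
      proof -
        have "(cmod (?ip \<psi>))\<^sup>2 \<le> (sqrt s)\<^sup>2" using ip by (intro power_mono) auto
        then show ?thesis using s by (intro mult_right_mono mult_left_mono) auto
      qed
      also have "\<dots> = (cmod (z - 1))\<^sup>2"
        using s by (simp add: c_def norm_divide power_divide power2_eq_square)
      finally show ?thesis .
    qed
    have z1: "(cmod (z - 1))\<^sup>2 \<le> 1" using z(3) by (simp add: power_le_one)
    have inv: "(\<integral>\<psi>. G (act N (reflect N c v) \<psi>) \<partial>M) = (\<integral>\<psi>. G \<psi> \<partial>M)"
    proof -
      have "(\<integral>\<psi>. G \<psi> \<partial>M) = (\<integral>\<psi>. G \<psi> \<partial>distr M M (act N (reflect N c v)))"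
        using M U by (simp add: haar_like_def)
      also have "\<dots> = (\<integral>\<psi>. G (act N (reflect N c v) \<psi>) \<partial>M)"
      proof (rule integral_distr)
        show "act N (reflect N c v) \<in> M \<rightarrow>\<^sub>M M"
          using act_measurable[OF U] unfolding measurable_cong_sets[OF sM sM] .
        show "G \<in> borel_measurable M"
          using bipolyD(1)[OF G] unfolding measurable_cong_sets[OF sM refl] .
      qed
      finally show ?thesis by simp
    qed
    have Gai: "integrable M (\<lambda>\<psi>. G (act N (reflect N c v) \<psi>))"
    proof (rule haar_like_integrable[OF M])
      show "(\<lambda>\<psi>. G (act N (reflect N c v) \<psi>)) \<in> borel_measurable (state_space N)"
        by (rule measurable_compose[OF act_measurable[OF U] bipolyD(1)[OF G]])
      show "cmod (G (act N (reflect N c v) \<psi>)) \<le> C" if "\<psi> \<in> pure_states N" for \<psi>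
        using T act_pure_states[OF U that] by blast
    qed
    have lin1: "(\<Sum>p<N. \<delta> \<psi> p * D p \<psi>) = c * ?f \<psi>" for \<psi>
      by (simp add: \<delta>_def sum_distrib_left mult_ac)
    have lin2: "(\<Sum>p<N. cnj (\<delta> \<psi> p) * E p \<psi>) = cnj c * ?g \<psi>" for \<psi>
      by (simp add: \<delta>_def sum_distrib_left mult_ac)
    let ?R = "\<lambda>\<psi>. G (act N (reflect N c v) \<psi>) - G \<psi> - (c * ?f \<psi> + cnj c * ?g \<psi>)"
    \<comment> \<open>Invariance cancels the two integrals of \<open>G\<close>, so the first-order
      terms are controlled by the integral of the second-order remainder.\<close>
    have "(\<integral>\<psi>. ?R \<psi> \<partial>M) = - (c * X + cnj c * Y)"
      unfolding X_def Y_def using Gi fi gi Gai inv by simp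
    then have "cmod (c * X + cnj c * Y) = cmod (\<integral>\<psi>. ?R \<psi> \<partial>M)" by (metis norm_minus_cancel)
    also have "\<dots> \<le> (\<integral>\<psi>. cmod (?R \<psi>) \<partial>M)" by (rule integral_norm_bound)
    also have "\<dots> \<le> (\<integral>\<psi>. C * (cmod (z - 1))\<^sup>2 \<partial>M)"
    proof (rule integral_mono)
      show "integrable M (\<lambda>\<psi>. cmod (?R \<psi>))" using Gi fi gi Gai by (intro integrable_norm) auto
      fix \<psi> assume "\<psi> \<in> space M"
      then have \<psi>: "\<psi> \<in> pure_states N" using sp by simp
      have "csq N (\<delta> \<psi>) \<le> 1" using csq\<delta>[OF \<psi>] z1 by linarith
      then have "cmod (?R \<psi>) \<le> C * csq N (\<delta> \<psi>)"
        using T[OF \<psi>] unfolding act[OF \<psi>] lin1[symmetric] lin2[symmetric] by blast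
      also have "\<dots> \<le> C * (cmod (z - 1))\<^sup>2" using csq\<delta>[OF \<psi>] C by (intro mult_left_mono)
      finally show "cmod (?R \<psi>) \<le> C * (cmod (z - 1))\<^sup>2" .
    qed simp
    also have "\<dots> = C * (cmod (z - 1))\<^sup>2" by (simp add: prob_space)
    finally have le: "cmod (c * X + cnj c * Y) \<le> C * (cmod (z - 1))\<^sup>2" .
    \<comment> \<open>On the unit circle both first-order terms share the factor
      \<open>z - 1\<close>; cancelling it leaves a bound that still tends to zero.\<close>
    have "cnj z - 1 = - (z - 1) * cnj z" using z(1) by (simp add: algebra_simps)
    then have "c * X + cnj c * Y = (z - 1) * (X - cnj z * Y) / of_real s"
      using s by (simp add: c_def field_simps)
    then have "cmod (z - 1) * cmod (X - cnj z * Y) / s \<le> C * (cmod (z - 1))\<^sup>2"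
      using le s by (simp add: norm_mult norm_divide)
    then have "cmod (z - 1) * cmod (X - cnj z * Y) \<le> cmod (z - 1) * (s * C * cmod (z - 1))"
      using s by (simp add: divide_le_eq power2_eq_square mult_ac)
    then show ?thesis using z(2) by simp
  qed
  have "cmod (X - Y) \<le> e" if e: "e > 0" for e
  proof -
    \<comment> \<open>The summand \<open>s * C\<close> comes from the remainder and
      \<open>cmod Y\<close> from replacing \<open>cnj z\<close> by \<open>1\<close>; the final
      \<open>1\<close> makes \<open>K\<close> positive so that \<open>e / K\<close> is a legitimate
      tolerance.\<close>
    define K where "K = s * C + cmod Y + 1"
    have K: "K > 0" using s C by (simp add: K_def add_nonneg_pos)
    obtain z where z: "z * cnj z = 1" "z \<noteq> 1" "cmod (z - 1) \<le> e / K" "cmod (z - 1) \<le> 1"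
      using unit_near_one[of "e / K"] e K by auto
    have "X - Y = (X - cnj z * Y) + cnj (z - 1) * Y" by (simp add: algebra_simps)
    also have "cmod \<dots> \<le> s * C * cmod (z - 1) + cmod (z - 1) * cmod Y"
      using key[OF z(1,2,4)] by (intro norm_triangle_mono) (auto simp: norm_mult complex_mod_cnj simp del: complex_cnj_diff)
    also have "\<dots> \<le> K * cmod (z - 1)" by (simp add: K_def algebra_simps)
    also have "\<dots> \<le> e" using z(3) K by (simp add: le_divide_eq mult.commute)
    finally show ?thesis .
  qed
  then have "cmod (X - Y) \<le> 0" by (rule field_le_epsilon) auto
  then show ?thesis by (simp add: X_def Y_def)
qed

text \<open>The rotation identity says that the sesquilinear form with matrix \<open>T\<close>
  vanishes at every nonzero vector paired with itself. Polarisation recovers each entry of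
  \<open>T\<close>, which amounts to using the generators of the complexified Lie algebra of the
  unitary group.\<close>

lemma haar_like_lie_derivative:
  assumes M: "haar_like N M" and G: "bipoly N l G D E" and pq: "p < N" "q < N"
  shows "(\<integral>\<psi>. \<psi> q * D p \<psi> \<partial>M) = (\<integral>\<psi>. cnj (\<psi> p) * E q \<psi> \<partial>M)"
proof -
  obtain B where B: "B \<ge> 0" "\<And>\<psi> p. \<psi> \<in> pure_states N \<Longrightarrow> cmod (D p \<psi>) \<le> B"
    "\<And>\<psi> p. \<psi> \<in> pure_states N \<Longrightarrow> cmod (E p \<psi>) \<le> B"
    using bipoly_bounded[OF G] by metis
  have Di: "integrable M (\<lambda>\<psi>. \<psi> q * D p \<psi>)" for p q
    using haar_like_integrable_coord_mult(1)[OF M bipolyD(2)[OF G, of p], of B] B by blast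
  have Ei: "integrable M (\<lambda>\<psi>. cnj (\<psi> q) * E p \<psi>)" for p q
    using haar_like_integrable_coord_mult(2)[OF M bipolyD(3)[OF G, of p], of B] B by blast
  define T where "T p q = (\<integral>\<psi>. \<psi> q * D p \<psi> \<partial>M) - (\<integral>\<psi>. cnj (\<psi> p) * E q \<psi> \<partial>M)" for p q
  have Q: "(\<Sum>a<N. v a * (\<Sum>b<N. cnj (v b) * T a b)) = 0" if v: "csq N v > 0" for v
  proof -
    have "(\<integral>\<psi>. (\<Sum>b<N. cnj (v b) * \<psi> b) * (\<Sum>a<N. v a * D a \<psi>) \<partial>M)
        = (\<integral>\<psi>. (\<Sum>b<N. \<Sum>a<N. (cnj (v b) * v a) * (\<psi> b * D a \<psi>)) \<partial>M)"
      by (simp add: sum_product mult_ac)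
    also have "\<dots> = (\<Sum>b<N. \<Sum>a<N. (cnj (v b) * v a) * (\<integral>\<psi>. \<psi> b * D a \<psi> \<partial>M))"
      using Di by (subst Bochner_Integration.integral_sum, simp, subst Bochner_Integration.integral_sum) auto
    finally have 1: "(\<integral>\<psi>. (\<Sum>b<N. cnj (v b) * \<psi> b) * (\<Sum>a<N. v a * D a \<psi>) \<partial>M)
        = (\<Sum>b<N. \<Sum>a<N. (cnj (v b) * v a) * (\<integral>\<psi>. \<psi> b * D a \<psi> \<partial>M))" .
    have "(\<integral>\<psi>. cnj (\<Sum>a<N. cnj (v a) * \<psi> a) * (\<Sum>b<N. cnj (v b) * E b \<psi>) \<partial>M)
        = (\<integral>\<psi>. (\<Sum>a<N. \<Sum>b<N. (cnj (v b) * v a) * (cnj (\<psi> a) * E b \<psi>)) \<partial>M)"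
      by (simp add: sum_product mult_ac)
    also have "\<dots> = (\<Sum>a<N. \<Sum>b<N. (cnj (v b) * v a) * (\<integral>\<psi>. cnj (\<psi> a) * E b \<psi> \<partial>M))"
      using Ei by (subst Bochner_Integration.integral_sum, simp, subst Bochner_Integration.integral_sum) auto
    also have "\<dots> = (\<Sum>b<N. \<Sum>a<N. (cnj (v b) * v a) * (\<integral>\<psi>. cnj (\<psi> a) * E b \<psi> \<partial>M))"
      by (rule sum.swap)
    finally have "(\<Sum>b<N. \<Sum>a<N. (cnj (v b) * v a) * (\<integral>\<psi>. \<psi> b * D a \<psi> \<partial>M)) =
        (\<Sum>b<N. \<Sum>a<N. (cnj (v b) * v a) * (\<integral>\<psi>. cnj (\<psi> a) * E b \<psi> \<partial>M))"
      using haar_like_rotation_derivative[OF M G v] 1 by simp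
    then have "(\<Sum>b<N. \<Sum>a<N. (cnj (v b) * v a) * T a b) = 0"
      unfolding T_def right_diff_distrib sum_subtractf by simp
    then show ?thesis by (subst (asm) sum.swap) (simp add: sum_distrib_left mult_ac)
  qed
  have delta: "(\<Sum>a<N. ((if a = p then 1 else 0) + w * (if a = q then 1 else 0)) * F a) = F p + w * F q"
    if "p < N" "q < N" for p q and w :: complex and F
  proof -
    have "(\<Sum>a<N. ((if a = p then 1 else 0) + w * (if a = q then 1 else 0)) * F a)
        = (\<Sum>a<N. (if a = p then F a else 0) + (if a = q then w * F a else 0))"
      by (intro sum.cong) (auto simp: algebra_simps)
    then show ?thesis using that by (simp add: sum.distrib)
  qed
  have pol: "T p p + cnj w * T p q + w * (T q p + cnj w * T q q) = 0" if pq: "p < N" "q < N" "p \<noteq> q" for p q w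
  proof -
    define v where "v a = (if a = p then 1 else 0) + w * (if a = q then 1 else 0)" for a
    have "0 < (cmod (v p))\<^sup>2" using pq by (simp add: v_def)
    also have "\<dots> \<le> csq N v" unfolding csq_def using pq by (intro member_le_sum[of p _ "\<lambda>i. (cmod (v i))\<^sup>2"]) auto
    finally have "csq N v > 0" .
    note Q[OF this]
    moreover have "(\<Sum>b<N. cnj (v b) * T a b) = T a p + cnj w * T a q" for a
    proof -
      have "cnj (v b) = (if b = p then 1 else 0) + cnj w * (if b = q then 1 else 0)" for b
        by (simp add: v_def)
      then show ?thesis using delta[OF pq(1,2), of "cnj w" "T a"] by simp
    qed
    moreover have "(\<Sum>a<N. v a * (T a p + cnj w * T a q)) = (T p p + cnj w * T p q) + w * (T q p + cnj w * T q q)"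
      unfolding v_def by (rule delta[OF pq(1,2), of w "\<lambda>a. T a p + cnj w * T a q"])
    ultimately show ?thesis by simp
  qed
  have diag: "T p p = 0" if p: "p < N" for p
  proof -
    define v :: "nat \<Rightarrow> complex" where "v a = (if a = p then 1 else 0) + 0 * (if a = p then 1 else 0)" for a
    have "0 < (cmod (v p))\<^sup>2" by (simp add: v_def)
    also have "\<dots> \<le> csq N v" unfolding csq_def using p by (intro member_le_sum[of p _ "\<lambda>i. (cmod (v i))\<^sup>2"]) auto
    finally have "csq N v > 0" .
    note Q[OF this]
    moreover have "(\<Sum>b<N. cnj (v b) * T a b) = T a p" for a
    proof -
      have "cnj (v b) = (if b = p then 1 else 0) + 0 * (if b = p then 1 else 0)" for b
        by (simp add: v_def)
      then show ?thesis using delta[OF p p, of 0 "T a"] by simp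
    qed
    moreover have "(\<Sum>a<N. v a * T a p) = T p p"
      unfolding v_def using delta[OF p p, of 0 "\<lambda>a. T a p"] by simp
    ultimately show ?thesis by simp
  qed
  have "T p q = 0"
  proof (cases "p = q")
    case True then show ?thesis using diag pq by simp
  next
    case False
    \<comment> \<open>The choices \<open>w = 1\<close> and \<open>w = \<i>\<close> determine the sum
      and the difference of the two off-diagonal entries.\<close>
    have 1: "T p q + T q p = 0" using pol[OF pq False, of 1] diag pq by simp
    have "\<i> * (T q p - T p q) = 0" using pol[OF pq False, of \<i>] diag pq by (simp add: algebra_simps)
    then have "T q p = T p q" by simp
    with 1 show ?thesis by simp
  qed
  then show ?thesis by (simp add: T_def)
qed

text \<open>Apply the previous identity to \<open>cnj (\<psi> q) * G\<close> and sum over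
  \<open>q\<close>. On one side the weights add up to \<open>|\<psi>|^2 = 1\<close>. On the other,
  differentiating \<open>cnj (\<psi> q)\<close> itself contributes \<open>G\<close> once for each
  \<open>q\<close>, hence the \<open>N\<close>, and the Euler identity contributes the
  \<open>l\<close>.\<close>

theorem haar_like_stein:
  assumes M: "haar_like N M" and G: "bipoly N l G D E" and p: "p < N"
  shows "of_nat (N + l) * (\<integral>\<psi>. cnj (\<psi> p) * G \<psi> \<partial>M) = (\<integral>\<psi>. D p \<psi> \<partial>M)"
proof -
  have sp: "space M = pure_states N" by (rule haar_like_space[OF M])
  obtain B where B: "B \<ge> 0" "\<And>\<psi>. \<psi> \<in> pure_states N \<Longrightarrow> cmod (G \<psi>) \<le> B"
    "\<And>\<psi> p. \<psi> \<in> pure_states N \<Longrightarrow> cmod (D p \<psi>) \<le> B"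
    "\<And>\<psi> p. \<psi> \<in> pure_states N \<Longrightarrow> cmod (E p \<psi>) \<le> B"
    using bipoly_bounded[OF G] by metis
  have Gq: "bipoly N (1 + l) (\<lambda>\<psi>. cnj (\<psi> q) * G \<psi>) (\<lambda>p \<psi>. 0 * G \<psi> + cnj (\<psi> q) * D p \<psi>)
      (\<lambda>r \<psi>. (if r = q then 1 else 0) * G \<psi> + cnj (\<psi> q) * E r \<psi>)" if "q < N" for q
    by (rule bipoly_mult[OF bipoly_cnj_coord[OF that] G])
  have step: "(\<integral>\<psi>. \<psi> q * (cnj (\<psi> q) * D p \<psi>) \<partial>M) = (\<integral>\<psi>. cnj (\<psi> p) * (G \<psi> + cnj (\<psi> q) * E q \<psi>) \<partial>M)"
    if q: "q < N" for q
    using haar_like_lie_derivative[OF M Gq[OF q] p q] by simp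
  have cm: "(\<lambda>\<psi>. cnj (\<psi> q)) \<in> borel_measurable (state_space N)" for q
    by (rule measurable_compose[OF state_space_component])
      (intro borel_measurable_continuous_onI continuous_intros)
  have i1: "integrable M (\<lambda>\<psi>. \<psi> q * (cnj (\<psi> q) * D p \<psi>))" for q
  proof (rule haar_like_integrable_coord_mult(1)[OF M, where B = "1 * B"])
    show "(\<lambda>\<psi>. cnj (\<psi> q) * D p \<psi>) \<in> borel_measurable (state_space N)"
      by (intro borel_measurable_times cm bipolyD(2)[OF G])
    show "cmod (cnj (\<psi> q) * D p \<psi>) \<le> 1 * B" if "\<psi> \<in> pure_states N" for \<psi>
      unfolding norm_mult using that B pure_state_component_le[OF that] by (intro mult_mono) auto
  qed
  have i2: "integrable M (\<lambda>\<psi>. cnj (\<psi> p) * (G \<psi> + cnj (\<psi> q) * E q \<psi>))" for q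
  proof (rule haar_like_integrable_coord_mult(2)[OF M, where B = "B + 1 * B"])
    show "(\<lambda>\<psi>. G \<psi> + cnj (\<psi> q) * E q \<psi>) \<in> borel_measurable (state_space N)"
      by (intro borel_measurable_times borel_measurable_add cm bipolyD[OF G])
    show "cmod (G \<psi> + cnj (\<psi> q) * E q \<psi>) \<le> B + 1 * B" if "\<psi> \<in> pure_states N" for \<psi>
    proof (rule norm_triangle_mono)
      show "cmod (G \<psi>) \<le> B" using B that by blast
      show "cmod (cnj (\<psi> q) * E q \<psi>) \<le> 1 * B"
        unfolding norm_mult using that B pure_state_component_le[OF that] by (intro mult_mono) auto
    qed
  qed
  have "(\<integral>\<psi>. D p \<psi> \<partial>M) = (\<integral>\<psi>. (\<Sum>q<N. \<psi> q * (cnj (\<psi> q) * D p \<psi>)) \<partial>M)"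
  proof (rule Bochner_Integration.integral_cong[OF refl])
    fix \<psi> assume "\<psi> \<in> space M"
    then have "csq N \<psi> = 1" using sp by (simp add: pure_states_iff)
    then have "(\<Sum>q<N. \<psi> q * cnj (\<psi> q)) = 1"
      unfolding csq_def by (metis (no_types, lifting) complex_norm_square of_real_1 of_real_sum sum.cong)
    then show "D p \<psi> = (\<Sum>q<N. \<psi> q * (cnj (\<psi> q) * D p \<psi>))"
      by (simp add: mult.assoc[symmetric] sum_distrib_right[symmetric])
  qed
  also have "\<dots> = (\<Sum>q<N. \<integral>\<psi>. \<psi> q * (cnj (\<psi> q) * D p \<psi>) \<partial>M)"
    by (rule Bochner_Integration.integral_sum) (rule i1)
  also have "\<dots> = (\<Sum>q<N. \<integral>\<psi>. cnj (\<psi> p) * (G \<psi> + cnj (\<psi> q) * E q \<psi>) \<partial>M)"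
    by (intro sum.cong refl) (simp only: step lessThan_iff)
  also have "\<dots> = (\<integral>\<psi>. (\<Sum>q<N. cnj (\<psi> p) * (G \<psi> + cnj (\<psi> q) * E q \<psi>)) \<partial>M)"
    by (rule Bochner_Integration.integral_sum[symmetric]) (rule i2)
  also have "\<dots> = (\<integral>\<psi>. of_nat (N + l) * (cnj (\<psi> p) * G \<psi>) \<partial>M)"
  proof (rule Bochner_Integration.integral_cong[OF refl])
    fix \<psi> assume "\<psi> \<in> space M"
    then have \<psi>: "\<psi> \<in> pure_states N" using sp by simp
    have "(\<Sum>q<N. cnj (\<psi> p) * (G \<psi> + cnj (\<psi> q) * E q \<psi>))
        = cnj (\<psi> p) * (of_nat N * G \<psi> + (\<Sum>q<N. cnj (\<psi> q) * E q \<psi>))"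
      by (simp add: sum_distrib_left[symmetric] sum.distrib)
    then show "(\<Sum>q<N. cnj (\<psi> p) * (G \<psi> + cnj (\<psi> q) * E q \<psi>)) = of_nat (N + l) * (cnj (\<psi> p) * G \<psi>)"
      unfolding bipolyD(4)[OF G \<psi>] by (simp add: algebra_simps)
  qed
  finally show ?thesis by simp
qed

section \<open>The variance under the uniform measure\<close>

definition bip :: "nat \<Rightarrow> nat \<Rightarrow> ((nat \<Rightarrow> complex) \<Rightarrow> complex) \<Rightarrow>
    (nat \<Rightarrow> (nat \<Rightarrow> complex) \<Rightarrow> complex) \<Rightarrow> bool" where
  \<comment> \<open>The antiholomorphic derivatives are hidden, as they enter integration by parts
    only through the degree. Agreement is asked for \<open>p < N\<close> only, since closed forms
    such as \<open>dap\<close> need not vanish beyond the dimension.\<close>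
  "bip N l G D \<longleftrightarrow> (\<exists>D' E. bipoly N l G D' E \<and> (\<forall>p<N. \<forall>\<psi>. D' p \<psi> = D p \<psi>))"

lemma bip_cong:
  assumes "bip N l G D" "\<And>\<psi>. G \<psi> = G' \<psi>" "\<And>p \<psi>. p < N \<Longrightarrow> D p \<psi> = D' p \<psi>"
  shows "bip N l G' D'"
proof -
  have "G = G'" using assms(2) by blast
  then show ?thesis using assms(1,3) unfolding bip_def by metis
qed

lemma bip_const: "bip N 0 (\<lambda>_. c) (\<lambda>_ _. 0)"
  unfolding bip_def using bipoly_const by blast

lemma bip_coord: "i < N \<Longrightarrow> bip N 0 (\<lambda>\<psi>. \<psi> i) (\<lambda>p _. if p = i then 1 else 0)"
  unfolding bip_def using bipoly_coord by blast

lemma bip_cnj_coord: "i < N \<Longrightarrow> bip N 1 (\<lambda>\<psi>. cnj (\<psi> i)) (\<lambda>_ _. 0)"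
  unfolding bip_def using bipoly_cnj_coord by blast

lemma bip_mult:
  assumes "bip N l G D" "bip N l' G' D'"
  shows "bip N (l + l') (\<lambda>\<psi>. G \<psi> * G' \<psi>) (\<lambda>p \<psi>. D p \<psi> * G' \<psi> + G \<psi> * D' p \<psi>)"
proof -
  obtain D1 E1 D2 E2 where *: "bipoly N l G D1 E1" "\<And>p \<psi>. p < N \<Longrightarrow> D1 p \<psi> = D p \<psi>"
    "bipoly N l' G' D2 E2" "\<And>p \<psi>. p < N \<Longrightarrow> D2 p \<psi> = D' p \<psi>"
    using assms unfolding bip_def by blast
  show ?thesis unfolding bip_def
    by (rule exI, rule exI, rule conjI, rule bipoly_mult[OF *(1,3)]) (simp add: *(2,4))
qed

lemma bip_sum:
  assumes "finite I" "\<And>a. a \<in> I \<Longrightarrow> bip N l (G a) (D a)"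
  shows "bip N l (\<lambda>\<psi>. \<Sum>a\<in>I. G a \<psi>) (\<lambda>p \<psi>. \<Sum>a\<in>I. D a p \<psi>)"
proof -
  have "\<forall>a\<in>I. \<exists>D' E. bipoly N l (G a) D' E \<and> (\<forall>p<N. \<forall>\<psi>. D' p \<psi> = D a p \<psi>)"
    using assms(2) unfolding bip_def by blast
  then obtain D' where "\<forall>a\<in>I. \<exists>E. bipoly N l (G a) (D' a) E \<and> (\<forall>p<N. \<forall>\<psi>. D' a p \<psi> = D a p \<psi>)"
    by metis
  then obtain E where *: "\<forall>a\<in>I. bipoly N l (G a) (D' a) (E a) \<and> (\<forall>p<N. \<forall>\<psi>. D' a p \<psi> = D a p \<psi>)"
    by metis
  have "bipoly N l (\<lambda>\<psi>. \<Sum>a\<in>I. G a \<psi>) (\<lambda>p \<psi>. \<Sum>a\<in>I. D' a p \<psi>) (\<lambda>p \<psi>. \<Sum>a\<in>I. E a p \<psi>)"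
    using assms(1) * by (intro bipoly_sum) auto
  moreover have "\<forall>p<N. \<forall>\<psi>. (\<Sum>a\<in>I. D' a p \<psi>) = (\<Sum>a\<in>I. D a p \<psi>)"
    using * by (auto intro!: sum.cong)
  ultimately show ?thesis unfolding bip_def by blast
qed

lemma bip_cmult: "bip N l G D \<Longrightarrow> bip N l (\<lambda>\<psi>. c * G \<psi>) (\<lambda>p \<psi>. c * D p \<psi>)"
  using bip_cong[OF bip_mult[OF bip_const], of N l G D c "\<lambda>\<psi>. c * G \<psi>"] by simp

lemma bip_add:
  assumes "bip N l G D" "bip N l G' D'"
  shows "bip N l (\<lambda>\<psi>. G \<psi> + G' \<psi>) (\<lambda>p \<psi>. D p \<psi> + D' p \<psi>)"
proof -
  obtain D1 E1 D2 E2 where *: "bipoly N l G D1 E1" "\<And>p \<psi>. p < N \<Longrightarrow> D1 p \<psi> = D p \<psi>"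
    "bipoly N l G' D2 E2" "\<And>p \<psi>. p < N \<Longrightarrow> D2 p \<psi> = D' p \<psi>"
    using assms unfolding bip_def by blast
  show ?thesis unfolding bip_def
    by (rule exI, rule exI, rule conjI, rule bipoly_add[OF *(1,3)]) (simp add: *(2,4))
qed

lemma bip_integrable:
  assumes M: "haar_like N M" and "bip N l G D"
  shows "integrable M G" "integrable M (\<lambda>\<psi>. cnj (\<psi> q) * G \<psi>)" "p < N \<Longrightarrow> integrable M (D p)"
proof -
  obtain D' E where *: "bipoly N l G D' E" "\<And>p \<psi>. p < N \<Longrightarrow> D' p \<psi> = D p \<psi>"
    using assms(2) unfolding bip_def by blast
  obtain B where B: "\<And>\<psi>. \<psi> \<in> pure_states N \<Longrightarrow> cmod (G \<psi>) \<le> B"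
    "\<And>\<psi> p. \<psi> \<in> pure_states N \<Longrightarrow> cmod (D' p \<psi>) \<le> B"
    using bipoly_bounded[OF *(1)] by metis
  show "integrable M G" using haar_like_integrable[OF M bipolyD(1)[OF *(1)] B(1)] .
  show "integrable M (\<lambda>\<psi>. cnj (\<psi> q) * G \<psi>)"
    using haar_like_integrable_coord_mult(2)[OF M bipolyD(1)[OF *(1)] B(1)] .
  assume "p < N"
  then have "D' p = D p" using * by blast
  then show "integrable M (D p)"
    using haar_like_integrable[OF M bipolyD(2)[OF *(1), of p] B(2)] by simp
qed

lemma bip_stein:
  assumes M: "haar_like N M" and "bip N l G D" and p: "p < N"
  shows "of_nat (N + l) * (\<integral>\<psi>. cnj (\<psi> p) * G \<psi> \<partial>M) = (\<integral>\<psi>. D p \<psi> \<partial>M)"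
proof -
  obtain D' E where *: "bipoly N l G D' E" "\<And>\<psi>. D' p \<psi> = D p \<psi>"
    using assms unfolding bip_def by blast
  show ?thesis using haar_like_stein[OF M *(1) p] *(2) by simp
qed

text \<open>\<open>B a b c d\<close> are the matrix elements of an operator on \<open>\<complex>\<^sup>N \<otimes> \<complex>\<^sup>N\<close>; \<open>ap B\<close> applies it to a
  tensor, \<open>expv B \<psi>\<close> is \<open>\<langle>\<psi>\<psi>|B|\<psi>\<psi>\<rangle>\<close>, \<open>dap\<close> and \<open>dexpv\<close> are holomorphic derivatives of \<open>ap B (\<psi>\<psi>)\<close> and
  \<open>expv B \<psi>\<close>, and \<open>dv B \<psi> a\<close> is the divergence of \<open>ap B (\<psi>\<psi>) a\<close>.\<close>

type_synonym tensor_op = "nat \<Rightarrow> nat \<Rightarrow> nat \<Rightarrow> nat \<Rightarrow> complex"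

definition ap :: "nat \<Rightarrow> tensor_op \<Rightarrow> (nat \<Rightarrow> nat \<Rightarrow> complex) \<Rightarrow> nat \<Rightarrow> nat \<Rightarrow> complex" where
  "ap N B w a b = (\<Sum>c<N. \<Sum>d<N. B a b c d * w c d)"

definition expv :: "nat \<Rightarrow> tensor_op \<Rightarrow> (nat \<Rightarrow> complex) \<Rightarrow> complex" where
  "expv N B \<psi> = (\<Sum>a<N. \<Sum>b<N. cnj (\<psi> a) * cnj (\<psi> b) * ap N B (\<lambda>c d. \<psi> c * \<psi> d) a b)"

definition dap :: "nat \<Rightarrow> tensor_op \<Rightarrow> nat \<Rightarrow> nat \<Rightarrow> nat \<Rightarrow> (nat \<Rightarrow> complex) \<Rightarrow> complex" where
  "dap N B a b p \<psi> = (\<Sum>d<N. B a b p d * \<psi> d) + (\<Sum>c<N. B a b c p * \<psi> c)"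

definition dexpv :: "nat \<Rightarrow> tensor_op \<Rightarrow> nat \<Rightarrow> (nat \<Rightarrow> complex) \<Rightarrow> complex" where
  "dexpv N B p \<psi> = (\<Sum>a<N. \<Sum>b<N. cnj (\<psi> a) * cnj (\<psi> b) * dap N B a b p \<psi>)"

definition dv :: "nat \<Rightarrow> tensor_op \<Rightarrow> (nat \<Rightarrow> complex) \<Rightarrow> nat \<Rightarrow> complex" where
  "dv N B \<psi> a = (\<Sum>b<N. dap N B a b b \<psi>)"

text \<open>The derivative of \<open>dv N B \<psi> a\<close> in direction \<open>p\<close>, constant
  because \<open>dv\<close> is linear in \<open>\<psi>\<close>. Its trace over \<open>a\<close> is
  the trace of \<open>B\<close> against identity plus swap, the quantity that fixes the uniform
  mean.\<close>

definition ddv :: "nat \<Rightarrow> tensor_op \<Rightarrow> nat \<Rightarrow> nat \<Rightarrow> complex" where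
  "ddv N B a p = (\<Sum>b<N. B a b b p + B a b p b)"

lemma bip_ap: "bip N 0 (\<lambda>\<psi>. ap N B (\<lambda>c d. \<psi> c * \<psi> d) a b) (dap N B a b)"
proof -
  have "bip N 0 (\<lambda>\<psi>. \<Sum>c<N. \<Sum>d<N. B a b c d * (\<psi> c * \<psi> d)) (\<lambda>p \<psi>. \<Sum>c<N. \<Sum>d<N. B a b c d *
      ((if p = c then 1 else 0) * \<psi> d + \<psi> c * (if p = d then 1 else 0)))"
  proof (intro bip_sum bip_cmult finite_lessThan)
    fix c d assume "c \<in> {..<N}" "d \<in> {..<N}"
    then show "bip N 0 (\<lambda>\<psi>. \<psi> c * \<psi> d) (\<lambda>p \<psi>. (if p = c then 1 else 0) * \<psi> d + \<psi> c * (if p = d then 1 else 0))"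
      using bip_mult[OF bip_coord[of c N] bip_coord[of d N]] by simp
  qed
  then show ?thesis
  proof (rule bip_cong)
    fix p \<psi> assume p: "p < N"
    have "(\<Sum>c<N. \<Sum>d<N. B a b c d * ((if p = c then 1 else 0) * \<psi> d + \<psi> c * (if p = d then 1 else 0)))
       = (\<Sum>c<N. (if p = c then \<Sum>d<N. B a b c d * \<psi> d else 0) + B a b c p * \<psi> c)"
    proof (rule sum.cong[OF refl])
      fix c
      have "(\<Sum>d<N. B a b c d * ((if p = c then 1 else 0) * \<psi> d + \<psi> c * (if p = d then 1 else 0))) =
        (\<Sum>d<N. (if p = c then B a b c d * \<psi> d else 0) + (if p = d then B a b c d * \<psi> c else 0))"
        by (intro sum.cong) (auto simp: algebra_simps)
      also have "\<dots> = (\<Sum>d<N. (if p = c then B a b c d * \<psi> d else 0)) + B a b c p * \<psi> c"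
        using p by (simp add: sum.distrib)
      finally show "(\<Sum>d<N. B a b c d * ((if p = c then 1 else 0) * \<psi> d + \<psi> c * (if p = d then 1 else 0)))
        = (if p = c then \<Sum>d<N. B a b c d * \<psi> d else 0) + B a b c p * \<psi> c" by simp
    qed
    also have "\<dots> = dap N B a b p \<psi>" using p by (simp add: sum.distrib dap_def)
    finally show "(\<Sum>c<N. \<Sum>d<N. B a b c d * ((if p = c then 1 else 0) * \<psi> d + \<psi> c * (if p = d then 1 else 0)))
      = dap N B a b p \<psi>" .
  qed (simp add: ap_def)
qed

lemma bip_cnj_mult: "a < N \<Longrightarrow> bip N l G D \<Longrightarrow> bip N (Suc l) (\<lambda>\<psi>. cnj (\<psi> a) * G \<psi>) (\<lambda>p \<psi>. cnj (\<psi> a) * D p \<psi>)"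
  using bip_cong[OF bip_mult[OF bip_cnj_coord], of a N l G D] by simp

lemma bip_ev: "bip N 2 (expv N B) (dexpv N B)"
proof -
  have "bip N (Suc (Suc 0)) (\<lambda>\<psi>. \<Sum>a<N. \<Sum>b<N. cnj (\<psi> a) * (cnj (\<psi> b) * ap N B (\<lambda>c d. \<psi> c * \<psi> d) a b))
     (\<lambda>p \<psi>. \<Sum>a<N. \<Sum>b<N. cnj (\<psi> a) * (cnj (\<psi> b) * dap N B a b p \<psi>))"
    by (intro bip_sum bip_cnj_mult bip_ap finite_lessThan) auto
  then show ?thesis
    unfolding numeral_2_eq_2 by (rule bip_cong) (simp_all add: expv_def dexpv_def mult.assoc)
qed

lemma bip_dv: "a < N \<Longrightarrow> bip N 0 (\<lambda>\<psi>. dv N B \<psi> a) (\<lambda>p _. ddv N B a p)"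
proof -
  have lin: "bip N 0 (\<lambda>\<psi>. \<Sum>c<N. x c * \<psi> c) (\<lambda>p _. x p)" for x
  proof -
    have "bip N 0 (\<lambda>\<psi>. \<Sum>c<N. x c * \<psi> c) (\<lambda>p \<psi>. \<Sum>c<N. x c * (if p = c then 1 else 0))"
      by (intro bip_sum bip_cmult bip_coord finite_lessThan) auto
    then show ?thesis
      by (rule bip_cong) (auto simp: if_distrib[of "\<lambda>z. _ * z"] cong: if_cong)
  qed
  have "bip N 0 (\<lambda>\<psi>. \<Sum>b<N. (\<Sum>d<N. B a b b d * \<psi> d) + (\<Sum>c<N. B a b c b * \<psi> c))
     (\<lambda>p \<psi>. \<Sum>b<N. B a b b p + B a b p b)"
    by (intro bip_sum bip_add lin finite_lessThan)
  then show ?thesis by (rule bip_cong) (auto simp: dv_def dap_def ddv_def)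
qed

section \<open>Gradient estimates for contractions\<close>

definition tensor_contraction :: "nat \<Rightarrow> tensor_op \<Rightarrow> bool" where
  "tensor_contraction N B \<longleftrightarrow>
     (\<forall>w. (\<Sum>a<N. \<Sum>b<N. (cmod (ap N B w a b))\<^sup>2) \<le> (\<Sum>c<N. \<Sum>d<N. (cmod (w c d))\<^sup>2))"

lemma sum_cmod_tensor: "(\<Sum>c<N. \<Sum>d<N. (cmod (x c * y d))\<^sup>2) = csq N x * csq N y"
  by (simp add: csq_def sum_product norm_mult power_mult_distrib)

lemma csq_partial_le:
  assumes "csq N x \<le> 1"
  shows "csq N (\<lambda>b. \<Sum>a<N. x a * Y a b) \<le> (\<Sum>a<N. \<Sum>b<N. (cmod (Y a b))\<^sup>2)"
proof -
  have "(cmod (\<Sum>a<N. x a * Y a b))\<^sup>2 \<le> (\<Sum>a<N. (cmod (Y a b))\<^sup>2)" for b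
  proof -
    have "cmod (\<Sum>a<N. x a * Y a b) \<le> 1 * sqrt (\<Sum>a<N. (cmod (Y a b))\<^sup>2)"
      using assms by (intro cmod_sum_mult_le) (auto simp: csq_def sum_nonneg)
    then show ?thesis by (intro sqrt_ge_absD) simp
  qed
  then have "csq N (\<lambda>b. \<Sum>a<N. x a * Y a b) \<le> (\<Sum>b<N. \<Sum>a<N. (cmod (Y a b))\<^sup>2)"
    unfolding csq_def by (intro sum_mono)
  also have "\<dots> = (\<Sum>a<N. \<Sum>b<N. (cmod (Y a b))\<^sup>2)" by (rule sum.swap)
  finally show ?thesis .
qed


lemma cmod_tensor_pairing_le:
  assumes "(\<Sum>a<N. \<Sum>b<N. (cmod (x a b))\<^sup>2) \<le> s\<^sup>2" "(\<Sum>a<N. \<Sum>b<N. (cmod (y a b))\<^sup>2) \<le> t\<^sup>2" "0 \<le> s" "0 \<le> t"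
  shows "cmod (\<Sum>a<N. \<Sum>b<N. x a b * y a b) \<le> s * t"
  using cmod_sum_mult_le[where I = "{..<N} \<times> {..<N}" and x = "\<lambda>(a, b). x a b" and y = "\<lambda>(a, b). y a b" and a = s and b = t]
    assms by (simp add: sum.cartesian_product split_beta')

text \<open>The pairing of the gradient with \<open>w\<close> is a directional derivative, and the
  product rule replaces \<open>\<psi> \<otimes> \<psi>\<close> by
  \<open>w \<otimes> \<psi> + \<psi> \<otimes> w\<close>. In this form the contraction property of
  \<open>B\<close> applies.\<close>

lemma sum_dev:
  "(\<Sum>p<N. w p * dexpv N B p \<psi>) = (\<Sum>a<N. \<Sum>b<N. cnj (\<psi> a) * cnj (\<psi> b) *
      (ap N B (\<lambda>c d. w c * \<psi> d) a b + ap N B (\<lambda>c d. \<psi> c * w d) a b))"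
proof -
  have dap: "(\<Sum>p<N. w p * dap N B a b p \<psi>) = ap N B (\<lambda>c d. w c * \<psi> d) a b + ap N B (\<lambda>c d. \<psi> c * w d) a b" for a b
  proof -
    have "(\<Sum>p<N. w p * dap N B a b p \<psi>) =
        (\<Sum>p<N. \<Sum>d<N. B a b p d * (w p * \<psi> d)) + (\<Sum>p<N. \<Sum>c<N. B a b c p * (\<psi> c * w p))"
      by (simp add: dap_def distrib_left sum.distrib sum_distrib_left mult_ac)
    also have "(\<Sum>p<N. \<Sum>c<N. B a b c p * (\<psi> c * w p)) = (\<Sum>c<N. \<Sum>p<N. B a b c p * (\<psi> c * w p))"
      by (rule sum.swap)
    finally show ?thesis by (simp add: ap_def)
  qed
  have "(\<Sum>p<N. w p * dexpv N B p \<psi>) = (\<Sum>p<N. \<Sum>a<N. \<Sum>b<N. cnj (\<psi> a) * cnj (\<psi> b) * (w p * dap N B a b p \<psi>))"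
    by (simp add: dexpv_def sum_distrib_left mult_ac)
  also have "\<dots> = (\<Sum>a<N. \<Sum>p<N. \<Sum>b<N. cnj (\<psi> a) * cnj (\<psi> b) * (w p * dap N B a b p \<psi>))"
    by (rule sum.swap)
  also have "\<dots> = (\<Sum>a<N. \<Sum>b<N. \<Sum>p<N. cnj (\<psi> a) * cnj (\<psi> b) * (w p * dap N B a b p \<psi>))"
    by (intro sum.cong sum.swap refl)
  also have "\<dots> = (\<Sum>a<N. \<Sum>b<N. cnj (\<psi> a) * cnj (\<psi> b) * (\<Sum>p<N. w p * dap N B a b p \<psi>))"
    by (simp only: sum_distrib_left)
  finally show ?thesis by (simp only: dap)
qed

text \<open>The gradient is paired with its own conjugate: its squared length \<open>s\<close>
  becomes a directional derivative, at most \<open>2 * sqrt s\<close> by Cauchy-Schwarz and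
  contraction, whence \<open>sqrt s \<le> 2\<close>.\<close>

lemma csq_dev_le:
  assumes B: "tensor_contraction N B" and \<psi>: "csq N \<psi> = 1"
  shows "csq N (\<lambda>p. dexpv N B p \<psi>) \<le> 2\<^sup>2"
proof -
  define w where "w p = cnj (dexpv N B p \<psi>)" for p
  define s where "s = csq N (\<lambda>p. dexpv N B p \<psi>)"
  have s0: "s \<ge> 0" by (simp add: s_def)
  have ws: "csq N w = (sqrt s)\<^sup>2" using s0 by (simp add: s_def w_def csq_def)
  have bd: "cmod (\<Sum>a<N. \<Sum>b<N. (cnj (\<psi> a) * cnj (\<psi> b)) * ap N B z a b) \<le> 1 * sqrt s"
    if "(\<Sum>c<N. \<Sum>d<N. (cmod (z c d))\<^sup>2) = s" for z
  proof (rule cmod_tensor_pairing_le)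
    show "(\<Sum>a<N. \<Sum>b<N. (cmod (cnj (\<psi> a) * cnj (\<psi> b)))\<^sup>2) \<le> 1\<^sup>2"
      using sum_cmod_tensor[of \<psi> \<psi> N] \<psi> by (simp add: norm_mult)
    have "(\<Sum>a<N. \<Sum>b<N. (cmod (ap N B z a b))\<^sup>2) \<le> s"
      using B that unfolding tensor_contraction_def by metis
    then show "(\<Sum>a<N. \<Sum>b<N. (cmod (ap N B z a b))\<^sup>2) \<le> (sqrt s)\<^sup>2" using s0 by simp
  qed (use s0 in auto)
  have "complex_of_real s = (\<Sum>p<N. w p * dexpv N B p \<psi>)"
    unfolding s_def csq_def of_real_sum complex_norm_square w_def by (simp add: mult.commute)
  also have "\<dots> = (\<Sum>a<N. \<Sum>b<N. (cnj (\<psi> a) * cnj (\<psi> b)) * ap N B (\<lambda>c d. w c * \<psi> d) a b)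
      + (\<Sum>a<N. \<Sum>b<N. (cnj (\<psi> a) * cnj (\<psi> b)) * ap N B (\<lambda>c d. \<psi> c * w d) a b)"
    unfolding sum_dev by (simp add: distrib_left sum.distrib)
  also have "cmod \<dots> \<le> 1 * sqrt s + 1 * sqrt s"
    using ws \<psi> s0 by (intro norm_triangle_mono bd) (simp_all add: sum_cmod_tensor)
  finally have le: "sqrt s * sqrt s \<le> 2 * sqrt s" using s0 by simp
  have "sqrt s \<le> 2"
  proof (cases "sqrt s = 0")
    case False
    then have "sqrt s > 0" using s0 by simp
    then show ?thesis using le by (metis mult_right_le_imp_le)
  qed simp
  then have "s \<le> 2\<^sup>2" by (rule sqrt_le_D)
  then show ?thesis by (simp add: s_def)
qed

text \<open>Contracting one index of a tensor of norm at most one with a unit vector leaves a vector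
  of norm at most one; the gradient contributes the factor \<open>2\<close>.\<close>

lemma cmod_ap_dev_le:
  assumes B: "tensor_contraction N B" and \<psi>: "csq N \<psi> = 1"
  shows "cmod (\<Sum>a<N. \<Sum>b<N. cnj (\<psi> a) * ap N B (\<lambda>c d. \<psi> c * \<psi> d) a b * dexpv N B b \<psi>) \<le> 2"
proof -
  have "(\<Sum>a<N. \<Sum>b<N. cnj (\<psi> a) * ap N B (\<lambda>c d. \<psi> c * \<psi> d) a b * dexpv N B b \<psi>)
     = (\<Sum>b<N. (\<Sum>a<N. cnj (\<psi> a) * ap N B (\<lambda>c d. \<psi> c * \<psi> d) a b) * dexpv N B b \<psi>)"
    by (subst sum.swap) (simp add: sum_distrib_right)
  also have "cmod \<dots> \<le> 1 * 2"
  proof (rule cmod_sum_mult_le)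
    have "csq N (\<lambda>b. \<Sum>a<N. cnj (\<psi> a) * ap N B (\<lambda>c d. \<psi> c * \<psi> d) a b)
       \<le> (\<Sum>a<N. \<Sum>b<N. (cmod (ap N B (\<lambda>c d. \<psi> c * \<psi> d) a b))\<^sup>2)"
      using \<psi> by (intro csq_partial_le) (simp add: csq_def)
    also have "\<dots> \<le> (\<Sum>c<N. \<Sum>d<N. (cmod (\<psi> c * \<psi> d))\<^sup>2)"
      using B unfolding tensor_contraction_def by blast
    also have "\<dots> = 1" by (simp only: sum_cmod_tensor \<psi>)
    finally show "(\<Sum>b<N. (cmod (\<Sum>a<N. cnj (\<psi> a) * ap N B (\<lambda>c d. \<psi> c * \<psi> d) a b))\<^sup>2) \<le> 1\<^sup>2"
      by (simp add: csq_def)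
    show "(\<Sum>i<N. (cmod (dexpv N B i \<psi>))\<^sup>2) \<le> 2\<^sup>2" using csq_dev_le[OF B \<psi>] by (simp add: csq_def)
  qed auto
  finally show ?thesis by simp
qed

text \<open>The divergence is a sum over \<open>b\<close> of slices of \<open>B\<close> applied to
  \<open>e b \<otimes> \<psi>\<close> and \<open>\<psi> \<otimes> e b\<close>. Each of these
  \<open>2 * N\<close> slices has norm at most one and meets a gradient of norm at most two.\<close>

lemma cmod_dv_dev_le:
  assumes B: "tensor_contraction N B" and \<psi>: "csq N \<psi> = 1"
  shows "cmod (\<Sum>a<N. dv N B \<psi> a * dexpv N B a \<psi>) \<le> 4 * real N"
proof -
  have bd: "cmod (\<Sum>a<N. ap N B w a b * dexpv N B a \<psi>) \<le> 1 * 2"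
    if b: "b < N" and w: "(\<Sum>c<N. \<Sum>d<N. (cmod (w c d))\<^sup>2) = 1" for w b
  proof (rule cmod_sum_mult_le)
    have "(\<Sum>a<N. (cmod (ap N B w a b))\<^sup>2) \<le> (\<Sum>a<N. \<Sum>b<N. (cmod (ap N B w a b))\<^sup>2)"
      using b by (intro sum_mono member_le_sum[of b _ "\<lambda>b. (cmod (ap N B w _ b))\<^sup>2"]) auto
    also have "\<dots> \<le> 1" using B w unfolding tensor_contraction_def by metis
    finally show "(\<Sum>a<N. (cmod (ap N B w a b))\<^sup>2) \<le> 1\<^sup>2" by simp
    show "(\<Sum>i<N. (cmod (dexpv N B i \<psi>))\<^sup>2) \<le> 2\<^sup>2" using csq_dev_le[OF B \<psi>] by (simp add: csq_def)
  qed auto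
  define e :: "nat \<Rightarrow> nat \<Rightarrow> complex" where "e b c = (if c = b then 1 else 0)" for b c
  have e1: "csq N (e b) = 1" if "b < N" for b
  proof -
    have "csq N (e b) = (\<Sum>c<N. if c = b then 1 else 0)" unfolding csq_def e_def by (intro sum.cong) auto
    then show ?thesis using that by simp
  qed
  have dap: "dap N B a b b \<psi> = ap N B (\<lambda>c d. e b c * \<psi> d) a b + ap N B (\<lambda>c d. \<psi> c * e b d) a b"
    if b: "b < N" for a b
  proof -
    have "ap N B (\<lambda>c d. e b c * \<psi> d) a b = (\<Sum>c<N. if c = b then \<Sum>d<N. B a b c d * \<psi> d else 0)"
      unfolding ap_def e_def by (intro sum.cong) auto
    moreover have "ap N B (\<lambda>c d. \<psi> c * e b d) a b = (\<Sum>c<N. \<Sum>d<N. if d = b then B a b c d * \<psi> c else 0)"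
      unfolding ap_def e_def by (intro sum.cong) auto
    ultimately show ?thesis using b by (simp add: dap_def)
  qed
  have "(\<Sum>a<N. dv N B \<psi> a * dexpv N B a \<psi>) = (\<Sum>a<N. \<Sum>b<N. dap N B a b b \<psi> * dexpv N B a \<psi>)"
    by (simp add: dv_def sum_distrib_right)
  also have "\<dots> = (\<Sum>b<N. \<Sum>a<N. dap N B a b b \<psi> * dexpv N B a \<psi>)" by (rule sum.swap)
  also have "\<dots> = (\<Sum>b<N. (\<Sum>a<N. ap N B (\<lambda>c d. e b c * \<psi> d) a b * dexpv N B a \<psi>)
      + (\<Sum>a<N. ap N B (\<lambda>c d. \<psi> c * e b d) a b * dexpv N B a \<psi>))"
    by (intro sum.cong refl) (simp add: dap distrib_right sum.distrib)
  also have "cmod \<dots> \<le> (\<Sum>b<N. 1 * 2 + 1 * 2)"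
    using \<psi> e1 by (intro sum_norm_le norm_triangle_mono bd) (auto simp: sum_cmod_tensor)
  finally show ?thesis by simp
qed

lemma integral_double_sum:
  fixes f :: "nat \<Rightarrow> nat \<Rightarrow> 'a \<Rightarrow> complex"
  assumes "\<And>a b. a < N \<Longrightarrow> b < N \<Longrightarrow> integrable M (f a b)"
  shows "(\<integral>x. (\<Sum>a<N. \<Sum>b<N. f a b x) \<partial>M) = (\<Sum>a<N. \<Sum>b<N. \<integral>x. f a b x \<partial>M)"
proof -
  have "(\<integral>x. (\<Sum>a<N. \<Sum>b<N. f a b x) \<partial>M) = (\<Sum>a<N. \<integral>x. (\<Sum>b<N. f a b x) \<partial>M)"
    using assms by (intro Bochner_Integration.integral_sum Bochner_Integration.integrable_sum) auto
  also have "\<dots> = (\<Sum>a<N. \<Sum>b<N. \<integral>x. f a b x \<partial>M)"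
    using assms by (intro sum.cong refl Bochner_Integration.integral_sum) auto
  finally show ?thesis .
qed

theorem haar_like_variance:
  assumes N: "1 \<le> N" and M: "haar_like N M" and B: "tensor_contraction N B"
    and real: "\<And>\<psi>. \<psi> \<in> pure_states N \<Longrightarrow> expv N B \<psi> = of_real (g \<psi>)"
  shows "(\<integral>\<psi>. (g \<psi>)\<^sup>2 \<partial>M) \<le> (\<integral>\<psi>. g \<psi> \<partial>M)\<^sup>2 + 6 / real N"
proof -
  interpret prob_space M using M by (simp add: haar_like_def)
  have sp: "space M = pure_states N" by (rule haar_like_space[OF M])
  let ?F = "\<lambda>a b \<psi>. ap N B (\<lambda>c d. \<psi> c * \<psi> d) a b"
  let ?f = "expv N B"
  define h where "h \<psi> = (\<Sum>a<N. cnj (\<psi> a) * dv N B \<psi> a)" for \<psi>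
  define T where "T = (\<Sum>a<N. ddv N B a a)"
  have fs: "G \<psi> * ?f \<psi> = (\<Sum>a<N. \<Sum>b<N. cnj (\<psi> b) * (cnj (\<psi> a) * (?F a b \<psi> * G \<psi>)))" for G \<psi>
    by (simp add: expv_def sum_distrib_left mult_ac)
  have f1: "?f \<psi> = (\<Sum>a<N. \<Sum>b<N. cnj (\<psi> b) * (cnj (\<psi> a) * ?F a b \<psi>))" for \<psi>
    using fs[of "\<lambda>_. 1"] by simp
  have hb: "(\<Sum>a<N. \<Sum>b<N. cnj (\<psi> a) * dap N B a b b \<psi>) = h \<psi>" for \<psi>
    by (simp add: h_def dv_def sum_distrib_left)
  have p1: "bip N (Suc 0) (\<lambda>\<psi>. cnj (\<psi> a) * ?F a b \<psi>) (\<lambda>p \<psi>. cnj (\<psi> a) * dap N B a b p \<psi>)" if "a < N" for a b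
    by (intro bip_cnj_mult bip_ap that)
  \<comment> \<open>Splitting off \<open>cnj (\<psi> b)\<close> leaves one conjugate factor, so the
    multiplier is \<open>N + 1\<close>. The next application splits the only conjugate factor off
    \<open>h\<close>, so its multiplier is \<open>N\<close>.\<close>
  have "of_nat (N + 1) * (\<integral>\<psi>. ?f \<psi> \<partial>M) = (\<Sum>a<N. \<Sum>b<N. of_nat (N + 1) * (\<integral>\<psi>. cnj (\<psi> b) * (cnj (\<psi> a) * ?F a b \<psi>) \<partial>M))"
    unfolding f1 by (subst integral_double_sum, rule bip_integrable(2)[OF M p1], assumption)
      (simp only: sum_distrib_left)
  also have "\<dots> = (\<Sum>a<N. \<Sum>b<N. \<integral>\<psi>. cnj (\<psi> a) * dap N B a b b \<psi> \<partial>M)"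
    using bip_stein[OF M p1] by (intro sum.cong refl) simp
  also have "\<dots> = (\<integral>\<psi>. (\<Sum>a<N. \<Sum>b<N. cnj (\<psi> a) * dap N B a b b \<psi>) \<partial>M)"
    by (rule integral_double_sum[symmetric]) (rule bip_integrable(3)[OF M p1])
  finally have e1: "of_nat (N + 1) * (\<integral>\<psi>. ?f \<psi> \<partial>M) = (\<integral>\<psi>. h \<psi> \<partial>M)" unfolding hb .
  have "of_nat N * (\<integral>\<psi>. h \<psi> \<partial>M) = (\<Sum>a<N. of_nat (N + 0) * (\<integral>\<psi>. cnj (\<psi> a) * dv N B \<psi> a \<partial>M))"
    unfolding h_def by (subst Bochner_Integration.integral_sum, rule bip_integrable(2)[OF M bip_dv])
      (auto simp: sum_distrib_left)
  also have "\<dots> = (\<Sum>a<N. \<integral>\<psi>. ddv N B a a \<partial>M)"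
    by (intro sum.cong refl bip_stein[OF M bip_dv]) auto
  finally have e2: "of_nat N * (\<integral>\<psi>. h \<psi> \<partial>M) = T" by (simp add: T_def prob_space)
  \<comment> \<open>Beside \<open>cnj (\<psi> b)\<close> there remain three conjugate factors, one
    from \<open>cnj (\<psi> a)\<close> and two from \<open>?f\<close>; this produces the multiplier
    \<open>N + 3\<close>, and \<open>N + 2\<close> once \<open>cnj (\<psi> a)\<close> is split off
    as well.\<close>
  have p3: "bip N (Suc (0 + 2)) (\<lambda>\<psi>. cnj (\<psi> a) * (?F a b \<psi> * ?f \<psi>))
      (\<lambda>p \<psi>. cnj (\<psi> a) * (dap N B a b p \<psi> * ?f \<psi> + ?F a b \<psi> * dexpv N B p \<psi>))" if "a < N" for a b
    by (intro bip_cnj_mult bip_mult bip_ap bip_ev that)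
  \<comment> \<open>Here, and in \<open>r'\<close> below, are the terms in which the derivative
    falls on the second factor \<open>?f\<close>; the others repeat the computation of the
    mean.\<close>
  define r where "r \<psi> = (\<Sum>a<N. \<Sum>b<N. cnj (\<psi> a) * ?F a b \<psi> * dexpv N B b \<psi>)" for \<psi>
  have D3: "(\<Sum>a<N. \<Sum>b<N. cnj (\<psi> a) * (dap N B a b b \<psi> * ?f \<psi> + ?F a b \<psi> * dexpv N B b \<psi>)) = h \<psi> * ?f \<psi> + r \<psi>" for \<psi>
    unfolding hb[symmetric] r_def by (simp add: distrib_left sum.distrib sum_distrib_right mult.assoc)
  have "of_nat (N + 3) * (\<integral>\<psi>. ?f \<psi> * ?f \<psi> \<partial>M) = (\<Sum>a<N. \<Sum>b<N. of_nat (N + Suc (0 + 2)) * (\<integral>\<psi>. cnj (\<psi> b) * (cnj (\<psi> a) * (?F a b \<psi> * ?f \<psi>)) \<partial>M))"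
    unfolding fs by (subst integral_double_sum, rule bip_integrable(2)[OF M p3], assumption)
      (simp add: sum_distrib_left add.commute)
  also have "\<dots> = (\<Sum>a<N. \<Sum>b<N. \<integral>\<psi>. cnj (\<psi> a) * (dap N B a b b \<psi> * ?f \<psi> + ?F a b \<psi> * dexpv N B b \<psi>) \<partial>M)"
    using bip_stein[OF M p3] by (intro sum.cong refl) simp
  also have "\<dots> = (\<integral>\<psi>. (\<Sum>a<N. \<Sum>b<N. cnj (\<psi> a) * (dap N B a b b \<psi> * ?f \<psi> + ?F a b \<psi> * dexpv N B b \<psi>)) \<partial>M)"
    by (rule integral_double_sum[symmetric]) (rule bip_integrable(3)[OF M p3])
  finally have e3': "of_nat (N + 3) * (\<integral>\<psi>. ?f \<psi> * ?f \<psi> \<partial>M) = (\<integral>\<psi>. h \<psi> * ?f \<psi> + r \<psi> \<partial>M)" unfolding D3 .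
  have p4: "bip N (0 + 2) (\<lambda>\<psi>. dv N B \<psi> a * ?f \<psi>) (\<lambda>p \<psi>. ddv N B a p * ?f \<psi> + dv N B \<psi> a * dexpv N B p \<psi>)" if "a < N" for a
    by (intro bip_mult bip_dv bip_ev that)
  have hf: "h \<psi> * ?f \<psi> = (\<Sum>a<N. cnj (\<psi> a) * (dv N B \<psi> a * ?f \<psi>))" for \<psi>
    by (simp add: h_def sum_distrib_right mult.assoc)
  define r' where "r' \<psi> = (\<Sum>a<N. dv N B \<psi> a * dexpv N B a \<psi>)" for \<psi>
  have D4: "(\<Sum>a<N. ddv N B a a * ?f \<psi> + dv N B \<psi> a * dexpv N B a \<psi>) = T * ?f \<psi> + r' \<psi>" for \<psi>
    by (simp add: T_def r'_def sum.distrib sum_distrib_right)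
  have hfi: "integrable M (\<lambda>\<psi>. h \<psi> * ?f \<psi>)"
    unfolding hf using bip_integrable(2)[OF M p4] by (intro Bochner_Integration.integrable_sum) auto
  have fi: "integrable M ?f" by (rule bip_integrable(1)[OF M bip_ev])
  have ri: "integrable M r"
  proof -
    have "integrable M (\<lambda>\<psi>. (\<Sum>a<N. \<Sum>b<N. cnj (\<psi> a) * (dap N B a b b \<psi> * ?f \<psi> + ?F a b \<psi> * dexpv N B b \<psi>)))"
      using bip_integrable(3)[OF M p3] by (intro Bochner_Integration.integrable_sum) auto
    then have "integrable M (\<lambda>\<psi>. h \<psi> * ?f \<psi> + r \<psi>)" unfolding D3 .
    from Bochner_Integration.integrable_diff[OF this hfi] show ?thesis by simp
  qed
  have r'i: "integrable M r'"
  proof -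
    have "integrable M (\<lambda>\<psi>. (\<Sum>a<N. ddv N B a a * ?f \<psi> + dv N B \<psi> a * dexpv N B a \<psi>))"
      using bip_integrable(3)[OF M p4] by (intro Bochner_Integration.integrable_sum) auto
    then have "integrable M (\<lambda>\<psi>. T * ?f \<psi> + r' \<psi>)" unfolding D4 .
    from Bochner_Integration.integrable_diff[OF this integrable_mult_right[OF fi, of T]] show ?thesis by simp
  qed
  have e3: "of_nat (N + 3) * (\<integral>\<psi>. ?f \<psi> * ?f \<psi> \<partial>M) = (\<integral>\<psi>. h \<psi> * ?f \<psi> \<partial>M) + (\<integral>\<psi>. r \<psi> \<partial>M)"
    using e3' hfi ri by simp
  have "of_nat (N + 2) * (\<integral>\<psi>. h \<psi> * ?f \<psi> \<partial>M) = (\<Sum>a<N. of_nat (N + (0 + 2)) * (\<integral>\<psi>. cnj (\<psi> a) * (dv N B \<psi> a * ?f \<psi>) \<partial>M))"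
    unfolding hf by (subst Bochner_Integration.integral_sum, rule bip_integrable(2)[OF M p4])
      (auto simp: sum_distrib_left)
  also have "\<dots> = (\<Sum>a<N. \<integral>\<psi>. ddv N B a a * ?f \<psi> + dv N B \<psi> a * dexpv N B a \<psi> \<partial>M)"
    by (intro sum.cong refl bip_stein[OF M p4]) auto
  also have "\<dots> = (\<integral>\<psi>. (\<Sum>a<N. ddv N B a a * ?f \<psi> + dv N B \<psi> a * dexpv N B a \<psi>) \<partial>M)"
    using bip_integrable(3)[OF M p4] by (intro Bochner_Integration.integral_sum[symmetric]) auto
  also have "\<dots> = T * (\<integral>\<psi>. ?f \<psi> \<partial>M) + (\<integral>\<psi>. r' \<psi> \<partial>M)" unfolding D4 using fi r'i by simp
  finally have e4: "of_nat (N + 2) * (\<integral>\<psi>. h \<psi> * ?f \<psi> \<partial>M) = T * (\<integral>\<psi>. ?f \<psi> \<partial>M) + (\<integral>\<psi>. r' \<psi> \<partial>M)" .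
  have bound: "cmod (\<integral>\<psi>. q \<psi> \<partial>M) \<le> K" if "integrable M q" "\<And>\<psi>. \<psi> \<in> pure_states N \<Longrightarrow> cmod (q \<psi>) \<le> K" for q K
  proof -
    have "cmod (\<integral>\<psi>. q \<psi> \<partial>M) \<le> (\<integral>\<psi>. cmod (q \<psi>) \<partial>M)" by (rule integral_norm_bound)
    also have "\<dots> \<le> (\<integral>\<psi>. K \<partial>M)" using that sp by (intro integral_mono integrable_norm) auto
    finally show ?thesis by (simp add: prob_space)
  qed
  have rb: "cmod (\<integral>\<psi>. r \<psi> \<partial>M) \<le> 2"
    using ri cmod_ap_dev_le[OF B] unfolding r_def by (intro bound) (auto simp: pure_states_iff)
  have r'b: "cmod (\<integral>\<psi>. r' \<psi> \<partial>M) \<le> 4 * real N"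
    using r'i cmod_dv_dev_le[OF B] unfolding r'_def by (intro bound) (auto simp: pure_states_iff)
  define m where "m = (\<integral>\<psi>. g \<psi> \<partial>M)"
  define S where "S = (\<integral>\<psi>. (g \<psi>)\<^sup>2 \<partial>M)"
  have mc: "(\<integral>\<psi>. ?f \<psi> \<partial>M) = of_real m"
    unfolding m_def integral_complex_of_real[symmetric] using real sp by (intro Bochner_Integration.integral_cong) auto
  have Sc: "(\<integral>\<psi>. ?f \<psi> * ?f \<psi> \<partial>M) = of_real S"
    unfolding S_def integral_complex_of_real[symmetric] using real sp
    by (intro Bochner_Integration.integral_cong) (auto simp: power2_eq_square)
  \<comment> \<open>The trace is eliminated in favour of the mean, so the main term is compared with
    \<open>m^2\<close> directly and \<open>T\<close> is never estimated.\<close>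
  have Tm: "T = of_nat (N * (N + 1)) * of_real m" using e1 e2 mc by (metis mult.assoc of_nat_mult)
  have "of_nat (N + 2) * (of_nat (N + 3) * of_real S) =
      of_nat (N * (N + 1)) * of_real m * of_real m + ((\<integral>\<psi>. r' \<psi> \<partial>M) + of_nat (N + 2) * (\<integral>\<psi>. r \<psi> \<partial>M))"
    using e3 e4 unfolding Sc mc Tm by (simp only: distrib_left add.assoc)
  then have eq: "complex_of_real (real (N + 2) * real (N + 3) * S - real (N * (N + 1)) * m\<^sup>2)
      = (\<integral>\<psi>. r' \<psi> \<partial>M) + of_nat (N + 2) * (\<integral>\<psi>. r \<psi> \<partial>M)"
    by (simp add: power2_eq_square mult.assoc)
  have "\<bar>real (N + 2) * real (N + 3) * S - real (N * (N + 1)) * m\<^sup>2\<bar> \<le> 4 * real N + real (N + 2) * 2"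
  proof -
    have "cmod ((\<integral>\<psi>. r' \<psi> \<partial>M) + of_nat (N + 2) * (\<integral>\<psi>. r \<psi> \<partial>M)) \<le> 4 * real N + real (N + 2) * 2"
    proof (rule norm_triangle_mono[OF r'b])
      show "cmod (of_nat (N + 2) * (\<integral>\<psi>. r \<psi> \<partial>M)) \<le> real (N + 2) * 2"
        unfolding norm_mult norm_of_nat using rb by (intro mult_left_mono) auto
    qed
    then show ?thesis unfolding eq[symmetric] norm_of_real .
  qed
  then have le: "real (N + 2) * real (N + 3) * S \<le> real (N * (N + 1)) * m\<^sup>2 + (4 * real N + real (N + 2) * 2)"
    by linarith
  \<comment> \<open>The error bounds add up to \<open>6 N + 4\<close>, which is at most
    \<open>6 (N + 2) (N + 3) / N\<close>, while \<open>N (N + 1) \<le> (N + 2) (N + 3)\<close>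
    handles the main term.\<close>
  also have "\<dots> \<le> real (N + 2) * real (N + 3) * (m\<^sup>2 + 6 / real N)"
  proof -
    have "real (N * (N + 1)) * m\<^sup>2 \<le> real (N + 2) * real (N + 3) * m\<^sup>2"
      by (intro mult_right_mono) (auto simp: algebra_simps)
    moreover have "4 * real N + real (N + 2) * 2 \<le> real (N + 2) * real (N + 3) * (6 / real N)"
      using N by (simp add: field_simps)
    ultimately show ?thesis by (simp add: distrib_left)
  qed
  finally have "S \<le> m\<^sup>2 + 6 / real N"
    by (rule mult_left_le_imp_le) simp
  then show ?thesis by (simp add: S_def m_def)
qed

section \<open>Moments, approximate designs and query complexity\<close>

text \<open>Coordinates of the tensor power of a state. The base \<open>N\<close> digits of the
  index are read from the most significant one, matching the recursion of \<open>mat_tpow\<close>,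
  so that the power of a rank-one matrix factors as a vector times its adjoint.\<close>

fun tpow_vec :: "nat \<Rightarrow> nat \<Rightarrow> (nat \<Rightarrow> complex) \<Rightarrow> nat \<Rightarrow> complex" where
  "tpow_vec N 0 \<psi> i = 1"
| "tpow_vec N (Suc s) \<psi> i = \<psi> (i div N ^ s) * tpow_vec N s \<psi> (i mod N ^ s)"

lemma mat_tpow_carrier: "mat_tpow s (rho N \<psi>) \<in> carrier_mat (N ^ s) (N ^ s)"
proof (induction s)
  case (Suc s)
  then show ?case by (auto simp: kron_def rho_def)
qed simp

lemma mat_tpow_rho_index:
  assumes "i < N ^ s" "j < N ^ s"
  shows "mat_tpow s (rho N \<psi>) $$ (i, j) = tpow_vec N s \<psi> i * cnj (tpow_vec N s \<psi> j)"
  using assms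
proof (induction s arbitrary: i j)
  case 0
  then show ?case by simp
next
  case (Suc s)
  have dims: "dim_row (mat_tpow s (rho N \<psi>)) = N ^ s" "dim_col (mat_tpow s (rho N \<psi>)) = N ^ s"
    using mat_tpow_carrier[of s N \<psi>] by auto
  have "N ^ s > 0" using Suc.prems(1) by (cases "N ^ s = 0") auto
  then have m: "i mod N ^ s < N ^ s" "j mod N ^ s < N ^ s" by auto
  have d: "i div N ^ s < N" "j div N ^ s < N"
    using Suc.prems by (auto intro!: less_mult_imp_div_less)
  have "mat_tpow (Suc s) (rho N \<psi>) $$ (i, j) = rho N \<psi> $$ (i div N ^ s, j div N ^ s)
      * mat_tpow s (rho N \<psi>) $$ (i mod N ^ s, j mod N ^ s)"
    using Suc.prems by (simp add: kron_def dims) (simp add: rho_def)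
  also have "\<dots> = \<psi> (i div N ^ s) * cnj (\<psi> (j div N ^ s)) *
      (tpow_vec N s \<psi> (i mod N ^ s) * cnj (tpow_vec N s \<psi> (j mod N ^ s)))"
    using d Suc.IH[OF m] by (simp add: rho_def)
  finally show ?case by (simp add: mult_ac)
qed

lemma tpow_vec_measurable [measurable]: "(\<lambda>\<psi>. tpow_vec N s \<psi> i) \<in> borel_measurable (state_space N)"
  by (induction s arbitrary: i) auto

lemma tpow_vec_le_1: "\<psi> \<in> pure_states N \<Longrightarrow> cmod (tpow_vec N s \<psi> i) \<le> 1"
proof (induction s arbitrary: i)
  case (Suc s)
  then show ?case using pure_state_component_le[OF Suc.prems]
    by (auto simp: norm_mult intro!: mult_le_one)
qed simp

lemma state_measure_space: "is_state_measure N M \<Longrightarrow> space M = pure_states N"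
  using sets_eq_imp_space_eq[of M "state_space N"] by (simp add: is_state_measure_def)

lemma cnj_borel_measurable: "cnj \<in> borel_measurable borel"
  by (intro borel_measurable_continuous_onI continuous_intros)

lemma state_measure_integrable_tpow:
  assumes M: "is_state_measure N M"
  shows "integrable M (\<lambda>\<psi>. tpow_vec N s \<psi> i * cnj (tpow_vec N s \<psi> j))"
proof -
  interpret prob_space M using M by (simp add: is_state_measure_def)
  have sM: "sets M = sets (state_space N)" using M by (simp add: is_state_measure_def)
  have "(\<lambda>\<psi>. tpow_vec N s \<psi> i * cnj (tpow_vec N s \<psi> j)) \<in> borel_measurable (state_space N)"
    by (intro borel_measurable_times tpow_vec_measurable measurable_compose[OF tpow_vec_measurable cnj_borel_measurable])
  then have "(\<lambda>\<psi>. tpow_vec N s \<psi> i * cnj (tpow_vec N s \<psi> j)) \<in> borel_measurable M"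
    unfolding measurable_cong_sets[OF sM refl] .
  moreover have "AE \<psi> in M. norm (tpow_vec N s \<psi> i * cnj (tpow_vec N s \<psi> j)) \<le> 1"
    using tpow_vec_le_1 by (intro AE_I2) (auto simp: state_measure_space[OF M] norm_mult intro!: mult_le_one)
  ultimately show ?thesis by (intro integrable_const_bound)
qed

lemma moment_index:
  assumes "i < N ^ s" "j < N ^ s"
  shows "moment N M s $$ (i, j) = (\<integral>\<psi>. tpow_vec N s \<psi> i * cnj (tpow_vec N s \<psi> j) \<partial>M)"
  using assms by (simp add: moment_def mat_tpow_rho_index)

lemma moment_carrier [simp]: "moment N M s \<in> carrier_mat (N ^ s) (N ^ s)"
  by (simp add: moment_def)

lemma hermitian_moment: "hermitian (N ^ s) (moment N M s)"
proof (rule hermitianI[OF moment_carrier])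
  fix i j assume ij: "i < N ^ s" "j < N ^ s"
  show "cnj (moment N M s $$ (i, j)) = moment N M s $$ (j, i)"
    unfolding moment_index[OF ij] moment_index[OF ij(2,1)]
    by (subst Bochner_Integration.integral_cnj[symmetric]) (simp add: mult.commute)
qed

lemma mtrace_mult:
  assumes "A \<in> carrier_mat n n" "B \<in> carrier_mat n n"
  shows "mtrace (A * B) = (\<Sum>i<n. \<Sum>j<n. A $$ (i, j) * B $$ (j, i))"
  unfolding mtrace_def using assms
  by (auto simp: mat_mult_index[OF assms] simp del: index_mult_mat(1) intro!: sum.cong)

text \<open>Linearity turns a trace against a moment into the expectation of a quadratic form, the
  quantity in which the variance is expressed.\<close>

lemma mtrace_moment_mult:
  assumes M: "is_state_measure N M" and B: "B \<in> carrier_mat (N ^ s) (N ^ s)"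
  shows "mtrace (moment N M s * B) = (\<integral>\<psi>. qform (N ^ s) B (tpow_vec N s \<psi>) \<partial>M)"
proof -
  have "mtrace (moment N M s * B) = (\<Sum>i<N ^ s. \<Sum>j<N ^ s. \<integral>\<psi>. tpow_vec N s \<psi> i * cnj (tpow_vec N s \<psi> j) * B $$ (j, i) \<partial>M)"
    unfolding mtrace_mult[OF moment_carrier B]
    using state_measure_integrable_tpow[OF M] by (intro sum.cong refl) (simp add: moment_index)
  also have "\<dots> = (\<integral>\<psi>. (\<Sum>i<N ^ s. \<Sum>j<N ^ s. tpow_vec N s \<psi> i * cnj (tpow_vec N s \<psi> j) * B $$ (j, i)) \<partial>M)"
    using state_measure_integrable_tpow[OF M] by (intro integral_double_sum[symmetric]) simp
  also have "\<dots> = (\<integral>\<psi>. qform (N ^ s) B (tpow_vec N s \<psi>) \<partial>M)"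
  proof (rule arg_cong[where f = "integral\<^sup>L M"], rule ext)
    fix \<psi>
    show "(\<Sum>i<N ^ s. \<Sum>j<N ^ s. tpow_vec N s \<psi> i * cnj (tpow_vec N s \<psi> j) * B $$ (j, i)) = qform (N ^ s) B (tpow_vec N s \<psi>)"
      unfolding qform_def by (subst sum.swap) (simp add: mult_ac)
  qed
  finally show ?thesis .
qed

lemma approx_design_qform:
  assumes M: "is_state_measure N M" and H: "is_state_measure N (haar N)"
    and d: "approx_design N M t \<epsilon>" "s \<le> t"
    and B: "B \<in> carrier_mat (N ^ s) (N ^ s)" "contraction (N ^ s) B"
  shows "cmod ((\<integral>\<psi>. qform (N ^ s) B (tpow_vec N s \<psi>) \<partial>M) - (\<integral>\<psi>. qform (N ^ s) B (tpow_vec N s \<psi>) \<partial>haar N)) \<le> \<epsilon>"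
proof -
  let ?n = "N ^ s" and ?K = "moment N M s" and ?H = "moment N (haar N) s"
  have cD: "?K - ?H \<in> carrier_mat ?n ?n" by (intro minus_carrier_mat moment_carrier)
  have D: "(?K - ?H) $$ (i, j) = ?K $$ (i, j) - ?H $$ (i, j)" if "i < ?n" "j < ?n" for i j
    using that by (intro index_minus_mat) (simp_all add: moment_def)
  have "hermitian ?n (?K - ?H)"
    using hermitian_index[OF hermitian_moment] by (intro hermitianI[OF cD]) (simp add: D)
  then have "cmod (mtrace ((?K - ?H) * B)) \<le> trace_norm (?K - ?H)"
    using B by (intro trace_norm_duality contraction_qform_le) auto
  also have "\<dots> \<le> \<epsilon>" using d by (simp add: approx_design_def)
  also have "mtrace ((?K - ?H) * B) = mtrace (?K * B) - mtrace (?H * B)"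
    unfolding mtrace_mult[OF cD B(1)] mtrace_mult[OF moment_carrier B(1)]
    by (simp add: D left_diff_distrib sum_subtractf)
  finally show ?thesis by (simp only: mtrace_moment_mult[OF M B(1)] mtrace_moment_mult[OF H B(1)])
qed

definition pair_vec :: "nat \<Rightarrow> (nat \<Rightarrow> complex) \<Rightarrow> nat \<Rightarrow> complex" where
  "pair_vec N \<psi> i = \<psi> (i div N) * \<psi> (i mod N)"

lemma pair_vec_index: "b < N \<Longrightarrow> pair_vec N \<psi> (a * N + b) = \<psi> a * \<psi> b"
  by (simp add: pair_vec_def)

lemma qform_cong: "(\<And>i. i < n \<Longrightarrow> v i = w i) \<Longrightarrow> qform n A v = qform n A w"
  unfolding qform_def by (intro sum.cong) auto

lemma tpow_vec_2: "i < N ^ 2 \<Longrightarrow> tpow_vec N 2 \<psi> i = pair_vec N \<psi> i"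
  by (simp add: numeral_2_eq_2 pair_vec_def)

text \<open>Four base \<open>N\<close> digits are regrouped as two base \<open>N * N\<close> digits,
  so that the fourth tensor power becomes a square of pairs compatible with
  \<open>kron A A\<close>.\<close>

lemma tpow_vec_4:
  assumes "i < N * N" "j < N * N"
  shows "tpow_vec N 4 \<psi> (i * (N * N) + j) = pair_vec N \<psi> i * pair_vec N \<psi> j"
proof -
  have N: "N > 0" using assms by (cases "N = 0") auto
  let ?k = "i * (N * N) + j"
  have gen: "(a * m + b) div m = a" "(a * m + b) mod m = b" if "b < m" for a b m :: nat using that by auto
  have kd: "?k div (N * N) = i" and km: "?k mod (N * N) = j" using gen[OF assms(2)] by auto
  have 1: "?k div N ^ 3 = i div N"
  proof -
    have "N ^ 3 = N * N * N" by (simp add: numeral_3_eq_3)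
    then show ?thesis using kd by (simp add: div_mult2_eq)
  qed
  have 2: "?k mod N ^ 3 = (N * N) * (i mod N) + j"
  proof -
    have "N ^ 3 = N * N * N" by (simp add: numeral_3_eq_3)
    then have "?k mod N ^ 3 = N * N * (?k div (N * N) mod N) + ?k mod (N * N)"
      by (simp only: mod_mult2_eq)
    then show ?thesis by (simp only: kd km)
  qed
  have 3: "((N * N) * (i mod N) + j) div N ^ 2 = i mod N" "((N * N) * (i mod N) + j) mod N ^ 2 = j"
    using gen[OF assms(2), of "i mod N"] by (simp_all add: power2_eq_square mult.commute[of "N * N"])
  have "tpow_vec N (Suc (Suc 2)) \<psi> ?k = \<psi> (?k div N ^ 3) * (\<psi> ((?k mod N ^ 3) div N ^ 2) * tpow_vec N 2 \<psi> ((?k mod N ^ 3) mod N ^ 2))"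
    by (simp only: tpow_vec.simps) (simp add: numeral_3_eq_3 numeral_2_eq_2)
  also have "\<dots> = \<psi> (i div N) * (\<psi> (i mod N) * tpow_vec N 2 \<psi> j)" by (simp only: 1 2 3)
  also have "tpow_vec N 2 \<psi> j = pair_vec N \<psi> j" using assms by (simp add: tpow_vec_2 power2_eq_square)
  finally show ?thesis by (simp add: pair_vec_def numeral_eq_Suc mult.assoc)
qed

lemma qform_tensor:
  assumes A: "A \<in> carrier_mat (N * N) (N * N)"
  shows "qform (N * N) A (pair_vec N \<psi>) = expv N (\<lambda>a b c d. A $$ (a * N + b, c * N + d)) \<psi>"
  unfolding qform_def expv_def ap_def sum_lessThan_mult
  by (intro sum.cong refl) (simp add: pair_vec_index sum_distrib_left mult_ac)

text \<open>This makes the square of an expectation value linear in the fourth moment, with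
  \<open>kron A A\<close> as the observable.\<close>

lemma qform_kron:
  assumes A: "A \<in> carrier_mat n n"
    and v: "\<And>i j. i < n \<Longrightarrow> j < n \<Longrightarrow> v (i * n + j) = w i * w j"
  shows "qform (n * n) (kron A A) v = qform n A w * qform n A w"
proof -
  have "qform (n * n) (kron A A) v =
      (\<Sum>i<n. \<Sum>i'<n. \<Sum>j<n. \<Sum>j'<n. (cnj (w i) * A $$ (i, j) * w j) * (cnj (w i') * A $$ (i', j') * w j'))"
    unfolding qform_def sum_lessThan_mult
    by (intro sum.cong refl) (simp add: v kron_index[OF A A] mult_ac)
  also have "\<dots> = (\<Sum>i<n. \<Sum>i'<n. (\<Sum>j<n. cnj (w i) * A $$ (i, j) * w j) * (\<Sum>j'<n. cnj (w i') * A $$ (i', j') * w j'))"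
    by (simp only: sum_product)
  also have "\<dots> = qform n A w * qform n A w"
    by (simp only: qform_def sum_product)
  finally show ?thesis .
qed

section \<open>Two-copy observables as functions of the state\<close>

lemma two_copy_val_qform:
  assumes A: "A \<in> carrier_mat (N * N) (N * N)"
  shows "two_copy_val N A \<psi> = Re (qform (N * N) A (pair_vec N \<psi>))"
proof -
  have car: "kron (rho N \<psi>) (rho N \<psi>) \<in> carrier_mat (N * N) (N * N)" by (simp add: kron_def rho_def)
  have ix: "kron (rho N \<psi>) (rho N \<psi>) $$ (i, j) = pair_vec N \<psi> i * cnj (pair_vec N \<psi> j)"
    if "i < N * N" "j < N * N" for i j
  proof -
    have "N > 0" using that by (cases "N = 0") auto
    then show ?thesis using that
      by (simp add: kron_def rho_def pair_vec_def less_mult_imp_div_less mult_ac)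
  qed
  have "mtrace (kron (rho N \<psi>) (rho N \<psi>) * A) = qform (N * N) A (pair_vec N \<psi>)"
    unfolding mtrace_mult[OF car A] qform_def
    by (subst sum.swap) (auto simp: ix mult_ac intro!: sum.cong)
  then show ?thesis by (simp add: two_copy_val_def)
qed

lemma hermitian_qform_real:
  assumes A: "hermitian n A"
  shows "qform n A v = of_real (Re (qform n A v))"
proof -
  have "cnj (qform n A v) = (\<Sum>i<n. \<Sum>j<n. cnj (v j) * A $$ (j, i) * v i)"
    unfolding qform_def cnj_sum using hermitian_index[OF A]
    by (intro sum.cong refl) (simp add: mult_ac)
  also have "\<dots> = qform n A v" unfolding qform_def by (rule sum.swap)
  finally show ?thesis by (simp add: complex_eq_iff)
qed

lemma tensor_contraction_of_contraction:
  assumes "contraction (N * N) A"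
  shows "tensor_contraction N (\<lambda>a b c d. A $$ (a * N + b, c * N + d))"
  unfolding tensor_contraction_def
proof
  fix w :: "nat \<Rightarrow> nat \<Rightarrow> complex"
  define w' where "w' i = w (i div N) (i mod N)" for i
  have w': "w' (c * N + d) = w c d" if "d < N" for c d using that by (simp add: w'_def)
  have "(\<Sum>i<N * N. (cmod (\<Sum>j<N * N. A $$ (i, j) * w' j))\<^sup>2) \<le> (\<Sum>j<N * N. (cmod (w' j))\<^sup>2)"
    using assms unfolding contraction_def by blast
  then show "(\<Sum>a<N. \<Sum>b<N. (cmod (ap N (\<lambda>a b c d. A $$ (a * N + b, c * N + d)) w a b))\<^sup>2)
      \<le> (\<Sum>c<N. \<Sum>d<N. (cmod (w c d))\<^sup>2)"
    unfolding sum_lessThan_mult ap_def by (simp add: w')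
qed

lemma csq_pair_vec: "csq (N * N) (pair_vec N \<psi>) = csq N \<psi> * csq N \<psi>"
  unfolding csq_def sum_lessThan_mult sum_product
  by (intro sum.cong refl) (simp add: pair_vec_index norm_mult power_mult_distrib)

lemma observableD:
  assumes "A \<in> observables N"
  shows "hermitian (N * N) A" "A \<in> carrier_mat (N * N) (N * N)" "contraction (N * N) A"
  using assms contraction_of_op_norm by (auto simp: observables_def hermitian_def)

lemma two_copy_val_of_real:
  assumes "A \<in> observables N"
  shows "complex_of_real (two_copy_val N A \<psi>) = qform (N * N) A (pair_vec N \<psi>)"
  using two_copy_val_qform[OF observableD(2)[OF assms]] hermitian_qform_real[OF observableD(1)[OF assms]]
  by simp

lemma two_copy_val_le_1:
  assumes "A \<in> observables N" "\<psi> \<in> pure_states N"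
  shows "\<bar>two_copy_val N A \<psi>\<bar> \<le> 1"
proof -
  have "csq (N * N) (pair_vec N \<psi>) = 1" using assms by (simp add: csq_pair_vec pure_states_iff)
  then have "cmod (qform (N * N) A (pair_vec N \<psi>)) \<le> 1"
    by (intro contraction_qform_le observableD(3)[OF assms(1)]) (simp add: csq_def)
  then show ?thesis unfolding two_copy_val_of_real[OF assms(1), symmetric] norm_of_real .
qed

lemma two_copy_val_integrable:
  assumes M: "is_state_measure N M" and A: "A \<in> observables N"
  shows "integrable M (two_copy_val N A)" "integrable M (\<lambda>\<psi>. (two_copy_val N A \<psi>)\<^sup>2)"
proof -
  interpret prob_space M using M by (simp add: is_state_measure_def)
  have sM: "sets M = sets (state_space N)" using M by (simp add: is_state_measure_def)
  have "two_copy_val N A = (\<lambda>\<psi>. Re (\<Sum>i<N * N. \<Sum>j<N * N. cnj (\<psi> (i div N) * \<psi> (i mod N)) * A $$ (i, j) * (\<psi> (j div N) * \<psi> (j mod N))))"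
    by (rule ext) (simp only: two_copy_val_qform[OF observableD(2)[OF A]] qform_def pair_vec_def)
  moreover have "\<dots> \<in> borel_measurable (state_space N)"
    by (intro measurable_compose[OF _ borel_measurable_Re] borel_measurable_sum borel_measurable_times
        measurable_compose[OF _ cnj_borel_measurable] state_space_component) auto
  ultimately have "two_copy_val N A \<in> borel_measurable (state_space N)" by simp
  then have meas [measurable]: "two_copy_val N A \<in> borel_measurable M" unfolding measurable_cong_sets[OF sM refl] .
  have bd: "AE \<psi> in M. norm (two_copy_val N A \<psi>) \<le> 1"
    using two_copy_val_le_1[OF A] by (intro AE_I2) (simp add: state_measure_space[OF M])
  show "integrable M (two_copy_val N A)" using bd by (intro integrable_const_bound) measurable
  have "AE \<psi> in M. norm ((two_copy_val N A \<psi>)\<^sup>2) \<le> 1"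
    using bd by eventually_elim (simp add: abs_square_le_1)
  then show "integrable M (\<lambda>\<psi>. (two_copy_val N A \<psi>)\<^sup>2)" by (intro integrable_const_bound) measurable
qed

text \<open>One \<open>\<epsilon>\<close> comes from the fourth moment tested against
  \<open>kron A A\<close>. The second moment moves the mean by at most \<open>\<epsilon>\<close>,
  and \<open>y^2 - x^2 = (y - x) (y + x)\<close> with both means in \<open>[-1, 1]\<close> turns
  this into \<open>2 * \<epsilon>\<close>.\<close>

theorem approx_design_variance:
  assumes N: "1 \<le> N" and M: "is_state_measure N M" and d: "approx_design N M 4 \<epsilon>"
    and A: "A \<in> observables N"
  shows "prob_space.variance M (two_copy_val N A) \<le> 6 / real N + 3 * \<epsilon>"
proof -
  interpret prob_space M using M by (simp add: is_state_measure_def)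
  let ?X = "two_copy_val N A" and ?H = "haar N"
  have haar: "haar_like N ?H" by (rule haar_like_haar[OF N])
  then have H: "is_state_measure N ?H" by (simp add: haar_like_def is_state_measure_def)
  interpret H: prob_space ?H using H by (simp add: is_state_measure_def)
  note obs = observableD[OF A]
  have val: "complex_of_real (?X \<psi>) = qform (N * N) A (pair_vec N \<psi>)" for \<psi>
    by (rule two_copy_val_of_real[OF A])
  have N2: "N ^ 2 = N * N" by (simp add: power2_eq_square)
  have N4: "N ^ 4 = (N * N) * (N * N)" by (simp add: numeral_eq_Suc)
  have q2: "qform (N ^ 2) A (tpow_vec N 2 \<psi>) = of_real (?X \<psi>)" for \<psi>
    unfolding val N2 by (rule qform_cong) (simp add: tpow_vec_2 power2_eq_square)
  have q4: "qform (N ^ 4) (kron A A) (tpow_vec N 4 \<psi>) = of_real ((?X \<psi>)\<^sup>2)" for \<psi>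
  proof -
    have "complex_of_real ((?X \<psi>)\<^sup>2) = of_real (?X \<psi>) * of_real (?X \<psi>)" by (simp add: power2_eq_square)
    then show ?thesis
      unfolding N4 val
      using qform_kron[OF obs(2), where v = "tpow_vec N 4 \<psi>" and w = "pair_vec N \<psi>", OF tpow_vec_4]
      by simp
  qed
  have "cmod (of_real (\<integral>\<psi>. ?X \<psi> \<partial>M) - of_real (\<integral>\<psi>. ?X \<psi> \<partial>?H)) \<le> \<epsilon>"
    using approx_design_qform[OF M H d, of 2 A] obs unfolding q2 by (simp add: N2)
  then have m: "\<bar>(\<integral>\<psi>. ?X \<psi> \<partial>M) - (\<integral>\<psi>. ?X \<psi> \<partial>?H)\<bar> \<le> \<epsilon>"
    unfolding of_real_diff[symmetric] norm_of_real .
  have "kron A A \<in> carrier_mat (N ^ 4) (N ^ 4)" using obs(2) unfolding N4 by (auto simp: kron_def)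
  moreover have "contraction (N ^ 4) (kron A A)" unfolding N4 by (rule contraction_kron[OF obs(2,2,3,3)])
  ultimately have "cmod (of_real (\<integral>\<psi>. (?X \<psi>)\<^sup>2 \<partial>M) - of_real (\<integral>\<psi>. (?X \<psi>)\<^sup>2 \<partial>?H)) \<le> \<epsilon>"
    using approx_design_qform[OF M H d, of 4 "kron A A"] unfolding q4 integral_complex_of_real by simp
  then have s: "\<bar>(\<integral>\<psi>. (?X \<psi>)\<^sup>2 \<partial>M) - (\<integral>\<psi>. (?X \<psi>)\<^sup>2 \<partial>?H)\<bar> \<le> \<epsilon>"
    unfolding of_real_diff[symmetric] norm_of_real .
  have hv: "(\<integral>\<psi>. (?X \<psi>)\<^sup>2 \<partial>?H) \<le> (\<integral>\<psi>. ?X \<psi> \<partial>?H)\<^sup>2 + 6 / real N"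
    by (rule haar_like_variance[OF N haar tensor_contraction_of_contraction[OF obs(3)]])
      (simp only: val qform_tensor[OF obs(2)])
  have b1: "\<bar>\<integral>\<psi>. ?X \<psi> \<partial>M\<bar> \<le> 1" if K: "is_state_measure N M" for M
  proof -
    interpret K: prob_space M using K by (simp add: is_state_measure_def)
    have "\<bar>\<integral>\<psi>. ?X \<psi> \<partial>M\<bar> \<le> (\<integral>\<psi>. \<bar>?X \<psi>\<bar> \<partial>M)" by (rule integral_abs_bound)
    also have "\<dots> \<le> (\<integral>\<psi>. 1 \<partial>M)"
      using two_copy_val_integrable[OF K A] two_copy_val_le_1[OF A] state_measure_space[OF K]
      by (intro integral_mono) auto
    finally show ?thesis by (simp add: K.prob_space)
  qed
  define x where "x = (\<integral>\<psi>. ?X \<psi> \<partial>M)"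
  define y where "y = (\<integral>\<psi>. ?X \<psi> \<partial>?H)"
  have "y\<^sup>2 - x\<^sup>2 = (y - x) * (y + x)" by (simp add: algebra_simps power2_eq_square)
  also have "\<dots> \<le> \<bar>y - x\<bar> * \<bar>y + x\<bar>" by (metis abs_ge_self abs_mult)
  also have "\<dots> \<le> \<epsilon> * 2"
    using m b1[OF M] b1[OF H] unfolding x_def[symmetric] y_def[symmetric]
    by (intro mult_mono) auto
  finally have xy: "y\<^sup>2 - x\<^sup>2 \<le> 2 * \<epsilon>" by simp
  have "variance ?X = (\<integral>\<psi>. (?X \<psi>)\<^sup>2 \<partial>M) - x\<^sup>2"
    using two_copy_val_integrable[OF M A] unfolding x_def by (rule variance_eq)
  then show ?thesis using s hv xy unfolding x_def[symmetric] y_def[symmetric] by linarith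
qed

section \<open>Query complexity\<close>

lemma zero_observable: "0\<^sub>m (N * N) (N * N) \<in> observables N" if "1 \<le> N"
proof -
  let ?Z = "0\<^sub>m (N * N) (N * N) :: complex mat"
  have h: "hermitian (N * N) ?Z" by (rule hermitianI) auto
  \<comment> \<open>A unit vector must be exhibited: otherwise the set inside \<open>op_norm\<close>
    could be empty and its supremum unspecified.\<close>
  define e where "e = vec (N * N) (\<lambda>i. if i = 0 then 1 else (0::complex))"
  have "(\<Sum>i<N * N. (cmod (if i = 0 then 1 else 0))\<^sup>2) = (\<Sum>i<N * N. if i = 0 then 1 else (0::real))"
    by (intro sum.cong) auto
  also have "\<dots> = 1" using that by simp
  finally have e: "e \<in> carrier_vec (N * N)" "cvec_norm e = 1" by (simp_all add: e_def cvec_norm_def)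
  have z: "cvec_norm (?Z *\<^sub>v v) = 0" if "v \<in> carrier_vec (N * N)" for v
    using that by (simp add: cvec_norm_def)
  have "{cvec_norm (?Z *\<^sub>v v) | v. v \<in> carrier_vec (dim_col ?Z) \<and> cvec_norm v = 1} = {0}"
    using z e by (auto intro!: exI[of _ e])
  then have "op_norm ?Z = 0" by (simp add: op_norm_def)
  then show ?thesis using h by (simp add: observables_def)
qed

text \<open>The variance bound enters through a free majorant \<open>V\<close>, which the two
  asymptotic regimes choose as a multiple of \<open>1 / N\<close> or of
  \<open>\<epsilon>\<close>.\<close>

lemma q_nt2_ge:
  assumes N: "1 \<le> N" and M: "is_state_measure N M" and d: "approx_design N M 4 \<epsilon>"
    and \<tau>: "\<tau> > 0" and V: "6 / real N + 3 * \<epsilon> \<le> V" "V > 0"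
  shows "ereal (\<tau>\<^sup>2 / V) \<le> q_nt2 N M \<tau>"
proof -
  interpret prob_space M using M by (simp add: is_state_measure_def)
  define g where "g A = (\<integral>\<psi>. two_copy_val N A \<psi> \<partial>M)" for A
  let ?p = "\<lambda>A. measure M {\<psi> \<in> space M. \<bar>two_copy_val N A \<psi> - g A\<bar> > \<tau>}"
  let ?S = "SUP A \<in> observables N. ereal (?p A)"
  have "?p A \<le> V / \<tau>\<^sup>2" if A: "A \<in> observables N" for A
  proof -
    note I = two_copy_val_integrable[OF M A]
    have [measurable]: "two_copy_val N A \<in> borel_measurable M" using I(1) by simp
    have "?p A \<le> prob {\<psi> \<in> space M. \<tau> \<le> \<bar>two_copy_val N A \<psi> - g A\<bar>}"
      by (intro finite_measure_mono) auto
    also have "\<dots> \<le> variance (two_copy_val N A) / \<tau>\<^sup>2"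
      unfolding g_def using I \<tau> by (intro Chebyshev_inequality) auto
    also have "\<dots> \<le> V / \<tau>\<^sup>2"
      using approx_design_variance[OF N M d A] V by (intro divide_right_mono) auto
    finally show ?thesis .
  qed
  then have up: "?S \<le> ereal (V / \<tau>\<^sup>2)" by (intro SUP_least) simp
  \<comment> \<open>The inverse on extended reals reverses order from zero upwards, so the supremum
    has to be nonnegative; over an empty set of observables it would be
    \<open>-\<infinity>\<close>.\<close>
  have "0 \<le> ereal (?p (0\<^sub>m (N * N) (N * N)))" by simp
  also have "\<dots> \<le> ?S" by (rule SUP_upper[OF zero_observable[OF N]])
  finally have "inverse (ereal (V / \<tau>\<^sup>2)) \<le> inverse ?S" using up by (rule ereal_inverse_antimono)
  also have "inverse ?S \<le> q_nt2 N M \<tau>" unfolding q_nt2_def by (rule SUP_upper) simp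
  finally show ?thesis using V \<tau> by (simp add: inverse_eq_divide)
qed

theorem mainTheorem9:
  shows
  "(\<exists>C>0. \<forall>N::nat. \<forall>\<epsilon>::real. \<forall>\<mu>. \<forall>A.
       1 \<le> N \<longrightarrow> \<epsilon> \<in> {0<..1} \<longrightarrow> is_state_measure N \<mu> \<longrightarrow>
       approx_design N \<mu> 4 \<epsilon> \<longrightarrow> A \<in> observables N \<longrightarrow>
       prob_space.variance \<mu> (two_copy_val N A) \<le> C * (1 / real N + \<epsilon> + \<epsilon>\<^sup>2))
   \<and> (\<forall>\<epsilon> :: nat \<Rightarrow> real. (\<forall>N. \<epsilon> N \<in> {0<..1}) \<longrightarrow> \<epsilon> \<in> O(\<lambda>N. 1 / real N) \<longrightarrow>
       (\<exists>c>0. \<forall>\<^sub>F N in sequentially. \<forall>\<mu>. \<forall>\<tau>::real.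
          \<tau> \<in> {0<..1} \<longrightarrow> is_state_measure N \<mu> \<longrightarrow> approx_design N \<mu> 4 (\<epsilon> N) \<longrightarrow>
          ereal (c * \<tau>\<^sup>2 * real N) \<le> q_nt2 N \<mu> \<tau>))
   \<and> (\<forall>\<epsilon> :: nat \<Rightarrow> real. (\<forall>N. \<epsilon> N \<in> {0<..1}) \<longrightarrow> \<epsilon> \<in> \<omega>(\<lambda>N. 1 / real N) \<longrightarrow>
       (\<exists>c>0. \<forall>\<^sub>F N in sequentially. \<forall>\<mu>. \<forall>\<tau>::real.
          \<tau> \<in> {0<..1} \<longrightarrow> is_state_measure N \<mu> \<longrightarrow> approx_design N \<mu> 4 (\<epsilon> N) \<longrightarrow>
          ereal (c * \<tau>\<^sup>2 / \<epsilon> N) \<le> q_nt2 N \<mu> \<tau>))"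
proof (intro conjI)
  show "\<exists>C>0. \<forall>N::nat. \<forall>\<epsilon>::real. \<forall>\<mu>. \<forall>A.
       1 \<le> N \<longrightarrow> \<epsilon> \<in> {0<..1} \<longrightarrow> is_state_measure N \<mu> \<longrightarrow>
       approx_design N \<mu> 4 \<epsilon> \<longrightarrow> A \<in> observables N \<longrightarrow>
       prob_space.variance \<mu> (two_copy_val N A) \<le> C * (1 / real N + \<epsilon> + \<epsilon>\<^sup>2)"
  \<comment> \<open>The constant dominates both coefficients \<open>6\<close> and \<open>3\<close>
    of the variance bound.\<close>
  proof (intro exI[of _ 6] conjI allI impI)
    fix N :: nat and \<epsilon> :: real and \<mu> A
    assume *: "1 \<le> N" "\<epsilon> \<in> {0<..1}" "is_state_measure N \<mu>" "approx_design N \<mu> 4 \<epsilon>" "A \<in> observables N"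
    have "prob_space.variance \<mu> (two_copy_val N A) \<le> 6 / real N + 3 * \<epsilon>"
      by (rule approx_design_variance) (use * in auto)
    also have "\<dots> \<le> 6 * (1 / real N + \<epsilon> + \<epsilon>\<^sup>2)" using * by simp
    finally show "prob_space.variance \<mu> (two_copy_val N A) \<le> 6 * (1 / real N + \<epsilon> + \<epsilon>\<^sup>2)" .
  qed simp
next
  show "\<forall>\<epsilon> :: nat \<Rightarrow> real. (\<forall>N. \<epsilon> N \<in> {0<..1}) \<longrightarrow> \<epsilon> \<in> O(\<lambda>N. 1 / real N) \<longrightarrow>
       (\<exists>c>0. \<forall>\<^sub>F N in sequentially. \<forall>\<mu>. \<forall>\<tau>::real.
          \<tau> \<in> {0<..1} \<longrightarrow> is_state_measure N \<mu> \<longrightarrow> approx_design N \<mu> 4 (\<epsilon> N) \<longrightarrow>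
          ereal (c * \<tau>\<^sup>2 * real N) \<le> q_nt2 N \<mu> \<tau>)"
  proof (intro allI impI)
    fix \<epsilon> :: "nat \<Rightarrow> real" assume \<epsilon>: "\<forall>N. \<epsilon> N \<in> {0<..1}" and "\<epsilon> \<in> O(\<lambda>N. 1 / real N)"
    then obtain K where K: "K > 0" "\<forall>\<^sub>F N in sequentially. norm (\<epsilon> N) \<le> K * norm (1 / real N)"
      by (auto elim: landau_o.bigE)
    show "\<exists>c>0. \<forall>\<^sub>F N in sequentially. \<forall>\<mu>. \<forall>\<tau>::real.
          \<tau> \<in> {0<..1} \<longrightarrow> is_state_measure N \<mu> \<longrightarrow> approx_design N \<mu> 4 (\<epsilon> N) \<longrightarrow>
          ereal (c * \<tau>\<^sup>2 * real N) \<le> q_nt2 N \<mu> \<tau>"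
    \<comment> \<open>From \<open>\<epsilon> N \<le> K / N\<close> the variance is at most
      \<open>(6 + 3 * K) / N\<close>.\<close>
    proof (intro exI[of _ "1 / (6 + 3 * K)"] conjI)
      show "\<forall>\<^sub>F N in sequentially. \<forall>\<mu>. \<forall>\<tau>::real.
          \<tau> \<in> {0<..1} \<longrightarrow> is_state_measure N \<mu> \<longrightarrow> approx_design N \<mu> 4 (\<epsilon> N) \<longrightarrow>
          ereal (1 / (6 + 3 * K) * \<tau>\<^sup>2 * real N) \<le> q_nt2 N \<mu> \<tau>"
        using K(2) eventually_ge_at_top[of 1]
      proof (eventually_elim, intro allI impI)
        fix N :: nat and \<mu> and \<tau> :: real
        assume le: "norm (\<epsilon> N) \<le> K * norm (1 / real N)" and N: "1 \<le> N" and \<tau>: "\<tau> \<in> {0<..1}"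
          and M: "is_state_measure N \<mu>" and d: "approx_design N \<mu> 4 (\<epsilon> N)"
        have "\<epsilon> N \<le> K / real N" using le by (simp add: abs_le_iff)
        then have "6 / real N + 3 * \<epsilon> N \<le> (6 + 3 * K) / real N" by (simp add: add_divide_distrib)
        moreover have "(6 + 3 * K) / real N > 0" using K N by simp
        ultimately have "ereal (\<tau>\<^sup>2 / ((6 + 3 * K) / real N)) \<le> q_nt2 N \<mu> \<tau>"
          using \<tau> by (intro q_nt2_ge[OF N M d]) auto
        then show "ereal (1 / (6 + 3 * K) * \<tau>\<^sup>2 * real N) \<le> q_nt2 N \<mu> \<tau>" by simp
      qed
    qed (use K in simp)
  qed
next
  show "\<forall>\<epsilon> :: nat \<Rightarrow> real. (\<forall>N. \<epsilon> N \<in> {0<..1}) \<longrightarrow> \<epsilon> \<in> \<omega>(\<lambda>N. 1 / real N) \<longrightarrow>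
       (\<exists>c>0. \<forall>\<^sub>F N in sequentially. \<forall>\<mu>. \<forall>\<tau>::real.
          \<tau> \<in> {0<..1} \<longrightarrow> is_state_measure N \<mu> \<longrightarrow> approx_design N \<mu> 4 (\<epsilon> N) \<longrightarrow>
          ereal (c * \<tau>\<^sup>2 / \<epsilon> N) \<le> q_nt2 N \<mu> \<tau>)"
  proof (intro allI impI)
    fix \<epsilon> :: "nat \<Rightarrow> real" assume \<epsilon>: "\<forall>N. \<epsilon> N \<in> {0<..1}" and om: "\<epsilon> \<in> \<omega>(\<lambda>N. 1 / real N)"
    have ev: "\<forall>\<^sub>F N in sequentially. norm (\<epsilon> N) \<ge> 1 * norm (1 / real N)"
      using landau_omega.smallD[OF om, of 1] by simp
    show "\<exists>c>0. \<forall>\<^sub>F N in sequentially. \<forall>\<mu>. \<forall>\<tau>::real.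
          \<tau> \<in> {0<..1} \<longrightarrow> is_state_measure N \<mu> \<longrightarrow> approx_design N \<mu> 4 (\<epsilon> N) \<longrightarrow>
          ereal (c * \<tau>\<^sup>2 / \<epsilon> N) \<le> q_nt2 N \<mu> \<tau>"
    \<comment> \<open>Eventually \<open>1 / N \<le> \<epsilon> N\<close>, so the variance is at most
      \<open>(6 + 3) * \<epsilon> N\<close>.\<close>
    proof (intro exI[of _ "1 / 9"] conjI)
      show "\<forall>\<^sub>F N in sequentially. \<forall>\<mu>. \<forall>\<tau>::real.
          \<tau> \<in> {0<..1} \<longrightarrow> is_state_measure N \<mu> \<longrightarrow> approx_design N \<mu> 4 (\<epsilon> N) \<longrightarrow>
          ereal (1 / 9 * \<tau>\<^sup>2 / \<epsilon> N) \<le> q_nt2 N \<mu> \<tau>"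
        using ev eventually_ge_at_top[of 1]
      proof (eventually_elim, intro allI impI)
        fix N :: nat and \<mu> and \<tau> :: real
        assume le: "norm (\<epsilon> N) \<ge> 1 * norm (1 / real N)" and N: "1 \<le> N" and \<tau>: "\<tau> \<in> {0<..1}"
          and M: "is_state_measure N \<mu>" and d: "approx_design N \<mu> 4 (\<epsilon> N)"
        have pos: "\<epsilon> N > 0" using \<epsilon> by simp
        then have "1 / real N \<le> \<epsilon> N" using le by simp
        then have "6 / real N + 3 * \<epsilon> N \<le> 9 * \<epsilon> N" by simp
        then have "ereal (\<tau>\<^sup>2 / (9 * \<epsilon> N)) \<le> q_nt2 N \<mu> \<tau>"
          using \<tau> pos by (intro q_nt2_ge[OF N M d]) auto
        then show "ereal (1 / 9 * \<tau>\<^sup>2 / \<epsilon> N) \<le> q_nt2 N \<mu> \<tau>" by simp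
      qed
    qed simp
  qed
qed

end
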